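(* Let $N\geqslant 2$, let $\Omega\subset\mathbb{R}^N$ be a smooth bounded domain, let $s\in(0,1)$, and let $l,p,m,\mathfrak{m}_1,\mathfrak{m}_2$ be real constants with $1<\mathfrak{m}_1<l\leqslant p\leqslant m<\mathfrak{m}_2<p_s^\star:=\frac{Np}{N-sp}$, $m<\frac{N}{s}$ and $(\mathfrak{m}_2-1)(m-l)<(\mathfrak{m}_2-l)(m-\mathfrak{m}_1)$. Let $\mathcal{A}:\mathbb{R}\to\mathbb{R}$ be odd and of class $C^2$, such that $\mathscr{A}(t):=\int_0^{|t|}\mathcal{A}(\tau)\,d\tau$ is strictly convex on $\mathbb{R}$; such that there are constants $c_{\mathcal{A}},C_{\mathcal{A}}>0$ with $\mathcal{A}(t)t\geqslant c_{\mathcal{A}}|t|^p$ and $|\mathcal{A}(t)|\leqslant C_{\mathcal{A}}|t|^{p-1}$ for all $t\in\mathbb{R}$; and such that for all $t\in\mathbb{R}$: (i) $l\mathscr{A}(t)\leqslant\mathcal{A}(t)t\leqslant p\mathscr{A}(t)$, (ii) $(l-1)\mathcal{A}(t)t\leqslant t^2\mathcal{A}'(t)\leqslant(m-1)\mathcal{A}(t)t$, (iii) $(l-2)\mathcal{A}'(t)\leqslant\mathcal{A}''(t)t\leqslant(m-2)\mathcal{A}'(t)$. Let $K:\mathbb{R}^N\times\mathbb{R}^N\to\mathbb{R}^+$ be measurable with constants $0<b_0\leqslant b_1$ such that $b_0\leqslant K(x,y)|x-y|^{N+sp}\leqslant b_1$ for all $x\neq y$. Let $\mathfrak{a},\mathfrak{b}:\overline\Omega\to\mathbb{R}$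 be (possibly sign-changing) functions in $L^\infty(\Omega)$ with $\mathfrak{a}^+\not\equiv0$ and $\mathfrak{b}^+\not\equiv0$. Then there exists $\tilde\lambda>0$ such that for all $0<\lambda<\tilde\lambda$ the problem $$\mathscr{L}_{\mathcal{A}K}u=\lambda\mathfrak{a}(x)|u|^{\mathfrak{m}_1-2}u+\mathfrak{b}(x)|u|^{\mathfrak{m}_2-2}u\ \text{ in }\Omega,\qquad u=0\ \text{ in }\mathbb{R}^N\setminus\Omega,$$ admits at least one ground state solution $u\in\mathcal{N}^-_{\lambda,1}$, and it satisfies $\mathcal{J}_{\lambda,1}(u)>0$.
   Context: $f^+=\max\{f,0\}$. $W^{s,p}_0(\Omega):=\{u\in W^{s,p}(\mathbb{R}^N): u=0\text{ a.e. in }\mathbb{R}^N\setminus\Omega\}$, with norm $\|u\|=\big(\int_{\mathbb{R}^N\times\mathbb{R}^N}\frac{|u(x)-u(y)|^p}{|x-y|^{N+sp}}dx\,dy\big)^{1/p}$. The operator is $\mathscr{L}_{\mathcal{A}K}u(x)=P.V.\int_{\mathbb{R}^N}\mathcal{A}(u(x)-u(y))K(x,y)\,dy$. A weak solution of the problem is $u\in W^{s,p}_0(\Omega)$ such that for every $v\in W^{s,p}_0(\Omega)$ $$\int_{\mathbb{R}^N\times\mathbb{R}^N}\mathcal{A}(u(x)-u(y))(v(x)-v(y))K(x,y)\,dx\,dy=\int_\Omega\big[\lambda\mathfrak{a}|u|^{\mathfrak{m}_1-2}uv+\mathfrak{b}|u|^{\mathfrak{m}_2-2}uv\big]dx.$$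 The energy functional on $W^{s,p}_0(\Omega)$ is $$\mathcal{J}_{\lambda,1}(u)=\int_{\mathbb{R}^N\times\mathbb{R}^N}\mathscr{A}(u(x)-u(y))K(x,y)\,dx\,dy-\frac{\lambda}{\mathfrak{m}_1}\int_\Omega\mathfrak{a}|u|^{\mathfrak{m}_1}dx-\frac1{\mathfrak{m}_2}\int_\Omega\mathfrak{b}|u|^{\mathfrak{m}_2}dx.$$ The Nehari manifold is $\mathcal{N}_{\lambda,1}=\{u\in W^{s,p}_0(\Omega)\setminus\{0\}:\langle\mathcal{J}'_{\lambda,1}(u),u\rangle=0\}$. For $u\neq0$ the fibering map is $\wp_u(t)=\mathcal{J}_{\lambda,1}(tu)$, $t>0$, with $$\wp_u''(1)=\int_{\mathbb{R}^N\times\mathbb{R}^N}\mathcal{A}'(u(x)-u(y))(u(x)-u(y))^2K(x,y)\,dx\,dy-\lambda(\mathfrak{m}_1-1)\int_\Omega\mathfrak{a}|u|^{\mathfrak{m}_1}dx-(\mathfrak{m}_2-1)\int_\Omega\mathfrak{b}|u|^{\mathfrak{m}_2}dx.$$ $\mathcal{N}^-_{\lambda,1}=\{u\in\mathcal{N}_{\lambda,1}:\wp_u''(1)<0\}$. A ground state solution in $\mathcal{N}^-_{\lambda,1}$ is a weak solution $u\in\mathcal{N}^-_{\lambda,1}$ with $\mathcal{J}_{\lambda,1}(u)=\inf_{\mathcal{N}^-_{\lambda,1}}\mathcal{J}_{\lambda,1}$. *)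

theory Defs
  imports "HOL-Analysis.Analysis"
begin

text \<open>
  Functions are concrete representatives, so two functions that agree almost everywhere stand for
  the same element of a Sobolev or Lebesgue space; in particular ``nonzero'' means ``not almost
  everywhere zero''. Measurability and almost-everywhere statements refer to the Lebesgue measure.
  The double integrals are integrals over the product space with its Lebesgue measure.
\<close>

section \<open>Smooth bounded domains\<close>

primrec Ck :: "nat \<Rightarrow> ('a::euclidean_space \<Rightarrow> real) \<Rightarrow> bool" where
  "Ck 0 f \<longleftrightarrow> continuous_on UNIV f"
| "Ck (Suc k) f \<longleftrightarrow> (\<forall>x. f differentiable (at x)) \<and>
     (\<forall>v. Ck k (\<lambda>x. frechet_derivative f (at x) v))"

definition smooth :: "('a::euclidean_space \<Rightarrow> real) \<Rightarrow> bool" where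
  "smooth f \<longleftrightarrow> (\<forall>k. Ck k f)"

text \<open>
  Near every boundary point the set is, in the direction of some unit vector \<open>e\<close>, the region
  strictly above the graph of a smooth function of the orthogonal projection onto the
  hyperplane normal to \<open>e\<close>.
\<close>

definition smooth_boundary :: "'a::euclidean_space set \<Rightarrow> bool" where
  "smooth_boundary \<Omega> \<longleftrightarrow>
     (\<forall>z\<in>frontier \<Omega>. \<exists>r>0. \<exists>e \<gamma>. norm e = 1 \<and> smooth \<gamma> \<and>
        \<Omega> \<inter> ball z r = {x \<in> ball z r. \<gamma> (x - (x \<bullet> e) *\<^sub>R e) < x \<bullet> e})"

definition smooth_bounded_domain :: "'a::euclidean_space set \<Rightarrow> bool" where
  "smooth_bounded_domain \<Omega> \<longleftrightarrow>
     open \<Omega> \<and> connected \<Omega> \<and> \<Omega> \<noteq> {} \<and> bounded \<Omega> \<and> smooth_boundary \<Omega>"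

section \<open>Function spaces\<close>

definition Linfty :: "'a::euclidean_space set \<Rightarrow> ('a \<Rightarrow> real) set" where
  "Linfty \<Omega> = {f. f \<in> borel_measurable (lebesgue_on \<Omega>) \<and>
     (\<exists>C. AE x in lebesgue_on \<Omega>. \<bar>f x\<bar> \<le> C)}"

definition Wsp :: "real \<Rightarrow> real \<Rightarrow> ('a::euclidean_space \<Rightarrow> real) set" where
  "Wsp s p = {u. u \<in> borel_measurable lebesgue \<and>
     integrable lebesgue (\<lambda>x. \<bar>u x\<bar> powr p) \<and>
     integrable lebesgue (\<lambda>(x::'a, y::'a).
       \<bar>u x - u y\<bar> powr p / norm (x - y) powr (real DIM('a) + s * p))}"

definition Wsp0 :: "real \<Rightarrow> real \<Rightarrow> 'a::euclidean_space set \<Rightarrow> ('a \<Rightarrow> real) set" where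
  "Wsp0 s p \<Omega> = {u \<in> Wsp s p. AE x in lebesgue. x \<notin> \<Omega> \<longrightarrow> u x = 0}"

section \<open>Energy functional and weak solutions\<close>

definition strictly_convex :: "(real \<Rightarrow> real) \<Rightarrow> bool" where
  "strictly_convex f \<longleftrightarrow> (\<forall>x y t. x \<noteq> y \<and> 0 < t \<and> t < 1 \<longrightarrow>
     f ((1 - t) * x + t * y) < (1 - t) * f x + t * f y)"

definition potential :: "(real \<Rightarrow> real) \<Rightarrow> real \<Rightarrow> real" where
  "potential A t = integral {0..\<bar>t\<bar>} A"

definition energy :: "(real \<Rightarrow> real) \<Rightarrow> ('a::euclidean_space \<times> 'a \<Rightarrow> real) \<Rightarrow> 'a set \<Rightarrow>
    real \<Rightarrow> ('a \<Rightarrow> real) \<Rightarrow> ('a \<Rightarrow> real) \<Rightarrow> real \<Rightarrow> real \<Rightarrow> ('a \<Rightarrow> real) \<Rightarrow> real" where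
  "energy A K \<Omega> lam a b m1 m2 u =
     (\<integral>(x, y). potential A (u x - u y) * K (x, y) \<partial>lebesgue)
     - lam / m1 * (LINT x:\<Omega>|lebesgue. a x * \<bar>u x\<bar> powr m1)
     - 1 / m2 * (LINT x:\<Omega>|lebesgue. b x * \<bar>u x\<bar> powr m2)"

text \<open>
  At points where \<open>u x = 0\<close> the term \<open>\<bar>u x\<bar> powr (m1 - 2) * u x\<close> is \<open>0\<close>, also for \<open>m1 < 2\<close>.
\<close>

definition weak_solution :: "real \<Rightarrow> real \<Rightarrow> (real \<Rightarrow> real) \<Rightarrow>
    ('a::euclidean_space \<times> 'a \<Rightarrow> real) \<Rightarrow> 'a set \<Rightarrow> real \<Rightarrow> ('a \<Rightarrow> real) \<Rightarrow> ('a \<Rightarrow> real) \<Rightarrow>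
    real \<Rightarrow> real \<Rightarrow> ('a \<Rightarrow> real) \<Rightarrow> bool" where
  "weak_solution s p A K \<Omega> lam a b m1 m2 u \<longleftrightarrow> u \<in> Wsp0 s p \<Omega> \<and>
     (\<forall>v\<in>Wsp0 s p \<Omega>.
        (\<integral>(x, y). A (u x - u y) * (v x - v y) * K (x, y) \<partial>lebesgue) =
        (LINT x:\<Omega>|lebesgue. lam * a x * \<bar>u x\<bar> powr (m1 - 2) * u x * v x
                           + b x * \<bar>u x\<bar> powr (m2 - 2) * u x * v x))"

section \<open>The Nehari manifold and ground states\<close>

text \<open>
  Since the function spaces are carrier sets rather than normed-space types, the pairing
  \<open>\<langle>J'(u), v\<rangle>\<close> is rendered as the directional (Gateaux) derivative of \<open>J\<close> at \<open>u\<close> along \<open>v\<close>.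
\<close>

definition derivative_pairing ::
    "(('a \<Rightarrow> real) \<Rightarrow> real) \<Rightarrow> ('a \<Rightarrow> real) \<Rightarrow> ('a \<Rightarrow> real) \<Rightarrow> real" where
  "derivative_pairing J u v = deriv (\<lambda>t. J (\<lambda>x. u x + t * v x)) (0::real)"

definition nehari :: "('a::euclidean_space \<Rightarrow> real) set \<Rightarrow> (('a \<Rightarrow> real) \<Rightarrow> real) \<Rightarrow>
    ('a \<Rightarrow> real) set" where
  "nehari W J = {u \<in> W. \<not> (AE x in lebesgue. u x = 0) \<and> derivative_pairing J u u = 0}"

definition fibering :: "(('a \<Rightarrow> real) \<Rightarrow> real) \<Rightarrow> ('a \<Rightarrow> real) \<Rightarrow> real \<Rightarrow> real" where
  "fibering J u t = J (\<lambda>x. t * u x)"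

definition nehari_minus :: "('a::euclidean_space \<Rightarrow> real) set \<Rightarrow> (('a \<Rightarrow> real) \<Rightarrow> real) \<Rightarrow>
    ('a \<Rightarrow> real) set" where
  "nehari_minus W J = {u \<in> nehari W J. deriv (deriv (fibering J u)) 1 < 0}"

text \<open>
  The infimum is taken in the extended reals, so that it is meaningful without knowing in advance
  that the energy is bounded below on the set.
\<close>

definition ground_state_minus :: "real \<Rightarrow> real \<Rightarrow> (real \<Rightarrow> real) \<Rightarrow>
    ('a::euclidean_space \<times> 'a \<Rightarrow> real) \<Rightarrow> 'a set \<Rightarrow> real \<Rightarrow> ('a \<Rightarrow> real) \<Rightarrow> ('a \<Rightarrow> real) \<Rightarrow>
    real \<Rightarrow> real \<Rightarrow> ('a \<Rightarrow> real) \<Rightarrow> bool" where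
  "ground_state_minus s p A K \<Omega> lam a b m1 m2 u \<longleftrightarrow>
     (let J = energy A K \<Omega> lam a b m1 m2; N = nehari_minus (Wsp0 s p \<Omega>) J in
        weak_solution s p A K \<Omega> lam a b m1 m2 u \<and> u \<in> N \<and>
        ereal (J u) = (INF w\<in>N. ereal (J w)))"

end

theory Submission
  imports Defs "HOL-Complex_Analysis.Great_Picard"
begin

text \<open>
  Write \<open>N u\<close> for the weighted Gagliardo energy, \<open>Q u\<close> and \<open>R u\<close> for the two weighted power
  integrals. On \<open>N\<^sup>-\<close> one has \<open>(l - m1) c N u \<le> (m2 - m1) R u\<close>, so \<open>N u\<close> is bounded below
  independently of \<open>lam\<close>, whereas \<open>N u\<close> tends to \<open>0\<close> with \<open>lam\<close> at all other points of the Nehari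
  manifold. Hence for small \<open>lam\<close> each ray carries at most one point of \<open>N\<^sup>-\<close> (between two of them
  the fibering map would have an interior minimum with large \<open>N\<close>), and that point is the global
  maximum of the fibering map, which is positive. Let \<open>u\<close> be an almost everywhere limit of a
  minimising sequence \<open>u_k\<close>, and \<open>t u\<close> the maximum on its ray. By Fatou and compactness
  \<open>J (t u) \<le> liminf J (t u_k) \<le> liminf J (u_k)\<close>, so \<open>t u\<close> is a minimiser. No weak topology is
  needed, and no strong convergence of the minimising sequence.
\<close>

section \<open>Second derivative tests\<close>

text \<open>The kernel part of the energy is not homogeneous, so the fibering map has no explicit
  form. Only \<open>N\<close> is p-homogeneous; the growth bounds and conditions (i), (ii) serve to
  compare the other kernel integrals with it, and every threshold is therefore expressed through
  \<open>N\<close>. The gap comes from two eliminations: removing the \<open>lam\<close> term from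
  the first and second order conditions uses \<open>H \<ge> (l - 1) B\<close>, removing
  \<open>R\<close> uses \<open>H \<le> (m - 1) B\<close>. Since m1 < p < m2, one gives a lower and
  the other an upper bound for \<open>N\<close>, and a degenerate point would have to satisfy both.
  The danger in the limit is that the minimising sequence vanishes. It cannot, because the lower
  bound on \<open>N\<close> is also one on \<open>R\<close>, and \<open>R\<close> passes to the
  limit as m2 is subcritical. The variation of the minimiser must stay on N^-. A perturbed function
  is moved back along its own ray, and maximality on the ray of \<open>u\<close> absorbs the change
  of scale, so no Lagrange multiplier appears.\<close>

lemma strict_local_max_second_derivative:
  fixes f f' :: "real \<Rightarrow> real"
  assumes "0 < x"
    and f: "\<And>t. 0 < t \<Longrightarrow> (f has_real_derivative f' t) (at t)"
    and f': "(f' has_real_derivative l) (at x)" "f' x = 0" "l < 0"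
  shows "\<exists>d>0. \<forall>t. 0 < \<bar>t - x\<bar> \<and> \<bar>t - x\<bar> < d \<longrightarrow> f t < f x"
proof -
  \<comment> \<open>A zero of \<open>f'\<close> at which \<open>f'\<close> has negative derivative
    is a sign change from plus to minus. The mean value theorem on either side turns this into
    strict inequalities for \<open>f\<close>.\<close>
  obtain d1 where d1: "d1 > 0" "\<And>h. 0 < h \<Longrightarrow> h < d1 \<Longrightarrow> f' (x + h) < 0"
    using DERIV_neg_dec_right[OF f'(1,3)] f'(2) by auto
  obtain d2 where d2: "d2 > 0" "\<And>h. 0 < h \<Longrightarrow> h < d2 \<Longrightarrow> 0 < f' (x - h)"
    using DERIV_neg_dec_left[OF f'(1,3)] f'(2) by auto
  define d where "d = min x (min d1 d2)"
  have "f t < f x" if t: "0 < \<bar>t - x\<bar>" "\<bar>t - x\<bar> < d" for t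
  proof (cases "t < x")
    case True
    have pos: "0 < t" using t True by (auto simp: d_def)
    obtain z where z: "t < z" "z < x" "f x - f t = (x - t) * f' z"
      using MVT2[OF True, of f f'] f pos by fastforce
    have "0 < f' z" using d2(2)[of "x - z"] z t True by (auto simp: d_def)
    then show ?thesis using z(3) True by (smt (verit) mult_pos_pos)
  next
    case False
    then have "x < t" using t by auto
    obtain z where z: "x < z" "z < t" "f t - f x = (t - x) * f' z"
      using MVT2[OF \<open>x < t\<close>, of f f'] f \<open>0 < x\<close> by fastforce
    have "f' z < 0" using d1(2)[of "z - x"] z t \<open>x < t\<close> by (auto simp: d_def)
    then show ?thesis using z(3) \<open>x < t\<close> by (smt (verit) mult_pos_neg)
  qed
  then show ?thesis using d1 d2 \<open>0 < x\<close> by (intro exI[of _ d]) (auto simp: d_def)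
qed

text \<open>If \<open>l\<close> were positive, the previous lemma applied to \<open>- f\<close>
  would make \<open>x\<close> a strict local minimum, which contradicts the local maximum at any
  point close to \<open>x\<close>.\<close>

lemma local_max_derivatives:
  fixes f f' :: "real \<Rightarrow> real"
  assumes "0 < x"
    and f: "\<And>t. 0 < t \<Longrightarrow> (f has_real_derivative f' t) (at t)"
    and f': "(f' has_real_derivative l) (at x)"
    and max: "0 < e" "\<And>t. \<bar>t - x\<bar> < e \<Longrightarrow> f t \<le> f x"
  shows "f' x = 0" "l \<le> 0"
proof -
  show 0: "f' x = 0"
    using DERIV_local_max[OF f[OF \<open>0 < x\<close>] \<open>0 < e\<close>] max(2) by (simp add: abs_minus_commute)
  show "l \<le> 0"
  proof (rule ccontr)
    assume "\<not> l \<le> 0"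
    have "\<exists>d>0. \<forall>t. 0 < \<bar>t - x\<bar> \<and> \<bar>t - x\<bar> < d \<longrightarrow> - f t < - f x"
      by (rule strict_local_max_second_derivative[where f'="\<lambda>t. - f' t" and l="-l"])
        (use \<open>0 < x\<close> f f' 0 \<open>\<not> l \<le> 0\<close> in \<open>auto intro!: derivative_eq_intros\<close>)
    then obtain d where d: "d > 0" "\<And>t. 0 < \<bar>t - x\<bar> \<Longrightarrow> \<bar>t - x\<bar> < d \<Longrightarrow> f x < f t" by auto
    define t where "t = x + min d e / 2"
    have "0 < \<bar>t - x\<bar>" "\<bar>t - x\<bar> < d" "\<bar>t - x\<bar> < e" using d(1) max(1) by (auto simp: t_def)
    then show False using d(2)[of t] max(2)[of t] by auto
  qed
qed

lemma local_min_derivatives: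
  fixes f f' :: "real \<Rightarrow> real"
  assumes "0 < x"
    and f: "\<And>t. 0 < t \<Longrightarrow> (f has_real_derivative f' t) (at t)"
    and f': "(f' has_real_derivative l) (at x)"
    and min: "0 < e" "\<And>t. \<bar>t - x\<bar> < e \<Longrightarrow> f x \<le> f t"
  shows "f' x = 0" "0 \<le> l"
  using local_max_derivatives[of x "\<lambda>t. - f t" "\<lambda>t. - f' t" "-l" e] assms
  by (auto intro!: derivative_eq_intros)

section \<open>Integral functionals of power growth\<close>

lemma powr_sum_le:
  fixes x y r :: real
  assumes "0 \<le> x" "0 \<le> y" "0 \<le> r"
  shows "(x + y) powr r \<le> 2 powr r * (x powr r + y powr r)"
proof -
  have "(x + y) powr r \<le> (2 * max x y) powr r"
    using assms by (intro powr_mono2) auto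
  also have "\<dots> = 2 powr r * max x y powr r"
    using assms by (simp add: powr_mult)
  also have "max x y powr r \<le> x powr r + y powr r" by (auto simp: max_def)
  finally show ?thesis by simp
qed

text \<open>The weight may change sign. Integrability is absolute, so for measurable
  \<open>w\<close> this is the Lebesgue space with weight |w|. One notion thus covers the kernel on
  the product space and the weights \<open>a\<close>, \<open>b\<close> on the domain.\<close>

definition weighted_Lp :: "'b measure \<Rightarrow> ('b \<Rightarrow> real) \<Rightarrow> real \<Rightarrow> ('b \<Rightarrow> real) set" where
  "weighted_Lp M w r = {g \<in> borel_measurable M. integrable M (\<lambda>x. w x * \<bar>g x\<bar> powr r)}"

text \<open>The common majorant for the dominated convergence arguments of this section: the scaled
  sum of |g| and |h| dominates all combinations with bounded coefficients.\<close>

lemma weighted_Lp_lincomb_bound: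
  fixes S C :: real
  assumes "r > 0" and w: "w \<in> borel_measurable M"
    and g: "g \<in> weighted_Lp M w r" and h: "h \<in> weighted_Lp M w r" and "0 \<le> S"
  shows "integrable M (\<lambda>x. C * (\<bar>w x\<bar> * (S * (\<bar>g x\<bar> + \<bar>h x\<bar>)) powr r))"
proof -
  have [measurable]: "g \<in> borel_measurable M" "h \<in> borel_measurable M"
    using g h by (auto simp: weighted_Lp_def)
  have "integrable M (\<lambda>x. \<bar>w x * \<bar>g x\<bar> powr r\<bar> + \<bar>w x * \<bar>h x\<bar> powr r\<bar>)"
    using g h by (intro Bochner_Integration.integrable_add integrable_abs) (auto simp: weighted_Lp_def)
  then have I: "integrable M (\<lambda>x. (\<bar>S\<bar> powr r * 2 powr r) * (\<bar>w x * \<bar>g x\<bar> powr r\<bar> + \<bar>w x * \<bar>h x\<bar> powr r\<bar>))"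
    by (rule integrable_mult_right)
  have "integrable M (\<lambda>x. \<bar>w x\<bar> * (S * (\<bar>g x\<bar> + \<bar>h x\<bar>)) powr r)"
  proof (rule Bochner_Integration.integrable_bound[OF I])
    show "(\<lambda>x. \<bar>w x\<bar> * (S * (\<bar>g x\<bar> + \<bar>h x\<bar>)) powr r) \<in> borel_measurable M"
      using w by measurable
    have "(S * (\<bar>g x\<bar> + \<bar>h x\<bar>)) powr r \<le> \<bar>S\<bar> powr r * (2 powr r * (\<bar>g x\<bar> powr r + \<bar>h x\<bar> powr r))" for x
    proof -
      have "(S * (\<bar>g x\<bar> + \<bar>h x\<bar>)) powr r = \<bar>S\<bar> powr r * (\<bar>g x\<bar> + \<bar>h x\<bar>) powr r"
        using \<open>0 \<le> S\<close> by (simp add: powr_mult)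
      also have "\<dots> \<le> \<bar>S\<bar> powr r * (2 powr r * (\<bar>g x\<bar> powr r + \<bar>h x\<bar> powr r))"
        using \<open>r > 0\<close> by (intro mult_left_mono powr_sum_le) auto
      finally show ?thesis .
    qed
    then have le: "\<bar>w x\<bar> * (S * (\<bar>g x\<bar> + \<bar>h x\<bar>)) powr r
        \<le> \<bar>w x\<bar> * (\<bar>S\<bar> powr r * (2 powr r * (\<bar>g x\<bar> powr r + \<bar>h x\<bar> powr r)))" for x
      by (intro mult_left_mono) auto
    have eq: "\<bar>w x\<bar> * (\<bar>S\<bar> powr r * (2 powr r * (\<bar>g x\<bar> powr r + \<bar>h x\<bar> powr r)))
        = (\<bar>S\<bar> powr r * 2 powr r) * (\<bar>w x * \<bar>g x\<bar> powr r\<bar> + \<bar>w x * \<bar>h x\<bar> powr r\<bar>)" for x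
      by (simp add: abs_mult algebra_simps)
    show "AE x in M. norm (\<bar>w x\<bar> * (S * (\<bar>g x\<bar> + \<bar>h x\<bar>)) powr r)
        \<le> norm ((\<bar>S\<bar> powr r * 2 powr r) * (\<bar>w x * \<bar>g x\<bar> powr r\<bar> + \<bar>w x * \<bar>h x\<bar> powr r\<bar>))"
    proof (rule AE_I2)
      fix x
      show "norm (\<bar>w x\<bar> * (S * (\<bar>g x\<bar> + \<bar>h x\<bar>)) powr r)
        \<le> norm ((\<bar>S\<bar> powr r * 2 powr r) * (\<bar>w x * \<bar>g x\<bar> powr r\<bar> + \<bar>w x * \<bar>h x\<bar> powr r\<bar>))"
        unfolding real_norm_def using le[of x] unfolding eq
        by (subst abs_of_nonneg, simp) (rule order_trans[OF _ abs_ge_self])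
    qed
  qed
  then show ?thesis by (rule integrable_mult_right)
qed

lemma weighted_Lp_lincomb:
  assumes "r > 0" and w: "w \<in> borel_measurable M"
    and g: "g \<in> weighted_Lp M w r" and h: "h \<in> weighted_Lp M w r"
  shows "(\<lambda>x. c * g x + d * h x) \<in> weighted_Lp M w r"
proof -
  have [measurable]: "g \<in> borel_measurable M" "h \<in> borel_measurable M" "w \<in> borel_measurable M"
    using g h w by (auto simp: weighted_Lp_def)
  have "integrable M (\<lambda>x. w x * \<bar>c * g x + d * h x\<bar> powr r)"
  proof (rule Bochner_Integration.integrable_bound[OF weighted_Lp_lincomb_bound[OF assms, of "\<bar>c\<bar> + \<bar>d\<bar>" 1]])
    show "AE x in M. norm (w x * \<bar>c * g x + d * h x\<bar> powr r) \<le>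
       norm (1 * (\<bar>w x\<bar> * ((\<bar>c\<bar> + \<bar>d\<bar>) * (\<bar>g x\<bar> + \<bar>h x\<bar>)) powr r))"
    proof (rule AE_I2)
      fix x
      have "\<bar>c * g x + d * h x\<bar> \<le> \<bar>c\<bar> * \<bar>g x\<bar> + \<bar>d\<bar> * \<bar>h x\<bar>"
        by (metis abs_mult abs_triangle_ineq)
      also have "\<dots> \<le> (\<bar>c\<bar> + \<bar>d\<bar>) * (\<bar>g x\<bar> + \<bar>h x\<bar>)" by (simp add: algebra_simps)
      finally have "\<bar>c * g x + d * h x\<bar> powr r \<le> ((\<bar>c\<bar> + \<bar>d\<bar>) * (\<bar>g x\<bar> + \<bar>h x\<bar>)) powr r"
        using \<open>r > 0\<close> by (intro powr_mono2) auto
      then show "norm (w x * \<bar>c * g x + d * h x\<bar> powr r) \<le>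
       norm (1 * (\<bar>w x\<bar> * ((\<bar>c\<bar> + \<bar>d\<bar>) * (\<bar>g x\<bar> + \<bar>h x\<bar>)) powr r))"
        by (simp add: abs_mult mult_left_mono)
    qed
  qed measurable
  then show ?thesis by (simp add: weighted_Lp_def)
qed

text \<open>The integrand takes the moving combination and the fixed direction \<open>h\<close> as a
  pair, so that one statement covers both functions of a single argument and pairings such as A(x)
  y. Convergent coefficients are bounded, which yields one majorant for the whole sequence.\<close>

lemma integral_functional_continuous:
  fixes \<phi> :: "real \<times> real \<Rightarrow> real"
  assumes "r > 0" and w: "w \<in> borel_measurable M"
    and g: "g \<in> weighted_Lp M w r" and h: "h \<in> weighted_Lp M w r"
    and \<phi>: "continuous_on UNIV \<phi>" "\<And>x y. \<bar>\<phi> (x, y)\<bar> \<le> C * (\<bar>x\<bar> + \<bar>y\<bar>) powr r"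
    and lim: "c \<longlonglongrightarrow> c0" "d \<longlonglongrightarrow> d0"
  shows "integrable M (\<lambda>x. w x * \<phi> (c0 * g x + d0 * h x, h x))"
    and "(\<lambda>n. \<integral>x. w x * \<phi> (c n * g x + d n * h x, h x) \<partial>M) \<longlonglongrightarrow> 
         (\<integral>x. w x * \<phi> (c0 * g x + d0 * h x, h x) \<partial>M)"
proof -
  have [measurable]: "g \<in> borel_measurable M" "h \<in> borel_measurable M" "w \<in> borel_measurable M"
    using g h w by (auto simp: weighted_Lp_def)
  have [measurable]: "\<phi> \<in> borel_measurable (borel \<Otimes>\<^sub>M borel)"
    using borel_measurable_continuous_onI[OF \<phi>(1)] by (simp add: borel_prod)
  obtain S1 S2 where S12: "S1 > 0" "\<And>n. \<bar>c n\<bar> \<le> S1" "S2 > 0" "\<And>n. \<bar>d n\<bar> \<le> S2"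
    using convergent_imp_Bseq[of c] convergent_imp_Bseq[of d] lim
    by (auto simp: convergent_def Bseq_def)
  define S where "S = S1 + S2 + 1"
  have S0: "0 \<le> S" using S12 by (simp add: S_def)
  have C: "0 \<le> C" using \<phi>(2)[of 1 0] by (simp add: order_trans[OF abs_ge_zero])
  have bound: "norm (w x * \<phi> (c n * g x + d n * h x, h x)) \<le> C * (\<bar>w x\<bar> * (S * (\<bar>g x\<bar> + \<bar>h x\<bar>)) powr r)" for x n
  proof -
    have "\<bar>c n * g x + d n * h x\<bar> \<le> \<bar>c n\<bar> * \<bar>g x\<bar> + \<bar>d n\<bar> * \<bar>h x\<bar>"
      by (metis abs_mult abs_triangle_ineq)
    also have "\<dots> \<le> S1 * \<bar>g x\<bar> + S2 * \<bar>h x\<bar>"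
      using S12 by (intro add_mono mult_right_mono) auto
    finally have "\<bar>c n * g x + d n * h x\<bar> + \<bar>h x\<bar> \<le> S1 * \<bar>g x\<bar> + S2 * \<bar>h x\<bar> + \<bar>h x\<bar>" by simp
    also have "\<dots> \<le> S * (\<bar>g x\<bar> + \<bar>h x\<bar>)"
      using S12 by (simp add: S_def algebra_simps)
    finally have "\<bar>\<phi> (c n * g x + d n * h x, h x)\<bar> \<le> C * (S * (\<bar>g x\<bar> + \<bar>h x\<bar>)) powr r"
      using \<open>r > 0\<close> C by (intro order_trans[OF \<phi>(2)] mult_left_mono powr_mono2) auto
    then have "\<bar>w x\<bar> * \<bar>\<phi> (c n * g x + d n * h x, h x)\<bar> \<le> \<bar>w x\<bar> * (C * (S * (\<bar>g x\<bar> + \<bar>h x\<bar>)) powr r)"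
      by (intro mult_left_mono) auto
    then show ?thesis by (simp add: abs_mult mult_ac)
  qed
  have ptw: "(\<lambda>n. w x * \<phi> (c n * g x + d n * h x, h x)) \<longlonglongrightarrow> w x * \<phi> (c0 * g x + d0 * h x, h x)" for x
  proof -
    have "(\<lambda>n. (c n * g x + d n * h x, h x)) \<longlonglongrightarrow> (c0 * g x + d0 * h x, h x)"
      using lim by (intro tendsto_intros)
    then have "(\<lambda>n. \<phi> (c n * g x + d n * h x, h x)) \<longlonglongrightarrow> \<phi> (c0 * g x + d0 * h x, h x)"
      using \<phi>(1) continuous_on_tendsto_compose by fastforce
    then show ?thesis by (intro tendsto_intros)
  qed
  show "integrable M (\<lambda>x. w x * \<phi> (c0 * g x + d0 * h x, h x))"
    by (rule integrable_dominated_convergence[where s="\<lambda>n x. w x * \<phi> (c n * g x + d n * h x, h x)", OF _ _ weighted_Lp_lincomb_bound[OF assms(1-4), of S C]])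
      (use bound ptw S0 in auto)
  show "(\<lambda>n. \<integral>x. w x * \<phi> (c n * g x + d n * h x, h x) \<partial>M) \<longlonglongrightarrow> 
         (\<integral>x. w x * \<phi> (c0 * g x + d0 * h x, h x) \<partial>M)"
    by (rule integral_dominated_convergence[OF _ _ weighted_Lp_lincomb_bound[OF assms(1-4), of S C]])
      (use bound ptw S0 in auto)
qed

lemma integrable_power_growth:
  assumes "r > 0" "w \<in> borel_measurable M" "g \<in> weighted_Lp M w r"
    and f: "continuous_on UNIV f" "\<And>x::real. \<bar>f x\<bar> \<le> C * \<bar>x\<bar> powr r"
  shows "integrable M (\<lambda>x. w x * f (g x))"
proof -
  have "0 \<le> C" using f(2)[of 1] by (simp add: order_trans[OF abs_ge_zero])
  have "\<bar>f x\<bar> \<le> C * (\<bar>x\<bar> + \<bar>y\<bar>) powr r" for x y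
    using \<open>0 \<le> C\<close> assms(1) by (intro order_trans[OF f(2)] mult_left_mono powr_mono2) auto
  moreover have "continuous_on UNIV (\<lambda>z::real \<times> real. f (fst z))"
    by (intro continuous_on_compose2[OF f(1)] continuous_intros) auto
  ultimately show ?thesis
    using integral_functional_continuous(1)[of r w M g g "\<lambda>z. f (fst z)" C "\<lambda>_. 1" 1 "\<lambda>_. 0" 0] assms
    by simp
qed

text \<open>A crude substitute for Young's inequality: enlarging both |x| and |y| to |x| + |y| gives
  homogeneity \<open>r\<close> at once, and membership in the weighted space then suffices without
  Hoelder.\<close>

lemma power_growth_pairing_bound:
  fixes x y C r :: real
  assumes "r > 1" "0 \<le> C" "\<bar>z\<bar> \<le> C * \<bar>x\<bar> powr (r - 1)"
  shows "\<bar>z * y\<bar> \<le> C * (\<bar>x\<bar> + \<bar>y\<bar>) powr r"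
proof -
  have "\<bar>z * y\<bar> \<le> (C * \<bar>x\<bar> powr (r - 1)) * \<bar>y\<bar>"
    unfolding abs_mult by (intro mult_right_mono assms) auto
  also have "\<dots> \<le> (C * (\<bar>x\<bar> + \<bar>y\<bar>) powr (r - 1)) * (\<bar>x\<bar> + \<bar>y\<bar>)"
    using assms by (intro mult_mono mult_left_mono powr_mono2) auto
  also have "\<dots> = C * (\<bar>x\<bar> + \<bar>y\<bar>) powr r"
    using powr_mult_base[of "\<bar>x\<bar> + \<bar>y\<bar>" "r - 1"] by (simp add: mult_ac)
  finally show ?thesis .
qed

text \<open>Differentiation under the integral along a line. The mean value theorem writes each
  difference quotient as \<open>f'\<close> at an intermediate parameter times \<open>h\<close>;
  these parameters are bounded along the sequence, so one integrable function dominates all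
  quotients.\<close>

lemma integral_functional_derivative:
  fixes f f' :: "real \<Rightarrow> real"
  assumes "r > 1" and w: "w \<in> borel_measurable M"
    and g: "g \<in> weighted_Lp M w r" and h: "h \<in> weighted_Lp M w r"
    and f: "\<And>x. (f has_real_derivative f' x) (at x)" "\<And>x. \<bar>f x\<bar> \<le> C * \<bar>x\<bar> powr r"
    and f': "continuous_on UNIV f'" "\<And>x. \<bar>f' x\<bar> \<le> C' * \<bar>x\<bar> powr (r - 1)"
  shows "((\<lambda>e. \<integral>x. w x * f (g x + e * h x) \<partial>M) has_real_derivative
           (\<integral>x. w x * (f' (g x + e0 * h x) * h x) \<partial>M)) (at e0)"
proof -
  have [measurable]: "g \<in> borel_measurable M" "h \<in> borel_measurable M" "w \<in> borel_measurable M"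
    using g h w by (auto simp: weighted_Lp_def)
  have contf: "continuous_on UNIV f"
    using f(1) by (meson DERIV_isCont continuous_at_imp_continuous_on)
  have [measurable]: "f \<in> borel_measurable borel" "f' \<in> borel_measurable borel"
    using contf f'(1) by (auto intro: borel_measurable_continuous_onI)
  have C': "0 \<le> C'" using f'(2)[of 1] by (simp add: order_trans[OF abs_ge_zero])
  have int: "integrable M (\<lambda>x. w x * f (g x + e * h x))" for e
    using weighted_Lp_lincomb[OF _ w g h, of 1 e] \<open>r > 1\<close>
    by (intro integrable_power_growth[OF _ w _ contf f(2)]) auto
  let ?I = "\<lambda>e. \<integral>x. w x * f (g x + e * h x) \<partial>M"
  show ?thesis unfolding has_field_derivative_iff
  proof (subst tendsto_at_iff_sequentially, intro allI impI, unfold comp_def)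
    fix X :: "nat \<Rightarrow> real" assume X: "\<forall>i. X i \<in> UNIV - {e0}" "X \<longlonglongrightarrow> e0"
    obtain S where S: "S > 0" "\<And>n. \<bar>X n\<bar> \<le> S"
      using convergent_imp_Bseq[of X] X by (auto simp: convergent_def Bseq_def)
    have e0: "\<bar>e0\<bar> \<le> S"
      using X(2) S(2) by (intro LIMSEQ_le_const2[OF tendsto_rabs]) auto
    have ne: "X n - e0 \<noteq> 0" for n using X(1) by auto
    define q where "q n x = w x * ((f (g x + X n * h x) - f (g x + e0 * h x)) / (X n - e0))" for n x
    have eq: "(?I (X n) - ?I e0) / (X n - e0) = (\<integral>x. q n x \<partial>M)" for n
    proof -
      have "?I (X n) - ?I e0 = (\<integral>x. w x * f (g x + X n * h x) - w x * f (g x + e0 * h x) \<partial>M)"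
        by (rule Bochner_Integration.integral_diff[symmetric]) (rule int)+
      moreover have "q n = (\<lambda>x. (w x * f (g x + X n * h x) - w x * f (g x + e0 * h x)) / (X n - e0))"
        by (auto simp: q_def algebra_simps)
      ultimately show ?thesis by simp
    qed
    have bound: "norm (q n x) \<le> C' * (\<bar>w x\<bar> * ((S + 1) * (\<bar>g x\<bar> + \<bar>h x\<bar>)) powr r)" for n x
    proof -
      have "\<exists>z. \<bar>z\<bar> \<le> S \<and> f (g x + X n * h x) - f (g x + e0 * h x) = (X n - e0) * (f' (g x + z * h x) * h x)"
      proof -
        have D: "((\<lambda>e. f (g x + e * h x)) has_real_derivative f' (g x + e * h x) * h x) (at e)" for e
          by (rule DERIV_chain2[OF f(1)]) (auto intro!: derivative_eq_intros)
        show ?thesis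
        proof (cases "X n < e0")
          case True
          from MVT2[OF True D] obtain z where "X n < z" "z < e0"
            "f (g x + e0 * h x) - f (g x + X n * h x) = (e0 - X n) * (f' (g x + z * h x) * h x)" by blast
          then show ?thesis using S(2)[of n] e0 by (intro exI[of _ z]) (auto simp: algebra_simps)
        next
          case False
          then have "e0 < X n" using ne[of n] by auto
          from MVT2[OF this D] obtain z where "e0 < z" "z < X n"
            "f (g x + X n * h x) - f (g x + e0 * h x) = (X n - e0) * (f' (g x + z * h x) * h x)" by blast
          then show ?thesis using S(2)[of n] e0 by (intro exI[of _ z]) auto
        qed
      qed
      then obtain z where z: "\<bar>z\<bar> \<le> S" 
        "(f (g x + X n * h x) - f (g x + e0 * h x)) / (X n - e0) = f' (g x + z * h x) * h x"
        using ne[of n] by (auto simp: field_simps)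
      have "\<bar>g x + z * h x\<bar> + \<bar>h x\<bar> \<le> \<bar>g x\<bar> + S * \<bar>h x\<bar> + \<bar>h x\<bar>"
        using abs_triangle_ineq[of "g x" "z * h x"] mult_right_mono[OF z(1), of "\<bar>h x\<bar>"]
        by (simp add: abs_mult)
      also have "\<dots> \<le> (S + 1) * (\<bar>g x\<bar> + \<bar>h x\<bar>)" using S(1) by (simp add: algebra_simps)
      finally have "\<bar>f' (g x + z * h x) * h x\<bar> \<le> C' * ((S + 1) * (\<bar>g x\<bar> + \<bar>h x\<bar>)) powr r"
        using \<open>r > 1\<close> C'
        by (intro order_trans[OF power_growth_pairing_bound[OF _ _ f'(2)]] mult_left_mono powr_mono2) auto
      then have "\<bar>w x\<bar> * \<bar>f' (g x + z * h x) * h x\<bar> \<le> \<bar>w x\<bar> * (C' * ((S + 1) * (\<bar>g x\<bar> + \<bar>h x\<bar>)) powr r)"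
        by (intro mult_left_mono) auto
      then show ?thesis unfolding q_def z(2) by (simp add: abs_mult mult_ac)
    qed
    have ptw: "(\<lambda>n. q n x) \<longlonglongrightarrow> w x * (f' (g x + e0 * h x) * h x)" for x
    proof -
      have "((\<lambda>e. f (g x + e * h x)) has_real_derivative f' (g x + e0 * h x) * h x) (at e0)"
        by (rule DERIV_chain2[OF f(1)]) (auto intro!: derivative_eq_intros)
      then have "((\<lambda>e. (f (g x + e * h x) - f (g x + e0 * h x)) / (e - e0)) \<longlongrightarrow> f' (g x + e0 * h x) * h x) (at e0)"
        by (simp add: has_field_derivative_iff)
      then have "(\<lambda>n. (f (g x + X n * h x) - f (g x + e0 * h x)) / (X n - e0)) \<longlonglongrightarrow> f' (g x + e0 * h x) * h x"
        using X by (subst (asm) tendsto_at_iff_sequentially) (auto simp: comp_def)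
      then show ?thesis unfolding q_def by (intro tendsto_intros)
    qed
    have qm: "q n \<in> borel_measurable M" for n unfolding q_def by measurable
    show "(\<lambda>i. (?I (X i) - ?I e0) / (X i - e0)) \<longlonglongrightarrow> (\<integral>x. w x * (f' (g x + e0 * h x) * h x) \<partial>M)"
      unfolding eq
      by (rule integral_dominated_convergence[OF _ _ weighted_Lp_lincomb_bound[OF _ w g h, of "S + 1" C']])
        (use bound ptw S(1) \<open>r > 1\<close> qm in auto)
  qed
qed

section \<open>Minimisation on the Nehari manifold\<close>

text \<open>In the application \<open>P\<close>, \<open>B\<close>, \<open>H\<close> integrate the
  potential, A(t) t and t^2 A'(t) against the kernel, and \<open>dP\<close>, \<open>dQ\<close>,
  \<open>dR\<close> are the pairings of the weak formulation; the factors \<open>m1\<close>,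
  \<open>m2\<close> in \<open>Q_line\<close> and \<open>R_line\<close> cancel those in the energy.
  The last part of \<open>compactness\<close> is lower semicontinuity of \<open>P\<close>, phrased
  with an arbitrary convergent upper bound in place of a liminf. It holds for all factors
  \<open>t\<close> along the same subsequence, because the factor used later is known only once the
  limit is.\<close>

locale nehari_functionals =
  fixes W :: "('a \<Rightarrow> real) set"
    and N P B H Q R :: "('a \<Rightarrow> real) \<Rightarrow> real"
    and dP dQ dR :: "('a \<Rightarrow> real) \<Rightarrow> ('a \<Rightarrow> real) \<Rightarrow> real"
    and c0 c1 C l p m m1 m2 :: real
  assumes exponents: "1 < m1" "m1 < l" "l \<le> p" "p \<le> m" "m < m2"
    and constants: "0 < c0" "0 < c1" "0 < C"
    and add_mem: "u \<in> W \<Longrightarrow> v \<in> W \<Longrightarrow> (\<lambda>x. u x + t * v x) \<in> W"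
    and scale_mem: "u \<in> W \<Longrightarrow> (\<lambda>x. t * u x) \<in> W"
    and N_nonneg: "u \<in> W \<Longrightarrow> 0 \<le> N u"
    and N_scale: "u \<in> W \<Longrightarrow> 0 < t \<Longrightarrow> N (\<lambda>x. t * u x) = t powr p * N u"
    and Q_scale: "u \<in> W \<Longrightarrow> 0 < t \<Longrightarrow> Q (\<lambda>x. t * u x) = t powr m1 * Q u"
    and R_scale: "u \<in> W \<Longrightarrow> 0 < t \<Longrightarrow> R (\<lambda>x. t * u x) = t powr m2 * R u"
    and B_lower: "u \<in> W \<Longrightarrow> c0 * N u \<le> B u"
    and P_lower: "u \<in> W \<Longrightarrow> B u \<le> p * P u"
    and P_upper: "u \<in> W \<Longrightarrow> P u \<le> c1 * N u"
    and H_lower: "u \<in> W \<Longrightarrow> (l - 1) * B u \<le> H u"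
    and H_upper: "u \<in> W \<Longrightarrow> H u \<le> (m - 1) * B u"
    and Q_bound: "u \<in> W \<Longrightarrow> \<bar>Q u\<bar> \<le> C * N u powr (m1 / p)"
    and R_bound: "u \<in> W \<Longrightarrow> \<bar>R u\<bar> \<le> C * N u powr (m2 / p)"
    and P_ray: "u \<in> W \<Longrightarrow> 0 < t \<Longrightarrow>
      ((\<lambda>t. P (\<lambda>x. t * u x)) has_real_derivative B (\<lambda>x. t * u x) / t) (at t)"
    and B_ray: "u \<in> W \<Longrightarrow> 0 < t \<Longrightarrow>
      ((\<lambda>t. B (\<lambda>x. t * u x)) has_real_derivative (H (\<lambda>x. t * u x) + B (\<lambda>x. t * u x)) / t) (at t)"
    and P_line: "u \<in> W \<Longrightarrow> v \<in> W \<Longrightarrow>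
      ((\<lambda>e. P (\<lambda>x. u x + e * v x)) has_real_derivative dP (\<lambda>x. u x + e * v x) v) (at e)"
    and Q_line: "u \<in> W \<Longrightarrow> v \<in> W \<Longrightarrow>
      ((\<lambda>e. Q (\<lambda>x. u x + e * v x)) has_real_derivative m1 * dQ (\<lambda>x. u x + e * v x) v) (at e)"
    and R_line: "u \<in> W \<Longrightarrow> v \<in> W \<Longrightarrow>
      ((\<lambda>e. R (\<lambda>x. u x + e * v x)) has_real_derivative m2 * dR (\<lambda>x. u x + e * v x) v) (at e)"
    and dP_scale: "u \<in> W \<Longrightarrow> v \<in> W \<Longrightarrow> dP u (\<lambda>x. t * v x) = t * dP u v"
    and dQ_scale: "u \<in> W \<Longrightarrow> v \<in> W \<Longrightarrow> dQ u (\<lambda>x. t * v x) = t * dQ u v"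
    and dR_scale: "u \<in> W \<Longrightarrow> v \<in> W \<Longrightarrow> dR u (\<lambda>x. t * v x) = t * dR u v"
    and dP_continuous: "u \<in> W \<Longrightarrow> v \<in> W \<Longrightarrow> c \<longlonglongrightarrow> 1 \<Longrightarrow> d \<longlonglongrightarrow> 0 \<Longrightarrow>
      (\<lambda>n. dP (\<lambda>x. c n * u x + d n * v x) v) \<longlonglongrightarrow> dP u v"
    and dQ_continuous: "u \<in> W \<Longrightarrow> v \<in> W \<Longrightarrow> c \<longlonglongrightarrow> 1 \<Longrightarrow> d \<longlonglongrightarrow> 0 \<Longrightarrow>
      (\<lambda>n. dQ (\<lambda>x. c n * u x + d n * v x) v) \<longlonglongrightarrow> dQ u v"
    and dR_continuous: "u \<in> W \<Longrightarrow> v \<in> W \<Longrightarrow> c \<longlonglongrightarrow> 1 \<Longrightarrow> d \<longlonglongrightarrow> 0 \<Longrightarrow>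
      (\<lambda>n. dR (\<lambda>x. c n * u x + d n * v x) v) \<longlonglongrightarrow> dR u v"
    and compactness: "(\<And>n::nat. f n \<in> W) \<Longrightarrow> (\<And>n. N (f n) \<le> bnd) \<Longrightarrow>
      \<exists>(r :: nat \<Rightarrow> nat) u. strict_mono r \<and> u \<in> W \<and> (\<lambda>n. Q (f (r n))) \<longlonglongrightarrow> Q u \<and> (\<lambda>n. R (f (r n))) \<longlonglongrightarrow> R u \<and>
        (\<forall>t X L. 0 < t \<longrightarrow> X \<longlonglongrightarrow> L \<longrightarrow> (\<forall>n. P (\<lambda>x. t * f (r n) x) \<le> X n) \<longrightarrow> P (\<lambda>x. t * u x) \<le> L)"
    and R_pos: "\<exists>u\<in>W. 0 < R u"
begin

section \<open>Derivatives of the fibering map and the smallness conditions\<close>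

definition J :: "real \<Rightarrow> ('a \<Rightarrow> real) \<Rightarrow> real" where
  "J lam u = P u - lam / m1 * Q u - 1 / m2 * R u"

definition fib1 :: "real \<Rightarrow> ('a \<Rightarrow> real) \<Rightarrow> real \<Rightarrow> real" where
  "fib1 lam u t = (B (\<lambda>x. t * u x) - lam * Q (\<lambda>x. t * u x) - R (\<lambda>x. t * u x)) / t"

definition fib2 :: "real \<Rightarrow> ('a \<Rightarrow> real) \<Rightarrow> real \<Rightarrow> real" where
  "fib2 lam u t = (H (\<lambda>x. t * u x) - lam * (m1 - 1) * Q (\<lambda>x. t * u x)
     - (m2 - 1) * R (\<lambda>x. t * u x)) / t\<^sup>2"

text \<open>The part N^- of the Nehari manifold in closed form: positivity of \<open>N\<close>
  encodes that \<open>u\<close> is not almost everywhere zero, and \<open>fib1\<close>,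
  \<open>fib2\<close> at 1 are the first two derivatives of the fibering map.\<close>

definition NM :: "real \<Rightarrow> ('a \<Rightarrow> real) set" where
  "NM lam = {u \<in> W. 0 < N u \<and> fib1 lam u 1 = 0 \<and> fib2 lam u 1 < 0}"

text \<open>
  On \<open>NM\<close> the functional \<open>N\<close> is at least \<open>nu\<close>, and at degenerate points and minima of fibering
  maps it is less than \<open>nu\<close> once \<open>lam\<close> is small.
\<close>

definition nu :: real where
  "nu = ((l - m1) * c0 / ((m2 - m1) * C)) powr (p / (m2 - p))"

text \<open>The level of \<open>N\<close> at which C / m2 * N^(m2/p) equals c0 / (2 p) * N. There
  the term with \<open>R\<close> uses up at most half of the lower bound c0 / p * N for
  \<open>P\<close>.\<close>

definition rho :: real where
  "rho = (c0 * m2 / (2 * p * C)) powr (p / (m2 - p))"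

text \<open>The three bounds on \<open>lam\<close> serve, in this order, \<open>less_nu\<close>,
  \<open>J_coercive\<close> and the positivity of the fibering map at the level \<open>N\<close> =
  \<open>rho\<close> in \<open>fib_global_max\<close>.\<close>

definition small :: "real \<Rightarrow> bool" where
  "small lam \<longleftrightarrow> 0 < lam \<and>
     lam * ((m2 - m1) * C) < (m2 - m) * c0 * nu powr (1 - m1 / p) \<and>
     lam * ((1 / m1 - 1 / m2) * C) < (1 / p - 1 / m2) * c0 / 2 * nu powr (1 - m1 / p) \<and>
     lam * (C / m1 * rho powr (m1 / p)) < c0 / (2 * p) * rho"

lemma pos: "0 < m1" "0 < l" "0 < p" "0 < m" "0 < m2" "m1 < p" "p < m2" "m1 < m2"
  using exponents by auto

lemma nu_pos: "0 < nu" and rho_pos: "0 < rho"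
  using exponents constants pos by (auto simp: nu_def rho_def)

lemma small_ex: "\<exists>lam0>0. \<forall>lam. 0 < lam \<and> lam < lam0 \<longrightarrow> small lam"
proof -
  define X1 where "X1 = (m2 - m1) * C"
  define X2 where "X2 = (1 / m1 - 1 / m2) * C"
  define X3 where "X3 = C / m1 * rho powr (m1 / p)"
  define Y1 where "Y1 = (m2 - m) * c0 * nu powr (1 - m1 / p)"
  define Y2 where "Y2 = (1 / p - 1 / m2) * c0 / 2 * nu powr (1 - m1 / p)"
  define Y3 where "Y3 = c0 / (2 * p) * rho"
  have "X1 > 0" "X2 > 0" "X3 > 0" "Y1 > 0" "Y2 > 0" "Y3 > 0"
    using exponents constants pos nu_pos rho_pos
    by (auto simp: X1_def X2_def X3_def Y1_def Y2_def Y3_def frac_less2 intro!: mult_pos_pos divide_pos_pos)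
  moreover have "small lam" if "0 < lam" "lam * X1 < Y1" "lam * X2 < Y2" "lam * X3 < Y3" for lam
    using that unfolding small_def X1_def X2_def X3_def Y1_def Y2_def Y3_def by blast
  ultimately show ?thesis
    by (intro exI[of _ "min (Y1/X1) (min (Y2/X2) (Y3/X3))"]) (auto simp: pos_less_divide_eq)
qed

text \<open>Near a positive \<open>t\<close> the terms with \<open>Q\<close> and \<open>R\<close>
  are explicit powers. In the second derivative the summand \<open>B\<close> of \<open>B_ray\<close>
  cancels against the derivative of 1/t, so that \<open>H\<close> appears alone.\<close>

lemma fib_deriv:
  assumes u: "u \<in> W" and t: "0 < t"
  shows "((\<lambda>t. J lam (\<lambda>x. t * u x)) has_real_derivative fib1 lam u t) (at t)"
    and "(fib1 lam u has_real_derivative fib2 lam u t) (at t)"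
proof -
  have Q: "((\<lambda>t. Q (\<lambda>x. t * u x)) has_real_derivative m1 * Q (\<lambda>x. t * u x) / t) (at t)"
  proof (rule DERIV_cong_ev[THEN iffD1, OF refl _ refl])
    show "((\<lambda>t. t powr m1 * Q u) has_real_derivative m1 * Q (\<lambda>x. t * u x) / t) (at t)"
      using t by (auto intro!: derivative_eq_intros simp: Q_scale[OF u t] powr_diff)
    show "\<forall>\<^sub>F t in nhds t. t powr m1 * Q u = Q (\<lambda>x. t * u x)"
      using eventually_nhds_in_open[of "{0<..}" t] t by (auto elim!: eventually_mono simp: Q_scale[OF u])
  qed
  have R: "((\<lambda>t. R (\<lambda>x. t * u x)) has_real_derivative m2 * R (\<lambda>x. t * u x) / t) (at t)"
  proof (rule DERIV_cong_ev[THEN iffD1, OF refl _ refl])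
    show "((\<lambda>t. t powr m2 * R u) has_real_derivative m2 * R (\<lambda>x. t * u x) / t) (at t)"
      using t by (auto intro!: derivative_eq_intros simp: R_scale[OF u t] powr_diff)
    show "\<forall>\<^sub>F t in nhds t. t powr m2 * R u = R (\<lambda>x. t * u x)"
      using eventually_nhds_in_open[of "{0<..}" t] t by (auto elim!: eventually_mono simp: R_scale[OF u])
  qed
  show "((\<lambda>t. J lam (\<lambda>x. t * u x)) has_real_derivative fib1 lam u t) (at t)"
    unfolding J_def fib1_def using pos t
    by (auto intro!: derivative_eq_intros P_ray[OF u t] Q R simp: field_simps)
  show "(fib1 lam u has_real_derivative fib2 lam u t) (at t)"
    unfolding fib1_def[abs_def] fib2_def using pos t
    by (auto intro!: derivative_eq_intros B_ray[OF u t] Q R simp: field_simps power2_eq_square)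
qed

lemma fib_scale:
  assumes "0 < t"
  shows "fib1 lam (\<lambda>x. t * u x) 1 = t * fib1 lam u t" "fib2 lam (\<lambda>x. t * u x) 1 = t\<^sup>2 * fib2 lam u t"
  using assms by (auto simp: fib1_def fib2_def)

lemma N_scale_pos: "u \<in> W \<Longrightarrow> 0 < N u \<Longrightarrow> 0 < t \<Longrightarrow> 0 < N (\<lambda>x. t * u x)"
  by (simp add: N_scale)

text \<open>The first order condition expresses \<open>lam * Q u\<close> as
  \<open>B u - R u\<close>. Inserting this into the second order condition removes
  \<open>lam\<close> altogether, and \<open>H_lower\<close> leaves (l - m1) B \<le> (m2 - m1)
  R.\<close>

lemma R_lower:
  assumes u: "u \<in> W" and n: "fib1 lam u 1 = 0" "fib2 lam u 1 \<le> 0"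
  shows "(l - m1) * c0 * N u \<le> (m2 - m1) * R u"
proof -
  have "lam * Q u = B u - R u" "H u \<le> (m1 - 1) * (lam * Q u) + (m2 - 1) * R u"
    using n by (auto simp: fib1_def fib2_def algebra_simps)
  then have "H u \<le> (m1 - 1) * (B u - R u) + (m2 - 1) * R u" by simp
  then have "(l - m1) * B u \<le> (m2 - m1) * R u"
    using H_lower[OF u] by (simp add: algebra_simps)
  moreover have "(l - m1) * (c0 * N u) \<le> (l - m1) * B u"
    using exponents B_lower[OF u] by (intro mult_left_mono) auto
  ultimately show ?thesis by simp
qed

text \<open>Since \<open>R\<close> is at most C N^(m2/p) with m2 > p, the bound of
  \<open>R_lower\<close> is violated when \<open>N\<close> is small. Dividing by \<open>N\<close>
  and solving the resulting inequality for \<open>N\<close> produces exactly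
  \<open>nu\<close>.\<close>

lemma nu_le:
  assumes u: "u \<in> W" "0 < N u" and n: "fib1 lam u 1 = 0" "fib2 lam u 1 \<le> 0"
  shows "nu \<le> N u"
proof -
  have "(l - m1) * c0 * N u \<le> (m2 - m1) * (C * N u powr (m2 / p))"
    using R_lower[OF u(1) n] R_bound[OF u(1)] pos by (smt (verit) mult_left_mono)
  also have "N u powr (m2 / p) = N u * N u powr ((m2 - p) / p)"
    using u pos by (simp add: powr_mult_base diff_divide_distrib)
  finally have "N u * ((l - m1) * c0) \<le> N u * ((m2 - m1) * C * N u powr ((m2 - p) / p))"
    by (simp add: mult_ac)
  then have "(l - m1) * c0 \<le> (m2 - m1) * C * N u powr ((m2 - p) / p)"
    using u by simp
  then have "(l - m1) * c0 / ((m2 - m1) * C) \<le> N u powr ((m2 - p) / p)"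
    using pos constants by (simp add: pos_divide_le_eq mult_ac)
  then have "nu \<le> (N u powr ((m2 - p) / p)) powr (p / (m2 - p))"
    unfolding nu_def using pos constants exponents by (intro powr_mono2) auto
  also have "\<dots> = N u" using u pos by (simp add: powr_powr)
  finally show ?thesis .
qed

text \<open>Here \<open>R\<close> is eliminated and \<open>Q\<close> kept. As \<open>Q\<close> is at
  most C N^(m1/p) with m1 < p, this bounds \<open>N\<close> from above by a quantity that shrinks
  with \<open>lam\<close>. Degenerate points are included on purpose, so that together with
  \<open>nu_le\<close> they are ruled out.\<close>

lemma less_nu:
  assumes lam: "small lam" and u: "u \<in> W" "0 < N u" and n: "fib1 lam u 1 = 0" "0 \<le> fib2 lam u 1"
  shows "N u < nu"
proof -
  have 1: "R u = B u - lam * Q u" "lam * (m1 - 1) * Q u + (m2 - 1) * R u \<le> H u"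
    using n by (auto simp: fib1_def fib2_def algebra_simps)
  have "(m2 - 1) * B u - H u \<le> lam * ((m2 - m1) * Q u)"
    using 1(2) unfolding 1(1) by (simp add: algebra_simps)
  then have "(m2 - m) * B u \<le> lam * ((m2 - m1) * Q u)"
    using H_upper[OF u(1)] by (simp add: algebra_simps)
  moreover have "(m2 - m) * (c0 * N u) \<le> (m2 - m) * B u"
    using exponents B_lower[OF u(1)] by (intro mult_left_mono) auto
  moreover have "lam * ((m2 - m1) * Q u) \<le> lam * ((m2 - m1) * (C * N u powr (m1 / p)))"
    using lam pos Q_bound[OF u(1)] by (intro mult_left_mono) (auto simp: small_def)
  ultimately have "(m2 - m) * c0 * N u \<le> lam * ((m2 - m1) * C) * N u powr (m1 / p)"
    by (simp add: mult_ac)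
  also have "\<dots> < ((m2 - m) * c0 * nu powr (1 - m1 / p)) * N u powr (m1 / p)"
    using lam u by (intro mult_strict_right_mono) (auto simp: small_def)
  finally have *: "N u < nu powr (1 - m1 / p) * N u powr (m1 / p)"
    using exponents constants by (simp add: mult_ac)
  show ?thesis
  proof (rule ccontr)
    assume "\<not> N u < nu"
    then have "nu powr (1 - m1 / p) * N u powr (m1 / p) \<le> N u powr (1 - m1 / p) * N u powr (m1 / p)"
      using nu_pos pos by (intro mult_right_mono powr_mono2) auto
    also have "\<dots> = N u" using u by (simp flip: powr_add)
    finally show False using * by simp
  qed
qed

text \<open>Substituting the Nehari identity for \<open>R\<close> leaves (1/p - 1/m2) B minus a
  multiple of lam Q. The latter grows only like N^(m1/p); because \<open>N\<close> is at least
  \<open>nu\<close>, the second smallness condition absorbs it into half of the leading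
  term.\<close>

lemma J_coercive:
  assumes lam: "small lam" and u: "u \<in> NM lam"
  shows "(1 / p - 1 / m2) * c0 / 2 * N u \<le> J lam u"
proof -
  have u': "u \<in> W" "0 < N u" and R: "R u = B u - lam * Q u"
    using u by (auto simp: NM_def fib1_def)
  have nu: "nu \<le> N u" using nu_le u by (auto simp: NM_def)
  define k where "k = (1 / p - 1 / m2) * c0"
  have "0 < k" unfolding k_def using pos constants by (auto simp: frac_less2)
  have "B u / p - lam / m1 * Q u - 1 / m2 * R u \<le> J lam u"
    using P_lower[OF u'(1)] pos by (simp add: J_def field_simps)
  moreover have "B u / p - lam / m1 * Q u - 1 / m2 * R u = (1 / p - 1 / m2) * B u - lam * ((1 / m1 - 1 / m2) * Q u)"
    unfolding R by (simp add: algebra_simps)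
  moreover have "k * N u \<le> (1 / p - 1 / m2) * B u"
    unfolding k_def mult.assoc using pos B_lower[OF u'(1)] by (intro mult_left_mono) (auto simp: frac_le)
  moreover have "lam * ((1 / m1 - 1 / m2) * Q u) \<le> k / 2 * N u"
  proof -
    have "lam * ((1 / m1 - 1 / m2) * Q u) \<le> lam * ((1 / m1 - 1 / m2) * (C * N u powr (m1 / p)))"
      using lam pos Q_bound[OF u'(1)] by (intro mult_left_mono) (auto simp: small_def frac_le)
    also have "\<dots> = lam * ((1 / m1 - 1 / m2) * C) * N u powr (m1 / p)" by simp
    also have "\<dots> \<le> (k / 2 * nu powr (1 - m1 / p)) * N u powr (m1 / p)"
      using lam by (intro mult_right_mono) (auto simp: small_def k_def)
    also have "\<dots> \<le> (k / 2 * N u powr (1 - m1 / p)) * N u powr (m1 / p)"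
      using nu nu_pos pos \<open>0 < k\<close> by (intro mult_right_mono mult_left_mono powr_mono2) auto
    also have "\<dots> = k / 2 * N u" using u' by (simp flip: powr_add)
    finally show ?thesis .
  qed
  ultimately have "k / 2 * N u \<le> J lam u" by linarith
  then show ?thesis by (simp add: k_def)
qed

lemma NM_facts:
  assumes "small lam" "u \<in> NM lam"
  shows "u \<in> W" "nu \<le> N u" "0 < R u" "0 < J lam u"
proof -
  show u: "u \<in> W" and nu: "nu \<le> N u" using assms nu_le by (auto simp: NM_def)
  have "0 < (l - m1) * c0 * N u" using exponents constants nu nu_pos by simp
  also have "\<dots> \<le> (m2 - m1) * R u" using R_lower[of u lam] assms by (auto simp: NM_def)
  finally show "0 < R u" using pos by (simp add: zero_less_mult_iff)
  have "0 < (1 / p - 1 / m2) * c0 / 2 * N u" using pos constants nu nu_pos by (simp add: frac_less2)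
  then show "0 < J lam u" using J_coercive[OF assms] by linarith
qed

text \<open>A local maximum of a fibering map satisfies the two conditions of \<open>NM\<close> with
  a weak inequality. Equality is impossible, as \<open>nu_le\<close> and \<open>less_nu\<close>
  would then both apply.\<close>

lemma local_max_in_NM:
  assumes lam: "small lam" and u: "u \<in> W" "0 < N u" and t: "0 < t" "0 < e"
    and max: "\<And>s. \<bar>s - t\<bar> < e \<Longrightarrow> J lam (\<lambda>x. s * u x) \<le> J lam (\<lambda>x. t * u x)"
  shows "(\<lambda>x. t * u x) \<in> NM lam"
proof -
  have 1: "fib1 lam u t = 0" "fib2 lam u t \<le> 0"
    using local_max_derivatives[OF t(1) fib_deriv(1)[OF u(1)] fib_deriv(2)[OF u(1) t(1)] t(2) max] by auto
  have tu: "(\<lambda>x. t * u x) \<in> W" "0 < N (\<lambda>x. t * u x)"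
    using scale_mem u N_scale_pos t by auto
  have f1: "fib1 lam (\<lambda>x. t * u x) 1 = 0" "fib2 lam (\<lambda>x. t * u x) 1 \<le> 0"
    using 1 fib_scale[OF t(1)] by (auto simp: mult_nonneg_nonpos)
  have "fib2 lam (\<lambda>x. t * u x) 1 \<noteq> 0"
    using less_nu[OF lam tu f1(1)] nu_le[OF tu f1] by auto
  then show ?thesis using tu f1 by (auto simp: NM_def)
qed

lemma NM_unique_on_ray:
  assumes lam: "small lam" and u: "u \<in> W"
    and t: "0 < t1" "t1 < t2" "(\<lambda>x. t1 * u x) \<in> NM lam" "(\<lambda>x. t2 * u x) \<in> NM lam"
  shows False
proof -
  let ?f = "\<lambda>t. J lam (\<lambda>x. t * u x)"
  note D = fib_deriv(1)[OF u, of _ lam] and D2 = fib_deriv(2)[OF u, of _ lam]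
  have strict: "\<exists>d>0. \<forall>s. 0 < \<bar>s - t\<bar> \<and> \<bar>s - t\<bar> < d \<longrightarrow> ?f s < ?f t"
    if "0 < t" "(\<lambda>x. t * u x) \<in> NM lam" for t
  proof (rule strict_local_max_second_derivative[OF that(1) D D2[OF that(1)]])
    show "fib1 lam u t = 0" "fib2 lam u t < 0"
      using that fib_scale[OF that(1)] by (auto simp: NM_def mult_less_0_iff)
  qed
  have "0 < t2" using t by auto
  obtain d1 where d1: "d1 > 0" "\<And>s. 0 < \<bar>s - t1\<bar> \<Longrightarrow> \<bar>s - t1\<bar> < d1 \<Longrightarrow> ?f s < ?f t1"
    using strict[OF t(1,3)] by auto
  obtain d2 where d2: "d2 > 0" "\<And>s. 0 < \<bar>s - t2\<bar> \<Longrightarrow> \<bar>s - t2\<bar> < d2 \<Longrightarrow> ?f s < ?f t2"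
    using strict[OF \<open>0 < t2\<close> t(4)] by auto
  have "continuous_on {t1..t2} ?f"
    using t by (intro continuous_at_imp_continuous_on ballI DERIV_isCont[OF D]) auto
  then obtain t0 where t0: "t0 \<in> {t1..t2}" "\<And>s. s \<in> {t1..t2} \<Longrightarrow> ?f t0 \<le> ?f s"
    using continuous_attains_inf[of "{t1..t2}" ?f] t by force
  \<comment> \<open>A step that remains inside both neighbourhoods and inside the interval: it
    exhibits points with a smaller value than each endpoint, hence the minimum over the interval is
    interior.\<close>
  define h where "h = min (min (d1 / 2) (d2 / 2)) (t2 - t1)"
  have h: "0 < h" "h < d1" "h < d2" "h \<le> t2 - t1" using d1(1) d2(1) t by (auto simp: h_def)
  have "t0 \<noteq> t1" using d1(2)[of "t1 + h"] t0(2)[of "t1 + h"] h t by auto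
  moreover have "t0 \<noteq> t2" using d2(2)[of "t2 - h"] t0(2)[of "t2 - h"] h t by auto
  ultimately have t0': "t1 < t0" "t0 < t2" "0 < t0" using t0 t by auto
  have min: "?f t0 \<le> ?f s" if "\<bar>s - t0\<bar> < min (t0 - t1) (t2 - t0)" for s
    using that by (intro t0(2)) (auto simp: abs_less_iff)
  have "fib1 lam u t0 = 0" "0 \<le> fib2 lam u t0"
    using local_min_derivatives[OF t0'(3) D D2[OF t0'(3)], of "min (t0 - t1) (t2 - t0)", OF _ _ min] t0' by auto
  then have "fib1 lam (\<lambda>x. t0 * u x) 1 = 0" "0 \<le> fib2 lam (\<lambda>x. t0 * u x) 1"
    using fib_scale[OF t0'(3)] by auto
  moreover have N1: "0 < N (\<lambda>x. t1 * u x)" using t by (auto simp: NM_def)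
  then have "0 < N u" using N_scale[OF u t(1)] by (simp add: zero_less_mult_iff)
  ultimately have "N (\<lambda>x. t0 * u x) < nu"
    using less_nu[OF lam scale_mem[OF u] N_scale_pos[OF u _ t0'(3)]] by auto
  moreover have "nu \<le> N (\<lambda>x. t1 * u x)" using NM_facts[OF lam t(3)] by auto
  \<comment> \<open>By homogeneity \<open>N\<close> increases along the ray, so the interior minimum
    inherits the lower bound \<open>nu\<close> from the left endpoint.\<close>
  moreover have "N (\<lambda>x. t1 * u x) \<le> N (\<lambda>x. t0 * u x)"
    using t t0' pos \<open>0 < N u\<close> by (auto simp: N_scale[OF u] intro!: mult_right_mono powr_mono2)
  ultimately show False by linarith
qed

text \<open>The fibering map is positive at one point, falls below that value near 0, and falls
  below it again at infinity since \<open>R u > 0\<close> and m2 is the largest exponent. So the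
  maximum over a compact interval is global, and \<open>local_max_in_NM\<close> applies to
  it.\<close>

lemma fib_global_max:
  assumes lam: "small lam" and u: "u \<in> W" "0 < N u" "0 < R u"
  shows "\<exists>t>0. (\<lambda>x. t * u x) \<in> NM lam \<and> (\<forall>s>0. J lam (\<lambda>x. s * u x) \<le> J lam (\<lambda>x. t * u x))"
proof -
  let ?f = "\<lambda>t. J lam (\<lambda>x. t * u x)"
  \<comment> \<open>The factor that normalises \<open>N\<close> to \<open>rho\<close>.\<close>
  define t0 where "t0 = (rho / N u) powr (1 / p)"
  have t0: "0 < t0" using rho_pos u by (simp add: t0_def)
  have lam0: "0 < lam" using lam by (simp add: small_def)
  have f0: "0 < ?f t0"
  proof -
    let ?v = "\<lambda>x. t0 * u x"
    have v: "?v \<in> W" using scale_mem u by auto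
    have N: "N ?v = rho"
      using rho_pos u pos t0 by (simp add: N_scale t0_def powr_powr)
    have "c0 / p * rho \<le> P ?v"
      using B_lower[OF v] P_lower[OF v] pos by (simp add: N field_simps)
    moreover have "lam / m1 * Q ?v < c0 / (2 * p) * rho"
    proof -
      have "lam / m1 * Q ?v \<le> lam / m1 * (C * rho powr (m1 / p))"
        using Q_bound[OF v] pos lam0 by (intro mult_left_mono) (auto simp: N)
      then show ?thesis using lam by (simp add: small_def)
    qed
    moreover have "1 / m2 * R ?v \<le> c0 / (2 * p) * rho"
    proof -
      have "rho powr ((m2 - p) / p) = c0 * m2 / (2 * p * C)"
        using pos constants by (simp add: rho_def powr_powr)
      moreover have "rho powr (m2 / p) = rho * rho powr ((m2 - p) / p)"
        using rho_pos pos by (simp add: powr_mult_base diff_divide_distrib)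
      ultimately have "1 / m2 * (C * rho powr (m2 / p)) = c0 / (2 * p) * rho"
        using constants pos by simp
      moreover have "1 / m2 * R ?v \<le> 1 / m2 * (C * rho powr (m2 / p))"
        using R_bound[OF v] pos by (intro mult_left_mono) (auto simp: N)
      ultimately show ?thesis by simp
    qed
    ultimately show ?thesis by (simp add: J_def)
  qed
  have upper: "?f t \<le> c1 * N u * t powr p + lam / m1 * \<bar>Q u\<bar> * t powr m1 - R u / m2 * t powr m2" if "0 < t" for t
  proof -
    have "P (\<lambda>x. t * u x) \<le> c1 * N u * t powr p"
      using P_upper[OF scale_mem[OF u(1)], of t] N_scale[OF u(1) that] by (simp add: mult_ac)
    moreover have "- (lam / m1 * Q (\<lambda>x. t * u x)) \<le> lam / m1 * \<bar>Q u\<bar> * t powr m1"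
    proof -
      have "lam / m1 * (t powr m1 * - Q u) \<le> lam / m1 * (t powr m1 * \<bar>Q u\<bar>)"
        using lam0 pos by (intro mult_left_mono) auto
      then show ?thesis unfolding Q_scale[OF u(1) that] by (simp add: mult_ac)
    qed
    ultimately show ?thesis by (simp add: J_def R_scale[OF u(1) that] mult_ac)
  qed
  have "((\<lambda>t. c1 * N u * t powr p + lam / m1 * \<bar>Q u\<bar> * t powr m1) \<longlongrightarrow> 
      c1 * N u * 0 powr p + lam / m1 * \<bar>Q u\<bar> * 0 powr m1) (at_right 0)"
    using pos by (intro tendsto_intros) (auto simp: eventually_at_right_less eventually_at_filter)
  then have "\<forall>\<^sub>F t in at_right 0. c1 * N u * t powr p + lam / m1 * \<bar>Q u\<bar> * t powr m1 < ?f t0"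
    using f0 pos by (intro order_tendstoD) auto
  then obtain a where a: "a > 0" "\<And>t. 0 < t \<Longrightarrow> t < a \<Longrightarrow> c1 * N u * t powr p + lam / m1 * \<bar>Q u\<bar> * t powr m1 < ?f t0"
    by (auto simp: eventually_at_right_field)
  have lo: "?f t < ?f t0" if "0 < t" "t < a" for t
    using upper[OF that(1)] a(2)[OF that] u(3) pos by (smt (verit) divide_nonneg_nonneg mult_nonneg_nonneg powr_ge_zero)
  \<comment> \<open>After division by t^m2 the two upper terms carry negative exponents and vanish
    at infinity, while the term with \<open>R\<close> becomes a positive constant.\<close>
  have "((\<lambda>t. c1 * N u * t powr (p - m2) + lam / m1 * \<bar>Q u\<bar> * t powr (m1 - m2)) \<longlongrightarrow> 
      c1 * N u * 0 + lam / m1 * \<bar>Q u\<bar> * 0) at_top"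
    using pos by (intro tendsto_intros tendsto_neg_powr filterlim_ident) auto
  then have "\<forall>\<^sub>F t in at_top. c1 * N u * t powr (p - m2) + lam / m1 * \<bar>Q u\<bar> * t powr (m1 - m2) < R u / m2"
    using u pos by (intro order_tendstoD) auto
  then obtain b where b: "\<And>t. t \<ge> b \<Longrightarrow> c1 * N u * t powr (p - m2) + lam / m1 * \<bar>Q u\<bar> * t powr (m1 - m2) < R u / m2"
    by (auto simp: eventually_at_top_linorder)
  have hi: "?f t < ?f t0" if "0 < t" "b \<le> t" for t
  proof -
    have "t powr m2 * (c1 * N u * t powr (p - m2) + lam / m1 * \<bar>Q u\<bar> * t powr (m1 - m2)) < t powr m2 * (R u / m2)"
      using b[OF that(2)] that(1) by (intro mult_strict_left_mono) auto
    moreover have "t powr m2 * (c1 * N u * t powr (p - m2) + lam / m1 * \<bar>Q u\<bar> * t powr (m1 - m2)) = 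
       c1 * N u * (t powr m2 * t powr (p - m2)) + lam / m1 * \<bar>Q u\<bar> * (t powr m2 * t powr (m1 - m2))"
      by (simp add: algebra_simps)
    moreover have "t powr m2 * t powr (p - m2) = t powr p" "t powr m2 * t powr (m1 - m2) = t powr m1"
      using that by (simp_all flip: powr_add)
    ultimately show ?thesis using upper[OF that(1)] f0 by (simp add: mult_ac)
  qed
  define a' where "a' = min a t0 / 2"
  define b' where "b' = max b (t0 + 1)"
  have ab: "0 < a'" "a' < a" "a' < t0" "t0 < b'" "b \<le> b'" using a t0 by (auto simp: a'_def b'_def)
  have "continuous_on {a'..b'} ?f"
    using ab by (intro continuous_at_imp_continuous_on ballI DERIV_isCont[OF fib_deriv(1)[OF u(1)]]) auto
  then obtain t where t: "t \<in> {a'..b'}" "\<And>s. s \<in> {a'..b'} \<Longrightarrow> ?f s \<le> ?f t"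
    using continuous_attains_sup[of "{a'..b'}" ?f] ab by force
  have "0 < t" using t ab by auto
  have max: "?f s \<le> ?f t" if "0 < s" for s
  proof (cases "s \<in> {a'..b'}")
    case False
    then have "?f s < ?f t0" using lo[OF that] hi[OF that] ab by auto
    also have "\<dots> \<le> ?f t" using t(2)[of t0] ab by auto
    finally show ?thesis by simp
  qed (use t in auto)
  then have "(\<lambda>x. t * u x) \<in> NM lam"
    using local_max_in_NM[OF lam u(1,2) \<open>0 < t\<close>, of t] \<open>0 < t\<close> by auto
  then show ?thesis using max \<open>0 < t\<close> by blast
qed

text \<open>\<open>fib_global_max\<close> supplies a point of \<open>NM\<close> that is maximal on
  the ray, and uniqueness on the ray identifies it with \<open>u\<close>. Another maximiser would
  itself lie in \<open>NM\<close>, whence strictness.\<close>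

lemma NM_fib_max:
  assumes lam: "small lam" and u: "u \<in> NM lam" and "0 < s"
  shows "J lam (\<lambda>x. s * u x) \<le> J lam u" and "s \<noteq> 1 \<Longrightarrow> J lam (\<lambda>x. s * u x) < J lam u"
proof -
  note f = NM_facts[OF lam u]
  have N: "0 < N u" using f nu_pos by simp
  obtain t where t: "t > 0" "(\<lambda>x. t * u x) \<in> NM lam" "\<And>s. s > 0 \<Longrightarrow> J lam (\<lambda>x. s * u x) \<le> J lam (\<lambda>x. t * u x)"
    using fib_global_max[OF lam f(1) N f(3)] by auto
  have u1: "(\<lambda>x. 1 * u x) \<in> NM lam" using u by simp
  have "t = 1"
    using NM_unique_on_ray[OF lam f(1) t(1) _ t(2) u1] NM_unique_on_ray[OF lam f(1) _ _ u1 t(2)]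
    by (cases t "1::real" rule: linorder_cases) auto
  then have max: "J lam (\<lambda>x. s * u x) \<le> J lam u" if "s > 0" for s using t(3)[OF that] by simp
  then show "J lam (\<lambda>x. s * u x) \<le> J lam u" using \<open>0 < s\<close> .
  show "J lam (\<lambda>x. s * u x) < J lam u" if "s \<noteq> 1"
  proof (rule ccontr)
    assume "\<not> J lam (\<lambda>x. s * u x) < J lam u"
    then have "J lam (\<lambda>x. s' * u x) \<le> J lam (\<lambda>x. s * u x)" if "s' > 0" for s' using max[OF that] by simp
    then have s: "(\<lambda>x. s * u x) \<in> NM lam"
      using local_max_in_NM[OF lam f(1) N \<open>0 < s\<close>, of s] \<open>0 < s\<close> by auto
    then show False
      using NM_unique_on_ray[OF lam f(1) \<open>0 < s\<close> _ s u1] NM_unique_on_ray[OF lam f(1) _ _ u1 s] that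
      by (cases s "1::real" rule: linorder_cases) auto
  qed
qed

lemma R_pos_N_pos: "u \<in> W \<Longrightarrow> 0 < R u \<Longrightarrow> 0 < N u"
  using N_nonneg[of u] R_bound[of u] pos by (cases "N u = 0") auto

lemma NM_nonempty: "small lam \<Longrightarrow> NM lam \<noteq> {}"
  using R_pos R_pos_N_pos fib_global_max by blast

section \<open>Existence of a minimiser\<close>

lemma minimizer_ex:
  assumes lam: "small lam"
  shows "\<exists>u\<in>NM lam. \<forall>w\<in>NM lam. J lam u \<le> J lam w"
proof -
  define d where "d = Inf (J lam ` NM lam)"
  have bdd: "bdd_below (J lam ` NM lam)"
    using NM_facts[OF lam] by (intro bdd_belowI[of _ 0]) (auto intro: less_imp_le)
  have d: "d \<le> J lam w" if "w \<in> NM lam" for w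
    unfolding d_def using bdd that by (intro cInf_lower) auto
  have "\<exists>u\<in>NM lam. J lam u < d + 1 / real (Suc n)" for n
    using cInf_lessD[of "J lam ` NM lam" "d + 1 / real (Suc n)"] NM_nonempty[OF lam] by (auto simp: d_def)
  then obtain f where f: "\<And>n. f n \<in> NM lam" "\<And>n. J lam (f n) < d + 1 / real (Suc n)" by metis
  define k where "k = (1 / p - 1 / m2) * c0 / 2"
  have "0 < k" unfolding k_def using pos constants by (auto simp: frac_less2)
  have "N (f n) \<le> (d + 1) / k" for n
  proof -
    have "k * N (f n) \<le> J lam (f n)" using J_coercive[OF lam f(1)] by (simp add: k_def)
    also have "\<dots> \<le> d + 1" using f(2)[of n] by (smt (verit) divide_le_eq_1_pos of_nat_0_less_iff of_nat_1 of_nat_Suc zero_less_Suc of_nat_0_le_iff)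
    finally show ?thesis using \<open>0 < k\<close> by (simp add: field_simps)
  qed
  then obtain r u where ru: "strict_mono r" "u \<in> W" "(\<lambda>n. Q (f (r n))) \<longlonglongrightarrow> Q u" "(\<lambda>n. R (f (r n))) \<longlonglongrightarrow> R u"
    and lsc: "\<And>t X L. 0 < t \<Longrightarrow> X \<longlonglongrightarrow> L \<Longrightarrow> (\<And>n. P (\<lambda>x. t * f (r n) x) \<le> X n) \<Longrightarrow> P (\<lambda>x. t * u x) \<le> L"
    using compactness[of f "(d + 1) / k"] NM_facts(1)[OF lam f(1)] by blast
  \<comment> \<open>A lower bound for \<open>R\<close> that is uniform along the sequence. It
    survives in the limit, so the limit is nonzero and its ray reaches \<open>NM\<close>.\<close>
  have "(l - m1) * c0 * nu \<le> (m2 - m1) * R (f (r n))" for n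
  proof -
    have "(l - m1) * c0 * nu \<le> (l - m1) * c0 * N (f (r n))"
      using NM_facts(2)[OF lam f(1)] exponents constants by (intro mult_left_mono) auto
    also have "\<dots> \<le> (m2 - m1) * R (f (r n))"
      using f(1) by (intro R_lower[of _ lam]) (auto simp: NM_def intro: less_imp_le)
    finally show ?thesis .
  qed
  then have "(l - m1) * c0 * nu \<le> (m2 - m1) * R u"
    by (intro LIMSEQ_le_const[OF tendsto_mult_left[OF ru(4)]]) auto
  moreover have "0 < (l - m1) * c0 * nu" using exponents constants nu_pos by simp
  ultimately have "0 < R u" using pos by (smt (verit) mult_nonneg_nonpos)
  then obtain t where t: "t > 0" "(\<lambda>x. t * u x) \<in> NM lam"
    using fib_global_max[OF lam ru(2) R_pos_N_pos[OF ru(2)]] by auto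
  \<comment> \<open>With \<open>t\<close> fixed from the limit function, J (t f) \<le> J f < d + 1 /
    (r n + 1) along the subsequence is solved for \<open>P\<close>. The right-hand side converges,
    as the semicontinuity clause requires.\<close>
  define X where "X n = d + 1 / real (Suc (r n)) + lam / m1 * (t powr m1 * Q (f (r n))) + 1 / m2 * (t powr m2 * R (f (r n)))" for n
  have "P (\<lambda>x. t * u x) \<le> d + 0 + lam / m1 * (t powr m1 * Q u) + 1 / m2 * (t powr m2 * R u)"
  proof (rule lsc[OF t(1)])
    show "X \<longlonglongrightarrow> d + 0 + lam / m1 * (t powr m1 * Q u) + 1 / m2 * (t powr m2 * R u)"
      unfolding X_def using LIMSEQ_subseq_LIMSEQ[OF LIMSEQ_Suc[OF lim_1_over_n] ru(1)]
      by (intro tendsto_intros ru) (auto simp: comp_def)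
    show "P (\<lambda>x. t * f (r n) x) \<le> X n" for n
    proof -
      have w: "f (r n) \<in> W" using NM_facts[OF lam f(1)] by auto
      have "J lam (\<lambda>x. t * f (r n) x) \<le> J lam (f (r n))" using NM_fib_max(1)[OF lam f(1) t(1)] .
      also have "\<dots> < d + 1 / real (Suc (r n))" by (rule f)
      finally show ?thesis using t(1) by (simp add: J_def X_def Q_scale[OF w] R_scale[OF w])
    qed
  qed
  then have "J lam (\<lambda>x. t * u x) \<le> d" using t(1) by (simp add: J_def Q_scale[OF ru(2)] R_scale[OF ru(2)])
  then show ?thesis using t(2) d by (meson order_trans)
qed

section \<open>The Euler-Lagrange equation for minimisers\<close>

lemma J_line:
  assumes "u \<in> W" "v \<in> W"
  shows "((\<lambda>e. J lam (\<lambda>x. u x + e * v x)) has_real_derivative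
    dP (\<lambda>x. u x + e * v x) v - lam * dQ (\<lambda>x. u x + e * v x) v - dR (\<lambda>x. u x + e * v x) v) (at e)"
  unfolding J_def using pos
  by (auto intro!: derivative_eq_intros P_line[OF assms] Q_line[OF assms] R_line[OF assms])

text \<open>
  The perturbed function \<open>u + v / n\<close> has a multiple in \<open>NM\<close> by a factor tending to \<open>1\<close>, because
  \<open>1\<close> is a strict maximum of the fibering map of \<open>u\<close>; no implicit function theorem is needed.
\<close>

lemma minimizer_derivative_nonneg:
  assumes lam: "small lam" and u: "u \<in> NM lam" "\<And>w. w \<in> NM lam \<Longrightarrow> J lam u \<le> J lam w" and v: "v \<in> W"
  shows "0 \<le> dP u v - lam * dQ u v - dR u v"
proof -
  note uW = NM_facts(1)[OF lam u(1)]
  define \<Psi> where "\<Psi> n t e \<longleftrightarrow> \<bar>t - 1\<bar> < 1 / real (Suc (Suc n)) \<and> 0 \<le> e \<and> e \<le> 2 / real (Suc n) \<and>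
      0 \<le> dP (\<lambda>x. t * u x + e * v x) v - lam * dQ (\<lambda>x. t * u x + e * v x) v - dR (\<lambda>x. t * u x + e * v x) v"
    for n t e
  have "\<exists>t e. \<Psi> n t e" for n
  proof -
    define \<delta> where "\<delta> = 1 / (2 * real (Suc (Suc n)))"
    have \<delta>: "0 < \<delta>" "\<delta> < 1" "\<delta> < 1 / real (Suc (Suc n))" by (auto simp: \<delta>_def field_simps)
    let ?e = "\<lambda>k. 1 / real (Suc k)"
    let ?g = "\<lambda>k t. J lam (\<lambda>x. t * (u x + ?e k * v x))"
    have e0: "?e \<longlonglongrightarrow> 0" using LIMSEQ_Suc[OF lim_1_over_n] .
    have conv: "(\<lambda>k. ?g k t) \<longlonglongrightarrow> J lam (\<lambda>x. t * u x)" for t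
    proof -
      have "isCont (\<lambda>e. J lam (\<lambda>x. t * u x + e * (t * v x))) 0"
        using J_line[OF scale_mem[OF uW] scale_mem[OF v]] by (rule DERIV_isCont)
      then have "(\<lambda>k. J lam (\<lambda>x. t * u x + ?e k * (t * v x))) \<longlonglongrightarrow> J lam (\<lambda>x. t * u x + 0 * (t * v x))"
        using e0 by (rule isCont_tendsto_compose)
      then show ?thesis by (simp add: algebra_simps)
    qed
    have less: "J lam (\<lambda>x. (1 - \<delta>) * u x) < J lam (\<lambda>x. 1 * u x)" "J lam (\<lambda>x. (1 + \<delta>) * u x) < J lam (\<lambda>x. 1 * u x)"
      using NM_fib_max(2)[OF lam u(1), of "1 - \<delta>"] NM_fib_max(2)[OF lam u(1), of "1 + \<delta>"] \<delta> by auto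
    have ev: "\<forall>\<^sub>F k in sequentially. Y k < X k" if "X \<longlonglongrightarrow> a" "Y \<longlonglongrightarrow> b" "b < a" for X Y :: "nat \<Rightarrow> real" and a b
    proof -
      have "(\<lambda>k. X k - Y k) \<longlonglongrightarrow> a - b" by (intro tendsto_intros that)
      then have "\<forall>\<^sub>F k in sequentially. 0 < X k - Y k" using that(3) by (intro order_tendstoD) auto
      then show ?thesis by eventually_elim auto
    qed
    have pos1: "(\<lambda>k. 0) \<longlonglongrightarrow> (0::real)" "0 < J lam (\<lambda>x. 1 * u x)" using NM_facts(4)[OF lam u(1)] by auto
    \<comment> \<open>For large \<open>k\<close> the fibering map of the perturbed function is still
      larger at 1 than at both ends of the window, so it has an interior maximum there. Positivity
      at 1 keeps the perturbed function nonzero, and n \<le> k keeps the perturbation small.\<close>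
    have "\<forall>\<^sub>F k in sequentially. ?g k (1 - \<delta>) < ?g k 1 \<and> ?g k (1 + \<delta>) < ?g k 1 \<and> 0 < ?g k 1 \<and> n \<le> k"
      using ev[OF conv[of 1] conv less(1)] ev[OF conv[of 1] conv less(2)] ev[OF conv[of 1] pos1]
        eventually_ge_at_top[of n]
      by (intro eventually_conj)
    then obtain k where k: "?g k (1 - \<delta>) < ?g k 1" "?g k (1 + \<delta>) < ?g k 1" "0 < ?g k 1" "n \<le> k"
      by (auto dest!: eventually_happens)
    define w where "w = (\<lambda>x. u x + ?e k * v x)"
    have w: "w \<in> W" unfolding w_def by (rule add_mem[OF uW v])
    have g: "?g k = (\<lambda>t. J lam (\<lambda>x. t * w x))" by (simp add: w_def)
    note k' = k[unfolded fun_cong[OF g]]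
    have "0 < N w"
    proof (rule ccontr)
      assume "\<not> 0 < N w"
      then have "N w = 0" using N_nonneg[OF w] by simp
      then have "P w \<le> 0" "Q w = 0" "R w = 0"
        using P_upper[OF w] Q_bound[OF w] R_bound[OF w] pos by auto
      then show False using k'(3) by (simp add: J_def)
    qed
    have "continuous_on {1-\<delta>..1+\<delta>} (\<lambda>t. J lam (\<lambda>x. t * w x))"
      using \<delta> by (intro continuous_at_imp_continuous_on ballI DERIV_isCont[OF fib_deriv(1)[OF w]]) auto
    then obtain t where t: "t \<in> {1-\<delta>..1+\<delta>}" "\<And>s. s \<in> {1-\<delta>..1+\<delta>} \<Longrightarrow> J lam (\<lambda>x. s * w x) \<le> J lam (\<lambda>x. t * w x)"
      using continuous_attains_sup[of "{1-\<delta>..1+\<delta>}" "\<lambda>t. J lam (\<lambda>x. t * w x)"] \<delta> by force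
    have "J lam (\<lambda>x. 1 * w x) \<le> J lam (\<lambda>x. t * w x)" using \<delta> by (intro t) auto
    then have "t \<noteq> 1 - \<delta>" "t \<noteq> 1 + \<delta>" using k' by auto
    then have t': "1 - \<delta> < t" "t < 1 + \<delta>" "0 < t" using t \<delta> by auto
    have "(\<lambda>x. t * w x) \<in> NM lam"
      using t' by (intro local_max_in_NM[OF lam w \<open>0 < N w\<close> t'(3), of "min (t - (1 - \<delta>)) (1 + \<delta> - t)"] t(2))
        (auto simp: abs_less_iff)
    then have "J lam u \<le> J lam (\<lambda>x. t * w x)" by (rule u(2))
    \<comment> \<open>Maximality on the ray gives J (t u) \<le> J u and minimality gives J u \<le> J
      (t w). At this fixed \<open>t\<close> the two outer functions differ by a multiple of t v, so
      the mean value theorem yields a point close to \<open>u\<close> at which the derivative in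
      direction \<open>v\<close> is nonnegative.\<close>
    then have "J lam (\<lambda>x. t * u x + 0 * (t * v x)) \<le> J lam (\<lambda>x. t * u x + ?e k * (t * v x))"
      using NM_fib_max(1)[OF lam u(1) t'(3)] by (simp add: w_def algebra_simps)
    moreover have "0 < ?e k" by simp
    then obtain z where z: "0 < z" "z < ?e k"
      and zeq: "J lam (\<lambda>x. t * u x + ?e k * (t * v x)) - J lam (\<lambda>x. t * u x + 0 * (t * v x))
      = (?e k - 0) * (dP (\<lambda>x. t * u x + z * (t * v x)) (\<lambda>x. t * v x) - lam * dQ (\<lambda>x. t * u x + z * (t * v x)) (\<lambda>x. t * v x)
          - dR (\<lambda>x. t * u x + z * (t * v x)) (\<lambda>x. t * v x))"
      using MVT2[OF _ J_line[OF scale_mem[OF uW, of t] scale_mem[OF v, of t]], of 0 "?e k" lam] by blast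
    ultimately have "0 \<le> (?e k - 0) * (dP (\<lambda>x. t * u x + z * (t * v x)) (\<lambda>x. t * v x) - lam * dQ (\<lambda>x. t * u x + z * (t * v x)) (\<lambda>x. t * v x)
          - dR (\<lambda>x. t * u x + z * (t * v x)) (\<lambda>x. t * v x))"
      unfolding zeq[symmetric] by simp
    then have z3: "0 \<le> dP (\<lambda>x. t * u x + z * (t * v x)) (\<lambda>x. t * v x) - lam * dQ (\<lambda>x. t * u x + z * (t * v x)) (\<lambda>x. t * v x)
          - dR (\<lambda>x. t * u x + z * (t * v x)) (\<lambda>x. t * v x)"
      using \<open>0 < ?e k\<close> by (simp add: zero_le_mult_iff zero_le_divide_iff del: of_nat_Suc)
    define y where "y = (\<lambda>x. t * u x + (z * t) * v x)"
    have y: "y \<in> W" unfolding y_def by (intro add_mem scale_mem uW v)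
    have "0 \<le> t * (dP y v - lam * dQ y v - dR y v)"
      using z3 dP_scale[OF y v, of t] dQ_scale[OF y v, of t] dR_scale[OF y v, of t]
      by (simp add: y_def algebra_simps)
    then have "0 \<le> dP y v - lam * dQ y v - dR y v" using t'(3) by (simp add: zero_le_mult_iff)
    moreover have "z * t \<le> 2 / real (Suc n)"
    proof -
      have "z * t \<le> ?e k * 2" using z t' \<delta> by (intro mult_mono) auto
      also have "\<dots> \<le> 1 / real (Suc n) * 2" using k(4) by (intro mult_right_mono) (auto simp: frac_le)
      finally show ?thesis by simp
    qed
    ultimately show ?thesis
      using t' z \<delta> by (intro exI[of _ t] exI[of _ "z * t"]) (auto simp: y_def \<Psi>_def)
  qed
  then obtain t e where "\<And>n. \<Psi> n (t n) (e n)" by metis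
  then have te: "\<And>n. \<bar>t n - 1\<bar> < 1 / real (Suc (Suc n))" "\<And>n. 0 \<le> e n" "\<And>n. e n \<le> 2 / real (Suc n)"
    "\<And>n. 0 \<le> dP (\<lambda>x. t n * u x + e n * v x) v - lam * dQ (\<lambda>x. t n * u x + e n * v x) v - dR (\<lambda>x. t n * u x + e n * v x) v"
    unfolding \<Psi>_def by blast+
  have "(\<lambda>n. t n - 1) \<longlonglongrightarrow> 0"
    using te(1) by (intro Lim_null_comparison[OF _ LIMSEQ_Suc[OF LIMSEQ_Suc[OF lim_1_over_n]]])
      (auto intro!: always_eventually less_imp_le)
  then have t: "t \<longlonglongrightarrow> 1" by (simp add: LIM_zero_iff)
  have "(\<lambda>n. 2 * (1 / real (Suc n))) \<longlonglongrightarrow> 2 * 0"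
    by (intro tendsto_intros LIMSEQ_Suc[OF lim_1_over_n])
  then have e: "e \<longlonglongrightarrow> 0"
    using te(2,3) by (intro Lim_null_comparison[of e "\<lambda>n. 2 * (1 / real (Suc n))"]) (auto intro!: always_eventually)
  have "(\<lambda>n. dP (\<lambda>x. t n * u x + e n * v x) v - lam * dQ (\<lambda>x. t n * u x + e n * v x) v - dR (\<lambda>x. t n * u x + e n * v x) v)
     \<longlonglongrightarrow> dP u v - lam * dQ u v - dR u v"
    using uW v t e by (intro tendsto_intros dP_continuous dQ_continuous dR_continuous)
  then show ?thesis using te(4) by (intro LIMSEQ_le_const) auto
qed

theorem ground_state_ex:
  "\<exists>lam0>0. \<forall>lam. 0 < lam \<and> lam < lam0 \<longrightarrow>
     (\<exists>u\<in>NM lam. (\<forall>w\<in>NM lam. J lam u \<le> J lam w) \<and> 0 < J lam u \<and>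
        (\<forall>v\<in>W. dP u v = lam * dQ u v + dR u v))"
proof -
  have "\<exists>u\<in>NM lam. (\<forall>w\<in>NM lam. J lam u \<le> J lam w) \<and> 0 < J lam u \<and>
        (\<forall>v\<in>W. dP u v = lam * dQ u v + dR u v)" if lam: "small lam" for lam
  proof -
    obtain u where u: "u \<in> NM lam" "\<And>w. w \<in> NM lam \<Longrightarrow> J lam u \<le> J lam w"
      using minimizer_ex[OF lam] by auto
    note uW = NM_facts(1)[OF lam u(1)]
    have "dP u v = lam * dQ u v + dR u v" if v: "v \<in> W" for v
      \<comment> \<open>The directions \<open>v\<close> and - v together turn the inequality into an
        equation, since the pairings are homogeneous in the direction.\<close>
      using minimizer_derivative_nonneg[OF lam u v] minimizer_derivative_nonneg[OF lam u scale_mem[OF v, of "-1"]]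
        dP_scale[OF uW v, of "-1"] dQ_scale[OF uW v, of "-1"] dR_scale[OF uW v, of "-1"] by simp
    then show ?thesis using u NM_facts(4)[OF lam u(1)] by blast
  qed
  then show ?thesis using small_ex by meson
qed

end

section \<open>A fractional Sobolev inequality\<close>

lemma nn_integral_fatou_tendsto:
  fixes f :: "nat \<Rightarrow> 'b \<Rightarrow> ennreal"
  assumes [measurable]: "\<And>n. f n \<in> borel_measurable M"
    and lim: "AE x in M. (\<lambda>n. f n x) \<longlonglongrightarrow> g x"
    and le: "\<And>n. (\<integral>\<^sup>+x. f n x \<partial>M) \<le> X n" and X: "X \<longlonglongrightarrow> L"
  shows "(\<integral>\<^sup>+x. g x \<partial>M) \<le> L"
proof -
  have "(\<integral>\<^sup>+x. g x \<partial>M) = (\<integral>\<^sup>+x. liminf (\<lambda>n. f n x) \<partial>M)"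
    using lim by (intro nn_integral_cong_AE) (auto elim!: eventually_mono simp: lim_imp_Liminf)
  also have "\<dots> \<le> liminf (\<lambda>n. \<integral>\<^sup>+x. f n x \<partial>M)"
    by (intro nn_integral_liminf) simp
  also have "\<dots> \<le> liminf X" using le by (intro Liminf_mono) auto
  also have "\<dots> = L" using X by (simp add: lim_imp_Liminf)
  finally show ?thesis .
qed

text \<open>The p-th power of the Gagliardo seminorm, with \<sigma> in the role of s p. As an
  iterated nonnegative integral over \<open>lborel\<close> it may be infinite and fits Borel
  representatives.\<close>

definition gagliardo :: "real \<Rightarrow> real \<Rightarrow> ('a::euclidean_space \<Rightarrow> real) \<Rightarrow> ennreal" where
  "gagliardo p \<sigma> u = (\<integral>\<^sup>+x. \<integral>\<^sup>+y. ennreal (\<bar>u x - u y\<bar> powr p / norm (x - y) powr (real DIM('a) + \<sigma>))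
     \<partial>lborel \<partial>lborel)"

text \<open>With \<sigma> = s p this is the fractional Sobolev exponent N p / (N - s p).\<close>

definition critical_exponent :: "'a::euclidean_space itself \<Rightarrow> real \<Rightarrow> real \<Rightarrow> real" where
  "critical_exponent _ p \<sigma> = real DIM('a) * p / (real DIM('a) - \<sigma>)"

text \<open>
  In a ball around \<open>x\<close> with twice the volume that Chebyshev allows for \<open>{g \<ge> g x / 2}\<close>, at least
  half of the points \<open>y\<close> satisfy \<open>g x - g y \<ge> g x / 2\<close>.
\<close>

lemma sobolev_pointwise:
  fixes g :: "'a::euclidean_space \<Rightarrow> real"
  assumes [measurable]: "g \<in> borel_measurable borel"
    and \<sigma>: "0 < \<sigma>" "\<sigma> < real DIM('a)" and p: "1 < p"
    and q: "q = critical_exponent TYPE('a) p \<sigma>"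
    and V: "V = unit_ball_vol (real DIM('a))"
    and g: "\<And>x. 0 \<le> g x" and I: "(\<integral>\<^sup>+x. ennreal (g x powr q) \<partial>lborel) = ennreal I" "0 < I"
  shows "ennreal (V * 2 powr (- p - 1) * (V / 2 powr (q + 1)) powr (\<sigma> / real DIM('a)) * g x powr q)
    \<le> ennreal (I powr (\<sigma> / real DIM('a))) *
       (\<integral>\<^sup>+y. ennreal (\<bar>g x - g y\<bar> powr p / norm (x - y) powr (real DIM('a) + \<sigma>)) \<partial>lborel)"
proof (cases "g x = 0")
  case True
  then show ?thesis by simp
next
  case False
  define n where "n = real DIM('a)"
  have n: "0 < n" "\<sigma> < n" using \<sigma> by (auto simp: n_def)
  have gx: "0 < g x" using False g[of x] by simp
  have "0 < V" unfolding V by simp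
  have "0 < q" using n p by (simp add: q critical_exponent_def n_def)
  \<comment> \<open>The power r^n of the radius, n being the dimension. The ball has volume V t, and
    V t / 2 = I / (g x / 2)^q is the Chebyshev bound.\<close>
  define t where "t = 2 powr (q + 1) * I / (V * g x powr q)"
  have "0 < t" using gx I \<open>0 < V\<close> by (simp add: t_def)
  define r where "r = t powr (1 / n)"
  have "0 < r" using \<open>0 < t\<close> by (simp add: r_def)
  have rn: "r ^ DIM('a) = t"
    using \<open>0 < t\<close> n by (simp add: r_def n_def powr_powr flip: powr_realpow)
  define T where "T = {y. g x / 2 \<le> g y}"
  define S where "S = ball x r - T"
  have [measurable]: "T \<in> sets borel" "S \<in> sets borel" unfolding S_def T_def by measurable
  have ballm: "emeasure lborel (ball x r) = ennreal (V * t)"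
    using \<open>0 < r\<close> by (simp add: emeasure_ball rn V)
  have T: "emeasure lborel T \<le> ennreal (V * t / 2)"
  proof -
    have "ennreal ((g x / 2) powr q) * emeasure lborel T = (\<integral>\<^sup>+y. ennreal ((g x / 2) powr q) * indicator T y \<partial>lborel)"
      by (rule nn_integral_cmult_indicator[symmetric]) measurable
    also have "\<dots> \<le> (\<integral>\<^sup>+x. ennreal (g x powr q) \<partial>lborel)"
      using gx \<open>0 < q\<close> by (intro nn_integral_mono) (auto simp: T_def indicator_def intro!: ennreal_leI powr_mono2)
    finally have *: "ennreal ((g x / 2) powr q) * emeasure lborel T \<le> ennreal I" unfolding I .
    have fin: "emeasure lborel T < top"
    proof (rule ccontr)
      assume "\<not> emeasure lborel T < top"
      then have "emeasure lborel T = top" using less_top by blast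
      then show False using * gx by (simp add: ennreal_mult_top top_unique)
    qed
    then have "emeasure lborel T = ennreal (measure lborel T)"
      by (simp add: emeasure_eq_ennreal_measure)
    moreover from this have "(g x / 2) powr q * measure lborel T \<le> I"
      using * I(2) by (simp flip: ennreal_mult)
    then have "measure lborel T \<le> V * t / 2"
      using gx \<open>0 < V\<close> by (simp add: t_def powr_add powr_divide field_simps)
    ultimately show ?thesis by (simp add: ennreal_leI)
  qed
  have S: "ennreal (V * t / 2) \<le> emeasure lborel S"
  proof -
    have "ennreal (V * t) \<le> emeasure lborel (S \<union> T)"
      unfolding ballm[symmetric] by (intro emeasure_mono) (auto simp: S_def T_def[symmetric])
    also have "\<dots> \<le> emeasure lborel S + emeasure lborel T" by (intro emeasure_subadditive) auto
    also have "\<dots> \<le> emeasure lborel S + ennreal (V * t / 2)" by (intro add_left_mono T)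
    also have "ennreal (V * t) = ennreal (V * t / 2) + ennreal (V * t / 2)"
      using \<open>0 < V\<close> \<open>0 < t\<close> by (simp flip: ennreal_plus)
    finally show ?thesis by (simp add: ennreal_add_left_cancel_le add.commute)
  qed
  define k where "k = (g x / 2) powr p / r powr (n + \<sigma>)"
  have "0 < k" using gx \<open>0 < r\<close> by (simp add: k_def)
  have "ennreal k * ennreal (V * t / 2) \<le> ennreal k * emeasure lborel S"
    by (intro mult_left_mono S) simp
  also have "\<dots> = (\<integral>\<^sup>+y. ennreal k * indicator S y \<partial>lborel)"
    by (rule nn_integral_cmult_indicator[symmetric]) measurable
  also have "\<dots> \<le> (\<integral>\<^sup>+y. ennreal (\<bar>g x - g y\<bar> powr p / norm (x - y) powr (n + \<sigma>)) \<partial>lborel)"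
  proof (intro nn_integral_mono)
    fix y
    show "ennreal k * indicator S y \<le> ennreal (\<bar>g x - g y\<bar> powr p / norm (x - y) powr (n + \<sigma>))"
    proof (cases "y \<in> S")
      case True
      then have y: "norm (x - y) < r" "g y < g x / 2" by (auto simp: S_def T_def dist_norm)
      then have "x \<noteq> y" using gx by auto
      then have "k \<le> \<bar>g x - g y\<bar> powr p / norm (x - y) powr (n + \<sigma>)"
        unfolding k_def using y gx p n \<sigma> \<open>0 < r\<close> by (intro frac_le powr_mono2) auto
      then show ?thesis using True by (simp add: ennreal_leI)
    qed simp
  qed
  finally have *: "ennreal (k * (V * t / 2)) \<le> (\<integral>\<^sup>+y. ennreal (\<bar>g x - g y\<bar> powr p / norm (x - y) powr (n + \<sigma>)) \<partial>lborel)"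
    using \<open>0 < k\<close> \<open>0 < V\<close> \<open>0 < t\<close> by (simp flip: ennreal_mult)
  \<comment> \<open>This identity characterises the critical exponent: the power of
    \<open>g x\<close> contributed by the radius and the power p from the numerator add up to
    exactly q.\<close>
  have qeq: "q = p + q * (\<sigma> / n)"
    using n by (simp add: q critical_exponent_def n_def field_simps)
  have "k * (V * t / 2) = V * 2 powr (- p - 1) * (g x powr p * (t / r powr (n + \<sigma>)))"
    using gx by (simp add: k_def powr_divide powr_diff powr_minus field_simps)
  also have "t / r powr (n + \<sigma>) = 1 / t powr (\<sigma> / n)"
    using \<open>0 < t\<close> n by (simp add: r_def powr_powr add_divide_distrib powr_add)
  also have "1 / t powr (\<sigma> / n) = (V / 2 powr (q + 1)) powr (\<sigma> / n) * g x powr (q * (\<sigma> / n)) / I powr (\<sigma> / n)"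
    using gx \<open>0 < V\<close> I(2) by (simp add: t_def powr_divide powr_mult powr_powr)
  finally have "I powr (\<sigma> / n) * (k * (V * t / 2)) = V * 2 powr (- p - 1) * (V / 2 powr (q + 1)) powr (\<sigma> / n) * (g x powr p * g x powr (q * (\<sigma> / n)))"
    using I(2) by (simp add: field_simps)
  also have "g x powr p * g x powr (q * (\<sigma> / n)) = g x powr q"
    by (metis powr_add qeq)
  finally have "ennreal (V * 2 powr (- p - 1) * (V / 2 powr (q + 1)) powr (\<sigma> / n) * g x powr q) =
     ennreal (I powr (\<sigma> / n) * (k * (V * t / 2)))"
    by (rule arg_cong[OF sym])
  also have "\<dots> = ennreal (I powr (\<sigma> / n)) * ennreal (k * (V * t / 2))"
    by (rule ennreal_mult') simp
  also have "\<dots> \<le> ennreal (I powr (\<sigma> / n)) * (\<integral>\<^sup>+y. ennreal (\<bar>g x - g y\<bar> powr p / norm (x - y) powr (n + \<sigma>)) \<partial>lborel)"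
    by (intro mult_left_mono *) simp
  finally show ?thesis by (simp add: n_def)
qed

text \<open>Integrating the pointwise inequality gives c I \<le> I^(\<sigma>/n) E for the integral
  \<open>I\<close> of g^q over n-dimensional space. Dividing by the power of \<open>I\<close>
  requires that \<open>I\<close> be finite, which the truncation in \<open>sobolev_critical\<close>
  provides.\<close>

lemma sobolev_critical_aux:
  fixes g :: "'a::euclidean_space \<Rightarrow> real"
  assumes [measurable]: "g \<in> borel_measurable borel"
    and \<sigma>: "0 < \<sigma>" "\<sigma> < real DIM('a)" and p: "1 < p"
    and q: "q = critical_exponent TYPE('a) p \<sigma>"
    and V: "V = unit_ball_vol (real DIM('a))"
    and c: "c = V * 2 powr (- p - 1) * (V / 2 powr (q + 1)) powr (\<sigma> / real DIM('a))"
    and g: "\<And>x. 0 \<le> g x" and fin: "(\<integral>\<^sup>+x. ennreal (g x powr q) \<partial>lborel) < top"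
    and E: "gagliardo p \<sigma> g \<le> ennreal E" "0 \<le> E"
  shows "(\<integral>\<^sup>+x. ennreal (g x powr q) \<partial>lborel) \<le> ennreal ((1 / c) powr (q / p) * E powr (q / p))"
proof -
  define n where "n = real DIM('a)"
  have n: "0 < n" "\<sigma> < n" using \<sigma> by (auto simp: n_def)
  have "0 < V" unfolding V by simp
  then have "0 < c" by (simp add: c)
  obtain I where I: "0 \<le> I" "(\<integral>\<^sup>+x. ennreal (g x powr q) \<partial>lborel) = ennreal I"
    using fin by (metis ennreal_cases less_irrefl infinity_ennreal_def)
  show ?thesis
  proof (cases "I = 0")
    case False
    then have "0 < I" using I by simp
    have "ennreal (c * I) = (\<integral>\<^sup>+x. ennreal (c * g x powr q) \<partial>lborel)"
      using \<open>0 < c\<close> I by (simp add: ennreal_mult' nn_integral_cmult)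
    also have "\<dots> \<le> (\<integral>\<^sup>+x. ennreal (I powr (\<sigma> / n)) *
       (\<integral>\<^sup>+y. ennreal (\<bar>g x - g y\<bar> powr p / norm (x - y) powr (n + \<sigma>)) \<partial>lborel) \<partial>lborel)"
      unfolding c n_def by (intro nn_integral_mono sobolev_pointwise assms I \<open>0 < I\<close>)
    also have "\<dots> = ennreal (I powr (\<sigma> / n)) * gagliardo p \<sigma> g"
      unfolding gagliardo_def n_def by (intro nn_integral_cmult) measurable
    also have "\<dots> \<le> ennreal (I powr (\<sigma> / n)) * ennreal E" by (intro mult_left_mono E) simp
    finally have "c * I \<le> I powr (\<sigma> / n) * E" using E by (simp flip: ennreal_mult)
    moreover have "I = I powr (\<sigma> / n) * I powr (1 - \<sigma> / n)"
      using \<open>0 < I\<close> by (simp flip: powr_add)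
    ultimately have "I powr (\<sigma> / n) * (c * I powr (1 - \<sigma> / n)) \<le> I powr (\<sigma> / n) * E"
      by (simp add: mult_ac)
    then have "I powr (1 - \<sigma> / n) \<le> 1 / c * E"
      using \<open>0 < I\<close> \<open>0 < c\<close> by (simp add: field_simps)
    then have "(I powr (1 - \<sigma> / n)) powr (q / p) \<le> (1 / c * E) powr (q / p)"
      using n p by (intro powr_mono2) (auto simp: q critical_exponent_def n_def)
    also have "(I powr (1 - \<sigma> / n)) powr (q / p) = I"
    proof -
      have e1: "(1 - \<sigma> / n) * (q / p) = 1" using n p by (simp add: q critical_exponent_def n_def field_simps)
      show ?thesis unfolding powr_powr e1 using I by simp
    qed
    also have "(1 / c * E) powr (q / p) = (1 / c) powr (q / p) * E powr (q / p)"
      by (rule powr_mult)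
    finally show ?thesis unfolding I by (rule ennreal_leI)
  qed (use I in simp)
qed

lemma gagliardo_mono:
  assumes "0 < p" "\<And>x y. \<bar>u x - u y\<bar> \<le> \<bar>v x - v y\<bar>"
  shows "gagliardo p \<sigma> u \<le> gagliardo p \<sigma> v"
  unfolding gagliardo_def using assms
  by (intro nn_integral_mono ennreal_leI divide_right_mono powr_mono2) auto

text \<open>The truncations of |u| at height k are 1-Lipschitz functions of \<open>u\<close>, so
  their Gagliardo energy does not increase; being bounded and p-integrable they are q-integrable.
  Fatou removes the truncation.\<close>

lemma sobolev_critical:
  fixes u :: "'a::euclidean_space \<Rightarrow> real"
  assumes [measurable]: "u \<in> borel_measurable borel"
    and \<sigma>: "0 < \<sigma>" "\<sigma> < real DIM('a)" and p: "1 < p"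
    and q: "q = critical_exponent TYPE('a) p \<sigma>"
    and V: "V = unit_ball_vol (real DIM('a))"
    and c: "c = V * 2 powr (- p - 1) * (V / 2 powr (q + 1)) powr (\<sigma> / real DIM('a))"
    and fin: "(\<integral>\<^sup>+x. ennreal (\<bar>u x\<bar> powr p) \<partial>lborel) < top"
    and E: "gagliardo p \<sigma> u \<le> ennreal E" "0 \<le> E"
  shows "(\<integral>\<^sup>+x. ennreal (\<bar>u x\<bar> powr q) \<partial>lborel) \<le> ennreal ((1 / c) powr (q / p) * E powr (q / p))"
proof -
  define g where "g k x = min \<bar>u x\<bar> (real k)" for k x
  have [measurable]: "g k \<in> borel_measurable borel" for k unfolding g_def by measurable
  have "p \<le> q" using \<sigma> p by (simp add: q critical_exponent_def field_simps)
  have 1: "(\<integral>\<^sup>+x. ennreal (g k x powr q) \<partial>lborel) \<le> ennreal ((1 / c) powr (q / p) * E powr (q / p))" for k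
  proof (rule sobolev_critical_aux[OF _ \<sigma> p q V c])
    show "0 \<le> g k x" for x by (simp add: g_def)
    have "(\<integral>\<^sup>+x. ennreal (g k x powr q) \<partial>lborel) \<le> (\<integral>\<^sup>+x. ennreal (real k powr (q - p)) * ennreal (\<bar>u x\<bar> powr p) \<partial>lborel)"
    proof (intro nn_integral_mono)
      fix x
      have "g k x powr q = g k x powr (q - p) * g k x powr p" by (simp flip: powr_add)
      also have "\<dots> \<le> real k powr (q - p) * \<bar>u x\<bar> powr p"
        using \<open>p \<le> q\<close> p by (intro mult_mono powr_mono2) (auto simp: g_def)
      finally show "ennreal (g k x powr q) \<le> ennreal (real k powr (q - p)) * ennreal (\<bar>u x\<bar> powr p)"
        by (simp add: ennreal_leI flip: ennreal_mult')
    qed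
    also have "\<dots> < top" using fin by (simp add: nn_integral_cmult ennreal_mult_less_top)
    finally show "(\<integral>\<^sup>+x. ennreal (g k x powr q) \<partial>lborel) < top" .
    have "gagliardo p \<sigma> (g k) \<le> gagliardo p \<sigma> u"
      using p by (intro gagliardo_mono) (auto simp: g_def)
    then show "gagliardo p \<sigma> (g k) \<le> ennreal E" using E by auto
  qed (use E in auto)
  have ev: "(\<lambda>k. ennreal (g k x powr q)) \<longlonglongrightarrow> ennreal (\<bar>u x\<bar> powr q)" for x
  proof (rule tendsto_eventually)
    obtain k0 where k0: "\<bar>u x\<bar> \<le> real k0" using real_arch_simple by blast
    show "\<forall>\<^sub>F k in sequentially. ennreal (g k x powr q) = ennreal (\<bar>u x\<bar> powr q)"
      using eventually_ge_at_top[of k0] by eventually_elim (use k0 in \<open>auto simp: g_def min_def\<close>)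
  qed
  show ?thesis
    by (rule nn_integral_fatou_tendsto[where f="\<lambda>k x. ennreal (g k x powr q)", OF _ _ 1 tendsto_const])
      (use ev in auto)
qed

text \<open>On a set of finite measure a lower power is controlled by 1 plus the critical one. The
  function is first normalised, so that the estimate keeps the homogeneity r/p in the energy; the
  constant depends neither on \<open>u\<close> nor on \<open>E\<close>.\<close>

lemma sobolev_subcritical:
  fixes \<Omega> :: "'a::euclidean_space set"
  assumes \<sigma>: "0 < \<sigma>" "\<sigma> < real DIM('a)" and p: "1 < p"
    and q: "q = critical_exponent TYPE('a) p \<sigma>" and r: "0 < r" "r \<le> q"
    and \<Omega>: "\<Omega> \<in> sets borel" "emeasure lborel \<Omega> < top"
  shows "\<exists>D>0. \<forall>u E. u \<in> borel_measurable borel \<longrightarrow> (\<integral>\<^sup>+x. ennreal (\<bar>u x\<bar> powr p) \<partial>lborel) < top \<longrightarrow>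
     (AE x in lborel. x \<notin> \<Omega> \<longrightarrow> u x = 0) \<longrightarrow> gagliardo p \<sigma> u \<le> ennreal E \<longrightarrow> 0 \<le> E \<longrightarrow>
     (\<integral>\<^sup>+x. ennreal (\<bar>u x\<bar> powr r) \<partial>lborel) \<le> ennreal (D * E powr (r / p))"
proof -
  define V where "V = unit_ball_vol (real DIM('a))"
  define c where "c = V * 2 powr (- p - 1) * (V / 2 powr (q + 1)) powr (\<sigma> / real DIM('a))"
  have "0 < V" unfolding V_def by simp
  then have "0 < c" by (simp add: c_def)
  have "0 < q" using r by simp
  define D where "D = ((1 / c) powr (1 / p)) powr r * (measure lborel \<Omega> + 1)"
  have "D > 0" using \<open>0 < c\<close> by (auto simp: D_def intro!: mult_pos_pos add_nonneg_pos)
  moreover have "(\<integral>\<^sup>+x. ennreal (\<bar>u x\<bar> powr r) \<partial>lborel) \<le> ennreal (D * E powr (r / p))"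
    if u [measurable]: "u \<in> borel_measurable borel" and fin: "(\<integral>\<^sup>+x. ennreal (\<bar>u x\<bar> powr p) \<partial>lborel) < top"
      and 0: "AE x in lborel. x \<notin> \<Omega> \<longrightarrow> u x = 0" and E: "gagliardo p \<sigma> u \<le> ennreal E" "0 \<le> E" for u E
  proof -
    \<comment> \<open>k^q is the critical bound, so u / k has q-th power integral at most 1. The
      elementary inequality for t = |u| / k then costs a factor k^r, which is the desired power of
      \<open>E\<close>.\<close>
    define k where "k = (1 / c) powr (1 / p) * E powr (1 / p)"
    have kq: "(1 / c) powr (q / p) * E powr (q / p) = k powr q"
      using \<open>0 < c\<close> E by (simp add: k_def powr_mult powr_powr)
    have I: "(\<integral>\<^sup>+x. ennreal (\<bar>u x\<bar> powr q) \<partial>lborel) \<le> ennreal (k powr q)"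
      using sobolev_critical[OF u \<sigma> p q V_def c_def fin E] unfolding kq .
    show ?thesis
    proof (cases "k = 0")
      case True
      then have "(\<integral>\<^sup>+x. ennreal (\<bar>u x\<bar> powr q) \<partial>lborel) = 0" using I \<open>0 < q\<close> by simp
      then have "AE x in lborel. ennreal (\<bar>u x\<bar> powr q) = 0" by (subst (asm) nn_integral_0_iff_AE) auto
      then have "AE x in lborel. ennreal (\<bar>u x\<bar> powr r) = 0"
        by eventually_elim simp
      then have "(\<integral>\<^sup>+x. ennreal (\<bar>u x\<bar> powr r) \<partial>lborel) = 0" by (subst nn_integral_0_iff_AE) auto
      then show ?thesis by simp
    next
      case False
      then have k: "0 < k" using E by (simp add: k_def)
      have "(\<integral>\<^sup>+x. ennreal (\<bar>u x\<bar> powr r) \<partial>lborel) \<le>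
        (\<integral>\<^sup>+x. ennreal (k powr r) * (indicator \<Omega> x + ennreal (1 / k powr q) * ennreal (\<bar>u x\<bar> powr q)) \<partial>lborel)"
      proof (intro nn_integral_mono_AE)
        show "AE x in lborel. ennreal (\<bar>u x\<bar> powr r) \<le>
           ennreal (k powr r) * (indicator \<Omega> x + ennreal (1 / k powr q) * ennreal (\<bar>u x\<bar> powr q))"
          using 0
        proof eventually_elim
          case (elim x)
          have "(\<bar>u x\<bar> / k) powr r \<le> 1 + (\<bar>u x\<bar> / k) powr q"
          proof (cases "\<bar>u x\<bar> / k \<le> 1")
            case True
            then have "(\<bar>u x\<bar> / k) powr r \<le> 1 powr r" using r k by (intro powr_mono2) auto
            then show ?thesis by (simp add: add_increasing2)
          next
            case False
            then have "(\<bar>u x\<bar> / k) powr r \<le> (\<bar>u x\<bar> / k) powr q" using r by (intro powr_mono) auto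
            then show ?thesis by simp
          qed
          then have *: "\<bar>u x\<bar> powr r \<le> k powr r * (1 + 1 / k powr q * \<bar>u x\<bar> powr q)"
            using k by (simp add: powr_divide field_simps)
          show ?case
          proof (cases "x \<in> \<Omega>")
            case True
            then show ?thesis using * k
              by (simp add: ennreal_leI flip: ennreal_mult' ennreal_plus ennreal_1)
          next
            case False
            then have "u x = 0" using elim by simp
            then show ?thesis by simp
          qed
        qed
      qed
      also have "\<dots> = ennreal (k powr r) * (emeasure lborel \<Omega> + ennreal (1 / k powr q) * (\<integral>\<^sup>+x. ennreal (\<bar>u x\<bar> powr q) \<partial>lborel))"
        using \<Omega>(1) by (simp add: nn_integral_cmult nn_integral_add)
      also have "\<dots> \<le> ennreal (k powr r) * (ennreal (measure lborel \<Omega>) + ennreal (1 / k powr q) * ennreal (k powr q))"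
        using \<Omega>(2) by (intro mult_left_mono add_mono I) (auto simp: emeasure_eq_ennreal_measure)
      also have "\<dots> = ennreal (k powr r * (measure lborel \<Omega> + 1))"
        using k by (simp flip: ennreal_mult' ennreal_plus ennreal_1)
      also have "k powr r * (measure lborel \<Omega> + 1) = D * E powr (r / p)"
        using \<open>0 < c\<close> E by (simp add: k_def D_def powr_mult powr_powr mult_ac)
      finally show ?thesis .
    qed
  qed
  ultimately show ?thesis by blast
qed

section \<open>Compactness of the embedding\<close>

lemma L1_Cauchy_AE_convergent_subseq:
  fixes f :: "nat \<Rightarrow> 'b \<Rightarrow> real"
  assumes [measurable]: "\<And>n. f n \<in> borel_measurable M"
    and Cauchy: "\<And>e. 0 < e \<Longrightarrow> \<exists>n0. \<forall>n\<ge>n0. \<forall>m\<ge>n0. (\<integral>\<^sup>+x. ennreal \<bar>f n x - f m x\<bar> \<partial>M) \<le> ennreal e"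
  shows "\<exists>h. strict_mono h \<and> (AE x in M. convergent (\<lambda>i. f (h i) x))"
proof -
  have "\<exists>n0. \<forall>n\<ge>n0. \<forall>m\<ge>n0. (\<integral>\<^sup>+x. ennreal \<bar>f n x - f m x\<bar> \<partial>M) \<le> ennreal ((1/2)^i)" for i
    using Cauchy[of "(1/2)^i"] by simp
  then obtain n0 where n0: "\<And>i n m. n \<ge> n0 i \<Longrightarrow> m \<ge> n0 i \<Longrightarrow> (\<integral>\<^sup>+x. ennreal \<bar>f n x - f m x\<bar> \<partial>M) \<le> ennreal ((1/2)^i)"
    by metis
  \<comment> \<open>Adding all earlier indices makes \<open>h\<close> strictly increasing and at
    least \<open>n0 i\<close> at the same time; successive differences are then summable in
    L^1.\<close>
  define h where "h i = i + (\<Sum>j\<le>i. n0 j)" for i :: nat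
  have h: "strict_mono h" by (simp add: strict_mono_Suc_iff h_def)
  have "n0 i \<le> h i" for i
    unfolding h_def by (metis add_increasing atMost_iff finite_atMost le_refl member_le_sum zero_le)
  then have hn: "n0 i \<le> h i" "n0 i \<le> h (Suc i)" for i
    using strict_mono_leD[OF h, of i "Suc i"] by (auto intro: order_trans)
  have "(\<integral>\<^sup>+x. (\<Sum>i. ennreal \<bar>f (h (Suc i)) x - f (h i) x\<bar>) \<partial>M) = (\<Sum>i. \<integral>\<^sup>+x. ennreal \<bar>f (h (Suc i)) x - f (h i) x\<bar> \<partial>M)"
    by (intro nn_integral_suminf) measurable
  also have "\<dots> \<le> (\<Sum>i. ennreal ((1/2)^i))"
    using n0 hn by (intro suminf_le) auto
  also have "\<dots> = ennreal (\<Sum>i. (1/2)^i)" by (intro suminf_ennreal2) (auto simp: summable_geometric)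
  also have "\<dots> < top" by simp
  finally have "AE x in M. (\<Sum>i. ennreal \<bar>f (h (Suc i)) x - f (h i) x\<bar>) \<noteq> \<infinity>"
    by (intro nn_integral_noteq_infinite) auto
  then have "AE x in M. convergent (\<lambda>i. f (h i) x)"
  proof eventually_elim
    case (elim x)
    then have "summable (\<lambda>i. \<bar>f (h (Suc i)) x - f (h i) x\<bar>)"
      by (intro summable_suminf_not_top) auto
    then have "summable (\<lambda>i. f (h (Suc i)) x - f (h i) x)"
      by (rule summable_rabs_cancel)
    then have "convergent (\<lambda>n. \<Sum>i<n. f (h (Suc i)) x - f (h i) x)"
      by (simp add: summable_iff_convergent)
    then have "convergent (\<lambda>n. f (h n) x - f (h 0) x)" by (simp add: sum_lessThan_telescope[of "\<lambda>i. f (h i) x"])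
    then have "convergent (\<lambda>n. (f (h n) x - f (h 0) x) + f (h 0) x)"
      by (intro convergent_add convergent_const)
    then show ?case by simp
  qed
  then show ?thesis using h by blast
qed

text \<open>Values up to \<delta> are kept, larger ones are absorbed by the p-th power. This trades
  an L^1 estimate for the Gagliardo energy, with the small part at free disposal.\<close>

lemma le_threshold_powr:
  fixes t \<delta> p :: real
  assumes "0 \<le> t" "0 < \<delta>" "1 < p"
  shows "t \<le> \<delta> + \<delta> powr (1 - p) * t powr p"
proof (cases "t \<le> \<delta>")
  case False
  then have "t = t powr (1 - p) * t powr p" using assms by (simp flip: powr_add)
  also have "\<dots> \<le> \<delta> powr (1 - p) * t powr p"
    using False assms by (intro mult_right_mono powr_mono2') auto
  finally show ?thesis using assms by simp
qed (use assms in \<open>simp add: add_increasing2\<close>)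

section \<open>Mollification by a Lipschitz cone of radius 1/k\<close>

definition cone_kernel :: "real \<Rightarrow> 'a::euclidean_space \<Rightarrow> real" where
  "cone_kernel k z = max 0 (1 - k * norm z)"

lemma cone_kernel_bounds: "0 \<le> k \<Longrightarrow> 0 \<le> cone_kernel k z" "0 \<le> k \<Longrightarrow> cone_kernel k z \<le> 1"
  by (auto simp: cone_kernel_def)

lemma abs_cone_kernel [simp]: "\<bar>cone_kernel k z\<bar> = cone_kernel k z"
  by (simp add: cone_kernel_def)

lemma cone_kernel_measurable [measurable]: "cone_kernel k \<in> borel_measurable borel"
  unfolding cone_kernel_def[abs_def] by measurable

lemma cone_kernel_lipschitz:
  assumes "0 \<le> k"
  shows "\<bar>cone_kernel k (x - y) - cone_kernel k (x' - y)\<bar> \<le> k * dist x x'"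
proof -
  have "\<bar>cone_kernel k (x - y) - cone_kernel k (x' - y)\<bar> \<le> \<bar>k * norm (x - y) - k * norm (x' - y)\<bar>"
    by (auto simp: cone_kernel_def)
  also have "\<dots> = k * \<bar>norm (x - y) - norm (x' - y)\<bar>"
    using assms by (simp add: abs_mult flip: right_diff_distrib)
  also have "\<dots> \<le> k * norm ((x - y) - (x' - y))"
    using assms by (intro mult_left_mono norm_triangle_ineq3)
  finally show ?thesis by (simp add: dist_norm)
qed

definition mollify :: "real \<Rightarrow> ('a::euclidean_space \<Rightarrow> real) \<Rightarrow> 'a \<Rightarrow> real" where
  "mollify k u x = (\<integral>y. cone_kernel k (x - y) * u y \<partial>lborel)"

text \<open>A lower bound for the integral of the cone, which is not normalised: on the ball of
  radius 1 / (2k) the cone is at least 1/2.\<close>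

definition mollify_mass :: "real \<Rightarrow> 'a::euclidean_space itself \<Rightarrow> real" where
  "mollify_mass k _ = unit_ball_vol (real DIM('a)) * (1 / (2 * k)) ^ DIM('a) / 2"

context
  fixes k :: real
  assumes k: "0 < k"
begin

lemma mollify_integrable:
  fixes u :: "'a::euclidean_space \<Rightarrow> real"
  assumes u: "integrable lborel u"
  shows "integrable lborel (\<lambda>y. cone_kernel k (x - y) * u y)"
proof (rule Bochner_Integration.integrable_bound[OF u])
  have [measurable]: "u \<in> borel_measurable borel" using borel_measurable_integrable[OF u] by simp
  show "(\<lambda>y. cone_kernel k (x - y) * u y) \<in> borel_measurable lborel" by measurable
  show "AE y in lborel. norm (cone_kernel k (x - y) * u y) \<le> norm (u y)"
    unfolding real_norm_def abs_mult abs_cone_kernel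
    using cone_kernel_bounds[of k] k by (intro AE_I2 mult_left_le_one_le) auto
qed

text \<open>For fixed \<open>k\<close> these two bounds make the mollifications of an L^1-bounded
  family uniformly bounded and equicontinuous, the input for a convergent subsequence.\<close>

lemma mollify_bound:
  fixes u :: "'a::euclidean_space \<Rightarrow> real"
  assumes u: "integrable lborel u" and D: "(\<integral>y. \<bar>u y\<bar> \<partial>lborel) \<le> D"
  shows "\<bar>mollify k u x\<bar> \<le> D" "\<bar>mollify k u x - mollify k u x'\<bar> \<le> k * dist x x' * D"
proof -
  have "\<bar>mollify k u x\<bar> \<le> (\<integral>y. \<bar>cone_kernel k (x - y) * u y\<bar> \<partial>lborel)"
    unfolding mollify_def by (rule integral_abs_bound)
  also have "\<dots> \<le> (\<integral>y. \<bar>u y\<bar> \<partial>lborel)"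
    using cone_kernel_bounds[of k] k
    by (intro integral_mono integrable_abs mollify_integrable u) (auto simp: abs_mult intro!: mult_left_le_one_le)
  finally show "\<bar>mollify k u x\<bar> \<le> D" using D by simp
  have "\<bar>mollify k u x - mollify k u x'\<bar> = \<bar>\<integral>y. cone_kernel k (x - y) * u y - cone_kernel k (x' - y) * u y \<partial>lborel\<bar>"
    unfolding mollify_def by (subst Bochner_Integration.integral_diff) (auto intro: mollify_integrable u)
  also have "\<dots> \<le> (\<integral>y. \<bar>cone_kernel k (x - y) * u y - cone_kernel k (x' - y) * u y\<bar> \<partial>lborel)"
    by (rule integral_abs_bound)
  also have "\<dots> \<le> (\<integral>y. k * dist x x' * \<bar>u y\<bar> \<partial>lborel)"
    using cone_kernel_lipschitz[of k x _ x'] k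
    by (intro integral_mono integrable_abs Bochner_Integration.integrable_diff mollify_integrable integrable_mult_right u)
      (auto simp: abs_mult intro!: mult_right_mono simp flip: left_diff_distrib)
  also have "\<dots> = k * dist x x' * (\<integral>y. \<bar>u y\<bar> \<partial>lborel)" by simp
  also have "\<dots> \<le> k * dist x x' * D" using k D by (intro mult_left_mono) auto
  finally show "\<bar>mollify k u x - mollify k u x'\<bar> \<le> k * dist x x' * D" .
qed

lemma mollify_mass_pos: "0 < mollify_mass k TYPE('a::euclidean_space)"
  using k by (simp add: mollify_mass_def)

lemma cone_kernel_integrable: "integrable lborel (\<lambda>y. cone_kernel k (x - y :: 'a::euclidean_space))"
proof (rule Bochner_Integration.integrable_bound)
  show "integrable lborel (indicator (cball x (1 / k)) :: 'a \<Rightarrow> real)"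
    using emeasure_lborel_cball_finite[of x "1/k"] by (simp add: integrable_indicator_iff)
  have "cone_kernel k (x - y) \<le> indicator (cball x (1 / k)) y" for y
    using k by (auto simp: cone_kernel_def indicator_def dist_norm field_simps)
  then show "AE y in lborel. norm (cone_kernel k (x - y)) \<le> norm (indicator (cball x (1 / k)) y :: real)"
    by (intro AE_I2) simp
qed measurable

lemma cone_kernel_mass: "mollify_mass k TYPE('a) \<le> (\<integral>y. cone_kernel k (x - y :: 'a::euclidean_space) \<partial>lborel)"
proof -
  have "mollify_mass k TYPE('a) = (\<integral>y. 1 / 2 * indicator (ball x (1 / (2 * k))) y \<partial>lborel)"
    using k by (simp add: mollify_mass_def content_ball)
  also have "\<dots> \<le> (\<integral>y. cone_kernel k (x - y) \<partial>lborel)"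
  proof (rule integral_mono[OF _ cone_kernel_integrable])
    show "integrable lborel (\<lambda>y. 1 / 2 * indicator (ball x (1 / (2 * k))) y :: real)"
      using emeasure_lborel_ball_finite[of x "1/(2*k)"]
      by (intro integrable_mult_right) (simp add: integrable_indicator_iff)
    show "1 / 2 * indicator (ball x (1 / (2 * k))) y \<le> cone_kernel k (x - y)" for y
      using k by (auto simp: cone_kernel_def indicator_def dist_norm field_simps)
  qed
  finally show ?thesis .
qed

definition mollify_err :: "('a::euclidean_space \<Rightarrow> real) \<Rightarrow> 'a \<Rightarrow> ennreal" where
  "mollify_err u x = (\<integral>\<^sup>+y. ennreal (cone_kernel k (x - y) * \<bar>u x - u y\<bar>) \<partial>lborel)"

lemma mollify_err_measurable [measurable]:
  assumes [measurable]: "u \<in> borel_measurable borel"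
  shows "mollify_err u \<in> borel_measurable borel"
  unfolding mollify_err_def[abs_def] by measurable

lemma mollify_diff:
  fixes u :: "'a::euclidean_space \<Rightarrow> real"
  assumes u: "integrable lborel u"
  shows "ennreal \<bar>u x * (\<integral>y. cone_kernel k (x - y) \<partial>lborel) - mollify k u x\<bar> \<le> mollify_err u x"
proof -
  have i: "integrable lborel (\<lambda>y. u x * cone_kernel k (x - y) - cone_kernel k (x - y) * u y)"
    by (intro Bochner_Integration.integrable_diff integrable_mult_right cone_kernel_integrable mollify_integrable u)
  have "u x * (\<integral>y. cone_kernel k (x - y) \<partial>lborel) - mollify k u x
     = (\<integral>y. u x * cone_kernel k (x - y) - cone_kernel k (x - y) * u y \<partial>lborel)"
    unfolding mollify_def
    by (subst Bochner_Integration.integral_diff) (auto intro: cone_kernel_integrable mollify_integrable u)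
  then have "ennreal \<bar>u x * (\<integral>y. cone_kernel k (x - y) \<partial>lborel) - mollify k u x\<bar>
    \<le> (\<integral>\<^sup>+y. ennreal (norm (u x * cone_kernel k (x - y) - cone_kernel k (x - y) * u y)) \<partial>lborel)"
    using integral_norm_bound_ennreal[OF i] by simp
  also have "\<dots> = mollify_err u x"
    unfolding mollify_err_def using cone_kernel_bounds(1)[of k] k
    by (intro nn_integral_cong) (simp add: abs_mult mult.commute[of "u x"] flip: right_diff_distrib)
  finally show ?thesis .
qed

text \<open>The triangle inequality after multiplication by the mass of the kernel. Multiplying in
  place of normalising means that only a lower bound of the mass is required.\<close>

lemma mollify_compare:
  fixes u v :: "'a::euclidean_space \<Rightarrow> real"
  assumes u: "integrable lborel u" and v: "integrable lborel v"
  shows "ennreal (mollify_mass k TYPE('a)) * ennreal \<bar>u x - v x\<bar>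
    \<le> ennreal \<bar>mollify k u x - mollify k v x\<bar> + (mollify_err u x + mollify_err v x)"
proof -
  define C where "C = (\<integral>y. cone_kernel k (x - y) \<partial>lborel)"
  have C: "mollify_mass k TYPE('a) \<le> C" unfolding C_def by (rule cone_kernel_mass)
  then have C0: "0 < C" using mollify_mass_pos[where 'a='a] by simp
  have "mollify_mass k TYPE('a) * \<bar>u x - v x\<bar> \<le> C * \<bar>u x - v x\<bar>"
    using C by (intro mult_right_mono) auto
  also have "\<dots> = \<bar>u x * C - v x * C\<bar>" using C0 by (simp add: abs_mult mult.commute[of C] flip: left_diff_distrib)
  also have "\<dots> \<le> \<bar>mollify k u x - mollify k v x\<bar> + (\<bar>u x * C - mollify k u x\<bar> + \<bar>v x * C - mollify k v x\<bar>)"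
    by linarith
  finally have "ennreal (mollify_mass k TYPE('a) * \<bar>u x - v x\<bar>) \<le> ennreal (\<bar>mollify k u x - mollify k v x\<bar> + (\<bar>u x * C - mollify k u x\<bar> + \<bar>v x * C - mollify k v x\<bar>))"
    by (rule ennreal_leI)
  also have "\<dots> = ennreal \<bar>mollify k u x - mollify k v x\<bar> + (ennreal \<bar>u x * C - mollify k u x\<bar> + ennreal \<bar>v x * C - mollify k v x\<bar>)"
    by simp
  also have "\<dots> \<le> ennreal \<bar>mollify k u x - mollify k v x\<bar> + (mollify_err u x + mollify_err v x)"
    unfolding C_def by (intro add_left_mono add_mono mollify_diff u v)
  finally show ?thesis
    using mollify_mass_pos[where 'a='a] by (simp add: ennreal_mult' less_imp_le)
qed

text \<open>On the support of the kernel the distance is below 1/k, so the p-th power part is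
  dominated by k^(-(n+\<sigma>)) times the Gagliardo quotient in dimension n; the remainder is at
  most \<delta> times the volume of the ball. The factor 2^(n+1) is that volume divided by
  \<open>mollify_mass\<close>. Both terms become small by choosing \<delta> first and
  \<open>k\<close> afterwards.\<close>

lemma mollify_err_integral:
  fixes u :: "'a::euclidean_space \<Rightarrow> real"
  assumes [measurable]: "u \<in> borel_measurable borel" "\<Omega> \<in> sets borel"
    and \<Omega>: "emeasure lborel \<Omega> < top" and p: "1 < p" and \<sigma>: "0 < \<sigma>" and "0 < \<delta>"
    and E: "gagliardo p \<sigma> u \<le> ennreal E" "0 \<le> E"
  shows "(\<integral>\<^sup>+x. indicator \<Omega> x * mollify_err u x \<partial>lborel) \<le>
     ennreal (mollify_mass k TYPE('a) * (2 ^ (DIM('a) + 1) * (measure lborel \<Omega> * \<delta>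
       + \<delta> powr (1 - p) * E * (1 / k) powr \<sigma> / unit_ball_vol (real DIM('a)))))"
proof -
  define V where "V = unit_ball_vol (real DIM('a))"
  define \<alpha> where "\<alpha> = real DIM('a) + \<sigma>"
  have V: "0 < V" by (simp add: V_def)
  have \<alpha>: "0 < \<alpha>" using \<sigma> by (simp add: \<alpha>_def)
  define G where "G x = (\<integral>\<^sup>+y. ennreal (\<bar>u x - u y\<bar> powr p / norm (x - y) powr \<alpha>) \<partial>lborel)" for x
  have [measurable]: "G \<in> borel_measurable borel" unfolding G_def[abs_def] by measurable
  have err: "mollify_err u x \<le> ennreal (\<delta> * (V * (1 / k) ^ DIM('a))) + ennreal (\<delta> powr (1 - p) * (1 / k) powr \<alpha>) * G x" for x
  proof -
    have "mollify_err u x \<le> (\<integral>\<^sup>+y. ennreal \<delta> * indicator (ball x (1 / k)) y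
       + ennreal (\<delta> powr (1 - p) * (1 / k) powr \<alpha>) * ennreal (\<bar>u x - u y\<bar> powr p / norm (x - y) powr \<alpha>) \<partial>lborel)"
      unfolding mollify_err_def
    proof (intro nn_integral_mono)
      fix y
      define t where "t = \<bar>u x - u y\<bar>"
      have "0 \<le> t" by (simp add: t_def)
      have "cone_kernel k (x - y) * t \<le> \<delta> * indicator (ball x (1 / k)) y
          + \<delta> powr (1 - p) * (1 / k) powr \<alpha> * (t powr p / norm (x - y) powr \<alpha>)"
      proof (cases "y \<in> ball x (1 / k) \<and> x \<noteq> y")
        case True
        then have n: "0 < norm (x - y)" "norm (x - y) \<le> 1 / k" by (auto simp: dist_norm)
        have "cone_kernel k (x - y) * t \<le> t"
          using cone_kernel_bounds[of k "x - y"] k \<open>0 \<le> t\<close> by (intro mult_left_le_one_le) auto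
        also have "\<dots> \<le> \<delta> + \<delta> powr (1 - p) * t powr p"
          by (rule le_threshold_powr) fact+
        also have "t powr p \<le> (1 / k) powr \<alpha> * (t powr p / norm (x - y) powr \<alpha>)"
        proof -
          have "norm (x - y) powr \<alpha> \<le> (1 / k) powr \<alpha>" using n \<alpha> by (intro powr_mono2) auto
          then have "t powr p * norm (x - y) powr \<alpha> \<le> t powr p * (1 / k) powr \<alpha>" by (intro mult_left_mono) auto
          then show ?thesis using n by (simp add: pos_le_divide_eq mult.commute)
        qed
        finally show ?thesis using True \<open>0 < \<delta>\<close> by (simp add: mult_left_mono mult.assoc)
      next
        case False
        have "cone_kernel k (x - y) * t = 0"
        proof (cases "x = y")
          case True then show ?thesis by (simp add: t_def)
        next
          case False
          with \<open>\<not> (y \<in> ball x (1 / k) \<and> x \<noteq> y)\<close> have "1 / k \<le> norm (x - y)" by (auto simp: dist_norm)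
          then show ?thesis using k by (simp add: cone_kernel_def field_simps)
        qed
        moreover have "0 \<le> \<delta> * indicator (ball x (1 / k)) y
          + \<delta> powr (1 - p) * (1 / k) powr \<alpha> * (t powr p / norm (x - y) powr \<alpha>)"
          using \<open>0 < \<delta>\<close> by (intro add_nonneg_nonneg mult_nonneg_nonneg divide_nonneg_nonneg) auto
        ultimately show ?thesis by linarith
      qed
      then have "ennreal (cone_kernel k (x - y) * t) \<le> ennreal (\<delta> * indicator (ball x (1 / k)) y
          + \<delta> powr (1 - p) * (1 / k) powr \<alpha> * (t powr p / norm (x - y) powr \<alpha>))" by (rule ennreal_leI)
      also have "\<dots> = ennreal (\<delta> * indicator (ball x (1 / k)) y)
          + ennreal (\<delta> powr (1 - p) * (1 / k) powr \<alpha> * (t powr p / norm (x - y) powr \<alpha>))"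
        using \<open>0 < \<delta>\<close> by (intro ennreal_plus) auto
      also have "ennreal (\<delta> powr (1 - p) * (1 / k) powr \<alpha> * (t powr p / norm (x - y) powr \<alpha>))
         = ennreal (\<delta> powr (1 - p) * (1 / k) powr \<alpha>) * ennreal (t powr p / norm (x - y) powr \<alpha>)"
        by (rule ennreal_mult') simp
      also have "ennreal (\<delta> * indicator (ball x (1 / k)) y) = ennreal \<delta> * indicator (ball x (1 / k)) y"
        by (simp add: indicator_def)
      finally show "ennreal (cone_kernel k (x - y) * \<bar>u x - u y\<bar>) \<le> ennreal \<delta> * indicator (ball x (1 / k)) y
       + ennreal (\<delta> powr (1 - p) * (1 / k) powr \<alpha>) * ennreal (\<bar>u x - u y\<bar> powr p / norm (x - y) powr \<alpha>)"
        unfolding t_def .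
    qed
    also have "\<dots> = ennreal \<delta> * emeasure lborel (ball x (1 / k)) + ennreal (\<delta> powr (1 - p) * (1 / k) powr \<alpha>) * G x"
    proof -
      have [measurable]: "ball x (1 / k) \<in> sets borel" by simp
      show ?thesis
        unfolding G_def by (subst nn_integral_add, measurable) (auto simp: nn_integral_cmult nn_integral_cmult_indicator)
    qed
    also have "ennreal \<delta> * emeasure lborel (ball x (1 / k)) = ennreal (\<delta> * (V * (1 / k) ^ DIM('a)))"
      using k \<open>0 < \<delta>\<close> by (simp add: emeasure_ball V_def ennreal_mult')
    finally show ?thesis .
  qed
  have "(\<integral>\<^sup>+x. indicator \<Omega> x * mollify_err u x \<partial>lborel) \<le>
     (\<integral>\<^sup>+x. ennreal (\<delta> * (V * (1 / k) ^ DIM('a))) * indicator \<Omega> x + ennreal (\<delta> powr (1 - p) * (1 / k) powr \<alpha>) * G x \<partial>lborel)"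
    using err by (intro nn_integral_mono) (auto simp: indicator_def)
  also have "\<dots> = ennreal (\<delta> * (V * (1 / k) ^ DIM('a))) * emeasure lborel \<Omega>
      + ennreal (\<delta> powr (1 - p) * (1 / k) powr \<alpha>) * gagliardo p \<sigma> u"
    unfolding gagliardo_def \<alpha>_def[symmetric] G_def[symmetric]
    by (subst nn_integral_add) (auto simp: nn_integral_cmult nn_integral_cmult_indicator)
  also have "\<dots> \<le> ennreal (\<delta> * (V * (1 / k) ^ DIM('a))) * ennreal (measure lborel \<Omega>)
      + ennreal (\<delta> powr (1 - p) * (1 / k) powr \<alpha>) * ennreal E"
    using \<Omega> E by (intro add_mono mult_left_mono) (auto simp: emeasure_eq_ennreal_measure)
  also have "\<dots> = ennreal (\<delta> * (V * (1 / k) ^ DIM('a)) * measure lborel \<Omega> + \<delta> powr (1 - p) * (1 / k) powr \<alpha> * E)"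
    using E V k \<open>0 < \<delta>\<close> by (simp flip: ennreal_mult' ennreal_plus)
  also have "(1 / k) powr \<alpha> = (1 / k) ^ DIM('a) * (1 / k) powr \<sigma>"
    using k by (simp add: \<alpha>_def powr_add powr_realpow)
  also have "\<delta> * (V * (1 / k) ^ DIM('a)) * measure lborel \<Omega> + \<delta> powr (1 - p) * ((1 / k) ^ DIM('a) * (1 / k) powr \<sigma>) * E
    = mollify_mass k TYPE('a) * (2 ^ (DIM('a) + 1) * (measure lborel \<Omega> * \<delta> + \<delta> powr (1 - p) * E * (1 / k) powr \<sigma> / V))"
  proof -
    define B where "B = (1 / k) ^ DIM('a)"
    define Z where "Z = (2 :: real) ^ DIM('a)"
    define X where "X = (1 / k) powr \<sigma>"
    have m: "mollify_mass k TYPE('a) = V * B / (2 * Z)"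
      by (simp add: mollify_mass_def V_def B_def Z_def power_divide power_mult_distrib)
    have Z: "2 ^ (DIM('a) + 1) = 2 * Z" "0 < Z" by (auto simp: Z_def)
    show ?thesis
      unfolding m Z(1) B_def[symmetric] X_def[symmetric] using V Z(2) by (simp add: field_simps)
  qed
  finally show ?thesis unfolding V_def .
qed

end

text \<open>A Rellich theorem. Mollifications at every scale converge pointwise along one
  subsequence and hence in L^1 on the domain; since the mollification error is uniform in the
  sequence, the functions themselves are L^1-Cauchy, and a further subsequence converges almost
  everywhere.\<close>

lemma bounded_gagliardo_AE_convergent_subseq:
  fixes \<Omega> :: "'a::euclidean_space set" and u :: "nat \<Rightarrow> 'a \<Rightarrow> real"
  assumes \<sigma>: "0 < \<sigma>" "\<sigma> < real DIM('a)" and p: "1 < p"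
    and \<Omega>: "\<Omega> \<in> sets borel" "emeasure lborel \<Omega> < top"
    and u [measurable]: "\<And>n. u n \<in> borel_measurable borel"
    and up: "\<And>n. (\<integral>\<^sup>+x. ennreal (\<bar>u n x\<bar> powr p) \<partial>lborel) < top"
    and u0: "\<And>n x. x \<notin> \<Omega> \<Longrightarrow> u n x = 0"
    and E: "\<And>n. gagliardo p \<sigma> (u n) \<le> ennreal E" "0 \<le> E"
  shows "\<exists>r g. strict_mono r \<and> g \<in> borel_measurable borel \<and> (\<forall>x. x \<notin> \<Omega> \<longrightarrow> g x = 0) \<and>
    (AE x in lborel. (\<lambda>n. u (r n) x) \<longlonglongrightarrow> g x)"
proof -
  note [measurable] = \<Omega>(1)
  have "1 \<le> critical_exponent TYPE('a) p \<sigma>"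
  proof -
    have "real DIM('a) - \<sigma> \<le> real DIM('a) * 1" using \<sigma> by simp
    also have "\<dots> \<le> real DIM('a) * p" using p by (intro mult_left_mono) auto
    finally show ?thesis using \<sigma> by (simp add: critical_exponent_def field_simps)
  qed
  from sobolev_subcritical[OF \<sigma> p refl _ this \<Omega>]
  obtain D0 where D0: "D0 > 0" "\<And>u E. u \<in> borel_measurable borel \<Longrightarrow> (\<integral>\<^sup>+x. ennreal (\<bar>u x\<bar> powr p) \<partial>lborel) < top \<Longrightarrow>
     (AE x in lborel. x \<notin> \<Omega> \<longrightarrow> u x = 0) \<Longrightarrow> gagliardo p \<sigma> u \<le> ennreal E \<Longrightarrow> 0 \<le> E \<Longrightarrow>
     (\<integral>\<^sup>+x. ennreal (\<bar>u x\<bar> powr 1) \<partial>lborel) \<le> ennreal (D0 * E powr (1 / p))"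
    by auto
  define D where "D = D0 * E powr (1 / p)"
  have uD: "(\<integral>\<^sup>+x. ennreal \<bar>u n x\<bar> \<partial>lborel) \<le> ennreal D" for n
    using D0(2)[OF u up _ E, of n] u0 by (simp add: D_def)
  have "0 \<le> D" using D0 by (simp add: D_def)
  have ui: "integrable lborel (u n)" for n
  proof (rule integrableI_bounded)
    show "(\<integral>\<^sup>+x. ennreal (norm (u n x)) \<partial>lborel) < \<infinity>" using uD[of n] by (simp add: order_le_less_trans)
  qed simp
  have uD': "(\<integral>x. \<bar>u n x\<bar> \<partial>lborel) \<le> D" for n
    using uD[of n] nn_integral_eq_integral[OF integrable_abs[OF ui[of n]]] \<open>0 \<le> D\<close> by simp
  define w where "w k n x = mollify (real (Suc k)) (u n) x" for k n x
  have w: "\<bar>w k n x\<bar> \<le> D" "\<bar>w k n x - w k n x'\<bar> \<le> real (Suc k) * dist x x' * D" for k n x x'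
    unfolding w_def using mollify_bound[OF _ ui uD', of "real (Suc k)"] by auto
  obtain S :: "'a set" where S: "countable S" "\<And>X. open X \<Longrightarrow> X \<noteq> {} \<Longrightarrow> \<exists>d\<in>S. d \<in> X"
    by (rule countable_dense_setE) blast
  \<comment> \<open>One diagonal selection over all pairs of a scale and a point of a countable
    dense set; the Lipschitz bounds extend the convergence to every point.\<close>
  obtain r :: "nat \<Rightarrow> nat" where r: "strict_mono r"
    "\<And>kx. kx \<in> (UNIV :: nat set) \<times> S \<Longrightarrow> \<exists>l. (\<lambda>n. w (fst kx) (r n) (snd kx)) \<longlonglongrightarrow> l"
    by (rule function_convergent_subsequence[of "(UNIV :: nat set) \<times> S" "\<lambda>n kx. w (fst kx) n (snd kx)" D])
      (use S w in auto)
  have conv: "convergent (\<lambda>n. w k (r n) x)" for k x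
  proof -
    have "Cauchy (\<lambda>n. w k (r n) x)"
    proof (rule CauchyI)
      fix e :: real assume "0 < e"
      \<comment> \<open>The summand 1 keeps \<open>L\<close> positive, hence a legitimate divisor,
        even if \<open>D\<close> is 0.\<close>
      define L where "L = real (Suc k) * D + 1"
      define d where "d = e / (3 * L)"
      have pos: "0 < L" unfolding L_def using \<open>0 \<le> D\<close> by (intro add_nonneg_pos) auto
      then have "0 < d" using \<open>0 < e\<close> by (simp add: d_def)
      then obtain y where y: "y \<in> S" "dist x y < d" using S(2)[of "ball x d"] by auto
      have lip: "\<bar>w k n x - w k n y\<bar> < e / 3" for n
      proof -
        have "\<bar>w k n x - w k n y\<bar> \<le> real (Suc k) * dist x y * D" by (rule w)
        also have "\<dots> \<le> dist x y * L" by (simp add: L_def algebra_simps)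
        also have "\<dots> < d * L" using y pos by (intro mult_strict_right_mono)
        also have "\<dots> = e / 3" using pos by (simp add: d_def)
        finally show ?thesis .
      qed
      have "Cauchy (\<lambda>n. w k (r n) y)" using r(2)[of "(k, y)"] y by (auto intro: LIMSEQ_imp_Cauchy)
      then obtain n0 where n0: "\<And>m n. m \<ge> n0 \<Longrightarrow> n \<ge> n0 \<Longrightarrow> norm (w k (r m) y - w k (r n) y) < e / 3"
        using CauchyD[of _ "e / 3"] \<open>0 < e\<close> by fastforce
      show "\<exists>M. \<forall>m\<ge>M. \<forall>n\<ge>M. norm (w k (r m) x - w k (r n) x) < e"
      proof (intro exI allI impI)
        fix m n assume "n0 \<le> m" "n0 \<le> n"
        then show "norm (w k (r m) x - w k (r n) x) < e"
          using n0[of m n] lip[of "r m"] lip[of "r n"] unfolding real_norm_def by linarith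
      qed
    qed
    then show ?thesis by (rule Cauchy_convergent)
  qed
  have wm [measurable]: "w k n \<in> borel_measurable borel" for k n
  proof -
    have "(real (Suc k) * D)-lipschitz_on UNIV (w k n)"
      using w(2)[of k n] \<open>0 \<le> D\<close> by (intro lipschitz_onI) (auto simp: dist_real_def mult_ac)
    then show ?thesis
      by (intro borel_measurable_continuous_onI lipschitz_on_continuous_on)
  qed
  define Wl where "Wl k x = lim (\<lambda>n. w k (r n) x)" for k x
  have Wl: "(\<lambda>n. w k (r n) x) \<longlonglongrightarrow> Wl k x" for k x
    using conv[of k x] by (simp add: Wl_def convergent_LIMSEQ_iff)
  have [measurable]: "Wl k \<in> borel_measurable borel" for k unfolding Wl_def[abs_def] by measurable
  have wconv: "(\<lambda>n. \<integral>x. indicator \<Omega> x * \<bar>w k (r n) x - Wl k x\<bar> \<partial>lborel) \<longlonglongrightarrow> (\<integral>x. 0 \<partial>(lborel :: 'a measure))" for k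
  proof (rule integral_dominated_convergence[where w="\<lambda>x. 2 * D * indicator \<Omega> x"])
    have "\<bar>Wl k x\<bar> \<le> D" for x
      by (rule LIMSEQ_le_const2[OF tendsto_rabs[OF Wl]]) (use w in auto)
    then have "\<bar>w k (r n) x - Wl k x\<bar> \<le> 2 * D" for n x
      using w(1)[of k "r n" x] by (smt (verit))
    then show "AE x in lborel. norm (indicator \<Omega> x * \<bar>w k (r n) x - Wl k x\<bar>) \<le> 2 * D * indicator \<Omega> x" for n
      by (auto simp: indicator_def)
    have "(\<lambda>n. indicator \<Omega> x * \<bar>w k (r n) x - Wl k x\<bar>) \<longlonglongrightarrow> indicator \<Omega> x * \<bar>Wl k x - Wl k x\<bar>" for x
      by (intro tendsto_intros Wl)
    then show "AE x in lborel. (\<lambda>n. indicator \<Omega> x * \<bar>w k (r n) x - Wl k x\<bar>) \<longlonglongrightarrow> 0" by simp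
    show "integrable lborel (\<lambda>x. 2 * D * indicator \<Omega> x)"
      using \<Omega> by (intro integrable_mult_right) (simp add: integrable_indicator_iff)
  qed measurable
  have "\<exists>n0. \<forall>n\<ge>n0. \<forall>m\<ge>n0. (\<integral>\<^sup>+x. ennreal \<bar>u (r n) x - u (r m) x\<bar> \<partial>lborel) \<le> ennreal e" if "0 < e" for e
  proof -
    define \<kappa> where "\<kappa> = (2::real) ^ (DIM('a) + 1)"
    define V where "V = unit_ball_vol (real DIM('a))"
    have \<kappa>: "0 < \<kappa>" "0 < V" by (auto simp: \<kappa>_def V_def)
    \<comment> \<open>The \<delta>-part of the two mollification errors is at most e/3 in total; the
      scale chosen next makes the energy part less than e/3, and the two mollified differences
      contribute e/6 each, all relative to the mass.\<close>
    define \<delta> where "\<delta> = e / (6 * \<kappa> * (measure lborel \<Omega> + 1))"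
    have m0: "0 < measure lborel \<Omega> + 1" by (intro add_nonneg_pos) auto
    have \<delta>: "0 < \<delta>" using \<open>0 < e\<close> \<kappa> m0 by (simp add: \<delta>_def)
    have "(\<lambda>k. inverse (real (Suc k))) \<longlonglongrightarrow> 0" by (rule LIMSEQ_inverse_real_of_nat)
    then have L0: "(\<lambda>k. (1 / real (Suc k)) powr \<sigma>) \<longlonglongrightarrow> 0 powr \<sigma>"
      using \<sigma> by (intro tendsto_powr2 tendsto_const) (auto simp: inverse_eq_divide)
    have "(\<lambda>k. 2 * \<kappa> * (\<delta> powr (1 - p) * E * (1 / real (Suc k)) powr \<sigma> / V)) \<longlonglongrightarrow> 2 * \<kappa> * (\<delta> powr (1 - p) * E * 0 powr \<sigma> / V)"
      using \<kappa> by (intro tendsto_mult tendsto_divide tendsto_const L0) auto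
    then have "\<forall>\<^sub>F k in sequentially. 2 * \<kappa> * (\<delta> powr (1 - p) * E * (1 / real (Suc k)) powr \<sigma> / V) < e / 3"
      using \<open>0 < e\<close> by (intro order_tendstoD) auto
    then obtain k where k: "2 * \<kappa> * (\<delta> powr (1 - p) * E * (1 / real (Suc k)) powr \<sigma> / V) < e / 3"
      by (auto dest!: eventually_happens)
    define K where "K = real (Suc k)"
    have K: "0 < K" by (simp add: K_def)
    define c where "c = mollify_mass K TYPE('a)"
    have c: "0 < c" unfolding c_def by (rule mollify_mass_pos[OF K])
    define M where "M = \<kappa> * (measure lborel \<Omega> * \<delta> + \<delta> powr (1 - p) * E * (1 / K) powr \<sigma> / V)"
    have "0 \<le> M" using \<kappa> \<delta> E by (auto simp: M_def intro!: mult_nonneg_nonneg add_nonneg_nonneg divide_nonneg_nonneg)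
    have M: "2 * M \<le> 2 * e / 3"
    proof -
      have "2 * \<kappa> * (measure lborel \<Omega> * \<delta>) \<le> 2 * \<kappa> * ((measure lborel \<Omega> + 1) * \<delta>)"
        using \<kappa> \<delta> by (intro mult_left_mono mult_right_mono) auto
      also have "\<dots> = e / 3" using \<kappa> m0 by (simp add: \<delta>_def)
      finally show ?thesis using k[folded K_def] by (simp add: M_def distrib_left)
    qed
    have err: "(\<integral>\<^sup>+x. indicator \<Omega> x * mollify_err K (u n) x \<partial>lborel) \<le> ennreal (c * M)" for n
      using mollify_err_integral[OF K u \<Omega>(1) \<Omega>(2) p \<sigma>(1) \<delta> E(1) E(2), of n]
      by (simp add: c_def M_def \<kappa>_def V_def)
    have "\<forall>\<^sub>F n in sequentially. (\<integral>x. indicator \<Omega> x * \<bar>w k (r n) x - Wl k x\<bar> \<partial>lborel) < c * (e / 6)"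
      using wconv[of k] c \<open>0 < e\<close> by (intro order_tendstoD) auto
    then obtain n0 where n0: "\<And>n. n \<ge> n0 \<Longrightarrow> (\<integral>x. indicator \<Omega> x * \<bar>w k (r n) x - Wl k x\<bar> \<partial>lborel) < c * (e / 6)"
      by (auto simp: eventually_sequentially)
    have wi: "integrable lborel (\<lambda>x. indicator \<Omega> x * \<bar>w k n x - Wl k x\<bar>)" for n
    proof (rule Bochner_Integration.integrable_bound)
      show "integrable lborel (\<lambda>x. 2 * D * indicator \<Omega> x)"
        using \<Omega> by (intro integrable_mult_right) (simp add: integrable_indicator_iff)
      have "\<bar>Wl k x\<bar> \<le> D" for x
        by (rule LIMSEQ_le_const2[OF tendsto_rabs[OF Wl]]) (use w in auto)
      then have "\<bar>w k n x - Wl k x\<bar> \<le> 2 * D" for x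
        using w(1)[of k "n" x] by (smt (verit))
      then show "AE x in lborel. norm (indicator \<Omega> x * \<bar>w k n x - Wl k x\<bar>) \<le> norm (2 * D * indicator \<Omega> x)"
        using \<open>0 \<le> D\<close> by (auto simp: indicator_def)
    qed measurable
    have wn: "(\<integral>\<^sup>+x. ennreal (indicator \<Omega> x * \<bar>w k (r n) x - Wl k x\<bar>) \<partial>lborel) \<le> ennreal (c * (e / 6))" if "n \<ge> n0" for n
      using n0[OF that] nn_integral_eq_integral[OF wi[of "r n"]] by (simp add: ennreal_leI less_imp_le)
    have main: "ennreal c * (\<integral>\<^sup>+x. ennreal \<bar>u (r n) x - u (r m) x\<bar> \<partial>lborel) \<le> ennreal (c * e)" if "n \<ge> n0" "m \<ge> n0" for n m
    proof -
      have "ennreal c * (\<integral>\<^sup>+x. ennreal \<bar>u (r n) x - u (r m) x\<bar> \<partial>lborel) = (\<integral>\<^sup>+x. ennreal c * ennreal \<bar>u (r n) x - u (r m) x\<bar> \<partial>lborel)"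
        by (simp add: nn_integral_cmult)
      also have "\<dots> \<le> (\<integral>\<^sup>+x. (ennreal (indicator \<Omega> x * \<bar>w k (r n) x - Wl k x\<bar>) + ennreal (indicator \<Omega> x * \<bar>w k (r m) x - Wl k x\<bar>))
          + (indicator \<Omega> x * mollify_err K (u (r n)) x + indicator \<Omega> x * mollify_err K (u (r m)) x) \<partial>lborel)"
      proof (intro nn_integral_mono)
        fix x
        show "ennreal c * ennreal \<bar>u (r n) x - u (r m) x\<bar> \<le> (ennreal (indicator \<Omega> x * \<bar>w k (r n) x - Wl k x\<bar>) + ennreal (indicator \<Omega> x * \<bar>w k (r m) x - Wl k x\<bar>))
          + (indicator \<Omega> x * mollify_err K (u (r n)) x + indicator \<Omega> x * mollify_err K (u (r m)) x)"
        proof (cases "x \<in> \<Omega>")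
          case True
          have "ennreal c * ennreal \<bar>u (r n) x - u (r m) x\<bar> \<le> ennreal \<bar>w k (r n) x - w k (r m) x\<bar>
            + (mollify_err K (u (r n)) x + mollify_err K (u (r m)) x)"
            unfolding c_def w_def K_def[symmetric] by (rule mollify_compare[OF K ui ui])
          also have "ennreal \<bar>w k (r n) x - w k (r m) x\<bar> \<le> ennreal (\<bar>w k (r n) x - Wl k x\<bar> + \<bar>w k (r m) x - Wl k x\<bar>)"
            by (intro ennreal_leI) linarith
          also have "\<dots> = ennreal \<bar>w k (r n) x - Wl k x\<bar> + ennreal \<bar>w k (r m) x - Wl k x\<bar>" by simp
          finally show ?thesis using True by (simp add: add_right_mono)
        next
          case False
          then show ?thesis using u0 by simp
        qed
      qed
      also have "\<dots> = ((\<integral>\<^sup>+x. ennreal (indicator \<Omega> x * \<bar>w k (r n) x - Wl k x\<bar>) \<partial>lborel) + (\<integral>\<^sup>+x. ennreal (indicator \<Omega> x * \<bar>w k (r m) x - Wl k x\<bar>) \<partial>lborel))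
          + ((\<integral>\<^sup>+x. indicator \<Omega> x * mollify_err K (u (r n)) x \<partial>lborel) + (\<integral>\<^sup>+x. indicator \<Omega> x * mollify_err K (u (r m)) x \<partial>lborel))"
        using mollify_err_measurable[OF K u] by (simp add: nn_integral_add)
      also have "\<dots> \<le> (ennreal (c * (e / 6)) + ennreal (c * (e / 6))) + (ennreal (c * M) + ennreal (c * M))"
        by (intro add_mono wn err that)
      also have "\<dots> = ennreal (c * (e / 6) + c * (e / 6) + (c * M + c * M))"
        using c \<open>0 < e\<close> \<open>0 \<le> M\<close> by (simp flip: ennreal_plus)
      also have "\<dots> \<le> ennreal (c * e)"
      proof (rule ennreal_leI)
        have "c * (e / 6 + e / 6 + 2 * M) \<le> c * e" using c M by (intro mult_left_mono) auto
        then show "c * (e / 6) + c * (e / 6) + (c * M + c * M) \<le> c * e" by (simp add: algebra_simps)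
      qed
      finally show ?thesis .
    qed
    have "(\<integral>\<^sup>+x. ennreal \<bar>u (r n) x - u (r m) x\<bar> \<partial>lborel) \<le> ennreal e" if "n \<ge> n0" "m \<ge> n0" for n m
    proof -
      have "ennreal (1 / c) * (ennreal c * (\<integral>\<^sup>+x. ennreal \<bar>u (r n) x - u (r m) x\<bar> \<partial>lborel)) \<le> ennreal (1 / c) * ennreal (c * e)"
        by (intro mult_left_mono main that) simp
      moreover have "ennreal (1 / c) * ennreal c = 1" "ennreal (1 / c) * ennreal (c * e) = ennreal e"
        using c by (simp_all flip: ennreal_mult')
      ultimately show ?thesis by (simp flip: mult.assoc)
    qed
    then show ?thesis by blast
  qed
  from L1_Cauchy_AE_convergent_subseq[of "\<lambda>n. u (r n)" lborel, OF _ this]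
  obtain h where h: "strict_mono h" "AE x in lborel. convergent (\<lambda>i. u (r (h i)) x)" by auto
  \<comment> \<open>Where the sequence diverges \<open>lim\<close> is an unspecified value, but only
    on a null set. Outside the domain the sequence is constantly 0, so \<open>g\<close> vanishes
    there everywhere.\<close>
  define g where "g x = lim (\<lambda>i. u (r (h i)) x)" for x
  have "g \<in> borel_measurable borel" unfolding g_def[abs_def] by measurable
  moreover have "\<forall>x. x \<notin> \<Omega> \<longrightarrow> g x = 0" using u0 by (simp add: g_def)
  moreover have "AE x in lborel. (\<lambda>n. u ((r \<circ> h) n) x) \<longlonglongrightarrow> g x"
    using h(2) by eventually_elim (simp add: g_def convergent_LIMSEQ_iff)
  moreover have "strict_mono (r \<circ> h)" using r h by (simp add: strict_mono_o)
  ultimately show ?thesis by blast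
qed

section \<open>Convergence of weighted power integrals\<close>

lemma integrable_lower_power:
  fixes f :: "'b \<Rightarrow> real"
  assumes fin: "emeasure M (space M) < top" and f [measurable]: "f \<in> borel_measurable M"
    and r: "0 < r" "r \<le> q" and C: "(\<integral>\<^sup>+x. ennreal (\<bar>f x\<bar> powr q) \<partial>M) < top"
    and w [measurable]: "w \<in> borel_measurable M" and wc: "AE x in M. \<bar>w x\<bar> \<le> c"
  shows "f \<in> weighted_Lp M w r"
proof -
  have i: "integrable M (\<lambda>x. \<bar>f x\<bar> powr q)"
    using C by (intro integrableI_nonneg) auto
  have "integrable M (\<lambda>x. 1 :: real)" using fin by (simp add: integrable_iff_bounded)
  with i have "integrable M (\<lambda>x. c * (1 + \<bar>f x\<bar> powr q))"
    by (intro integrable_mult_right Bochner_Integration.integrable_add)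
  then have "integrable M (\<lambda>x. w x * \<bar>f x\<bar> powr r)"
  proof (rule Bochner_Integration.integrable_bound)
    show "AE x in M. norm (w x * \<bar>f x\<bar> powr r) \<le> norm (c * (1 + \<bar>f x\<bar> powr q))"
      using wc
    proof eventually_elim
      case (elim x)
      have "\<bar>f x\<bar> powr r \<le> 1 + \<bar>f x\<bar> powr q"
      proof (cases "\<bar>f x\<bar> \<le> 1")
        case True
        then have "\<bar>f x\<bar> powr r \<le> 1 powr r" using r by (intro powr_mono2) auto
        then show ?thesis by (simp add: add_increasing2)
      next
        case False
        then have "\<bar>f x\<bar> powr r \<le> \<bar>f x\<bar> powr q" using r by (intro powr_mono) auto
        then show ?thesis by simp
      qed
      then have "norm (w x * \<bar>f x\<bar> powr r) \<le> c * (1 + \<bar>f x\<bar> powr q)"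
        unfolding norm_mult using elim by (intro mult_mono) auto
      also have "\<dots> \<le> norm (c * (1 + \<bar>f x\<bar> powr q))" unfolding real_norm_def by (rule abs_ge_self)
      finally show ?case .
    qed
  qed measurable
  then show ?thesis by (simp add: weighted_Lp_def)
qed

text \<open>A Vitali argument. Cutting the functions at height L costs at most c L^(r-q) C uniformly
  in n, which tends to 0 because r < q; the cut functions converge by dominated convergence on the
  finite measure space.\<close>

lemma weighted_power_integral_tendsto:
  fixes f :: "nat \<Rightarrow> 'b \<Rightarrow> real"
  assumes fin: "emeasure M (space M) < top" and f [measurable]: "\<And>n. f n \<in> borel_measurable M"
    and g [measurable]: "g \<in> borel_measurable M" and lim: "AE x in M. (\<lambda>n. f n x) \<longlonglongrightarrow> g x"
    and r: "0 < r" "r < q" and C: "\<And>n. (\<integral>\<^sup>+x. ennreal (\<bar>f n x\<bar> powr q) \<partial>M) \<le> ennreal C" "0 \<le> C"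
    and w [measurable]: "w \<in> borel_measurable M" and wc: "AE x in M. \<bar>w x\<bar> \<le> c" "0 \<le> c"
  shows "(\<lambda>n. \<integral>x. w x * \<bar>f n x\<bar> powr r \<partial>M) \<longlonglongrightarrow> (\<integral>x. w x * \<bar>g x\<bar> powr r \<partial>M)"
proof -
  have gC: "(\<integral>\<^sup>+x. ennreal (\<bar>g x\<bar> powr q) \<partial>M) \<le> ennreal C"
  proof (rule nn_integral_fatou_tendsto[where f="\<lambda>n x. ennreal (\<bar>f n x\<bar> powr q)", OF _ _ C(1) tendsto_const])
    show "AE x in M. (\<lambda>n. ennreal (\<bar>f n x\<bar> powr q)) \<longlonglongrightarrow> ennreal (\<bar>g x\<bar> powr q)"
      using lim
    proof eventually_elim
      case (elim x)
      then show ?case using r by (intro tendsto_ennrealI tendsto_powr2 tendsto_rabs tendsto_const) auto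
    qed
  qed measurable
  define T where "T L t = min \<bar>t\<bar> L powr r" for L t :: real
  have tail: "\<bar>(\<integral>x. w x * \<bar>h x\<bar> powr r \<partial>M) - (\<integral>x. w x * T L (h x) \<partial>M)\<bar> \<le> c * (L powr (r - q) * C)"
    if h [measurable]: "h \<in> borel_measurable M" and hC: "(\<integral>\<^sup>+x. ennreal (\<bar>h x\<bar> powr q) \<partial>M) \<le> ennreal C" and L: "0 < L" for h L
  proof -
    have hq: "integrable M (\<lambda>x. \<bar>h x\<bar> powr q)"
      using hC by (intro integrableI_nonneg) (auto simp: order_le_less_trans)
    have hqC: "(\<integral>x. \<bar>h x\<bar> powr q \<partial>M) \<le> C"
      using hC nn_integral_eq_integral[OF hq] C(2) by simp
    have 1: "integrable M (\<lambda>x. w x * \<bar>h x\<bar> powr r)"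
      using integrable_lower_power[OF fin h _ _ _ w wc(1), of r q] r hC
      by (auto simp: weighted_Lp_def order_le_less_trans)
    have 2: "integrable M (\<lambda>x. w x * T L (h x))"
    proof (rule Bochner_Integration.integrable_bound[OF 1])
      have "min \<bar>h x\<bar> L powr r \<le> \<bar>h x\<bar> powr r" for x using L r by (intro powr_mono2) auto
      then show "AE x in M. norm (w x * T L (h x)) \<le> norm (w x * \<bar>h x\<bar> powr r)"
        by (intro AE_I2) (simp add: abs_mult T_def mult_left_mono)
      show "(\<lambda>x. w x * T L (h x)) \<in> borel_measurable M" unfolding T_def by measurable
    qed
    have "\<bar>(\<integral>x. w x * \<bar>h x\<bar> powr r \<partial>M) - (\<integral>x. w x * T L (h x) \<partial>M)\<bar> = \<bar>\<integral>x. w x * \<bar>h x\<bar> powr r - w x * T L (h x) \<partial>M\<bar>"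
      by (subst Bochner_Integration.integral_diff) (use 1 2 in auto)
    also have "\<dots> \<le> (\<integral>x. \<bar>w x * \<bar>h x\<bar> powr r - w x * T L (h x)\<bar> \<partial>M)" by (rule integral_abs_bound)
    also have "\<dots> \<le> (\<integral>x. c * (L powr (r - q) * \<bar>h x\<bar> powr q) \<partial>M)"
    proof (rule integral_mono_AE)
      show "AE x in M. \<bar>w x * \<bar>h x\<bar> powr r - w x * T L (h x)\<bar> \<le> c * (L powr (r - q) * \<bar>h x\<bar> powr q)"
        using wc(1)
      proof eventually_elim
        case (elim x)
        have "\<bar>\<bar>h x\<bar> powr r - T L (h x)\<bar> \<le> L powr (r - q) * \<bar>h x\<bar> powr q"
        proof (cases "\<bar>h x\<bar> \<le> L")
          case True
          then show ?thesis by (simp add: T_def min_def)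
        next
          case False
          have "L powr r \<le> \<bar>h x\<bar> powr r" using False L r by (intro powr_mono2) auto
          then have "\<bar>\<bar>h x\<bar> powr r - T L (h x)\<bar> \<le> \<bar>h x\<bar> powr r"
            using False by (simp add: T_def min_def)
          also have "\<dots> = \<bar>h x\<bar> powr (r - q) * \<bar>h x\<bar> powr q" using False L by (simp flip: powr_add)
          also have "\<dots> \<le> L powr (r - q) * \<bar>h x\<bar> powr q"
            using False L r by (intro mult_right_mono powr_mono2') auto
          finally show ?thesis .
        qed
        then have "\<bar>w x\<bar> * \<bar>\<bar>h x\<bar> powr r - T L (h x)\<bar> \<le> c * (L powr (r - q) * \<bar>h x\<bar> powr q)"
          using elim wc(2) by (intro mult_mono) auto
        then show ?case by (simp flip: abs_mult right_diff_distrib)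
      qed
    qed (use 1 2 hq in auto)
    also have "\<dots> = c * (L powr (r - q) * (\<integral>x. \<bar>h x\<bar> powr q \<partial>M))" by simp
    also have "\<dots> \<le> c * (L powr (r - q) * C)" using wc hqC by (intro mult_left_mono) auto
    finally show ?thesis .
  qed
  have trunc: "(\<lambda>n. \<integral>x. w x * T L (f n x) \<partial>M) \<longlonglongrightarrow> (\<integral>x. w x * T L (g x) \<partial>M)" if L: "0 < L" for L
  proof (rule integral_dominated_convergence[where w="\<lambda>x. c * L powr r"])
    show "integrable M (\<lambda>x. c * L powr r)" using fin by (simp add: integrable_iff_bounded ennreal_mult_less_top)
    show "AE x in M. (\<lambda>n. w x * T L (f n x)) \<longlonglongrightarrow> w x * T L (g x)"
      using lim
    proof eventually_elim
      case (elim x)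
      then show ?case unfolding T_def using r L by (intro tendsto_intros tendsto_powr2) auto
    qed
    show "AE x in M. norm (w x * T L (f n x)) \<le> c * L powr r" for n
      using wc(1)
    proof eventually_elim
      case (elim x)
      have "T L (f n x) \<le> L powr r" unfolding T_def using L r by (intro powr_mono2) auto
      then have "\<bar>w x\<bar> * T L (f n x) \<le> c * L powr r" using elim wc by (intro mult_mono) (auto simp: T_def)
      then show ?case by (simp add: abs_mult T_def)
    qed
    show "(\<lambda>x. w x * T L (g x)) \<in> borel_measurable M" unfolding T_def by measurable
    show "(\<lambda>x. w x * T L (f n x)) \<in> borel_measurable M" for n unfolding T_def by measurable
  qed
  show ?thesis
  proof (rule LIMSEQ_I)
    fix e :: real assume e: "0 < e"
    have "((\<lambda>L. c * (L powr (r - q) * C)) \<longlongrightarrow> c * (0 * C)) at_top"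
      using r by (intro tendsto_mult tendsto_const tendsto_neg_powr filterlim_ident) auto
    then have "\<forall>\<^sub>F L in at_top. c * (L powr (r - q) * C) < e / 3" using e by (intro order_tendstoD) auto
    then have "\<forall>\<^sub>F L in at_top. c * (L powr (r - q) * C) < e / 3 \<and> 0 < L"
      using eventually_gt_at_top[of "0::real"] by eventually_elim auto
    then obtain L :: real where L: "c * (L powr (r - q) * C) < e / 3" "0 < L"
      by (auto dest!: eventually_happens)
    obtain n0 where n0: "\<And>n. n \<ge> n0 \<Longrightarrow> norm ((\<integral>x. w x * T L (f n x) \<partial>M) - (\<integral>x. w x * T L (g x) \<partial>M)) < e / 3"
      using LIMSEQ_D[OF trunc[OF L(2)], of "e / 3"] e by auto
    show "\<exists>n0. \<forall>n\<ge>n0. norm ((\<integral>x. w x * \<bar>f n x\<bar> powr r \<partial>M) - (\<integral>x. w x * \<bar>g x\<bar> powr r \<partial>M)) < e"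
    proof (intro exI allI impI)
      fix n assume "n0 \<le> n"
      then show "norm ((\<integral>x. w x * \<bar>f n x\<bar> powr r \<partial>M) - (\<integral>x. w x * \<bar>g x\<bar> powr r \<partial>M)) < e"
        using n0[of n] tail[OF f C(1) L(2), of n] tail[OF g gC L(2)] L(1) unfolding real_norm_def by linarith
    qed
  qed
qed

section \<open>Lebesgue measure on the product space\<close>

text \<open>The Lebesgue measure on the product is the completion of the product of the Borel
  measures. The exceptional set is therefore first enlarged to a Borel null set, whose cylinders are
  null since 0 times infinity is 0.\<close>

lemma AE_lebesgue_fst_snd:
  fixes P :: "'a::euclidean_space \<Rightarrow> bool"
  assumes "AE x in lebesgue. P x"
  shows "AE z in (lebesgue :: ('a \<times> 'a) measure). P (fst z)"
    and "AE z in (lebesgue :: ('a \<times> 'a) measure). P (snd z)"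
proof -
  have "AE x in lborel. P x" using assms by (simp add: AE_completion_iff)
  then obtain N where N: "{x \<in> space lborel. \<not> P x} \<subseteq> N" "emeasure lborel N = 0" "N \<in> sets (lborel :: 'a measure)"
    by (rule AE_E)
  have "N \<times> UNIV \<in> null_sets (lborel \<Otimes>\<^sub>M (lborel :: 'a measure))"
    "UNIV \<times> N \<in> null_sets ((lborel :: 'a measure) \<Otimes>\<^sub>M lborel)"
    using N lborel.emeasure_pair_measure_Times[of N lborel UNIV] lborel.emeasure_pair_measure_Times[of UNIV "lborel :: 'a measure" N]
    by (auto simp: null_sets_def)
  then have n: "N \<times> UNIV \<in> null_sets (lborel :: ('a \<times> 'a) measure)" "UNIV \<times> N \<in> null_sets (lborel :: ('a \<times> 'a) measure)"
    by (simp_all add: lborel_prod)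
  have "AE z in (lborel :: ('a \<times> 'a) measure). P (fst z)"
    by (rule AE_I'[OF n(1)]) (use N in auto)
  then show "AE z in (lebesgue :: ('a \<times> 'a) measure). P (fst z)" by (simp add: AE_completion_iff)
  have "AE z in (lborel :: ('a \<times> 'a) measure). P (snd z)"
    by (rule AE_I'[OF n(2)]) (use N in auto)
  then show "AE z in (lebesgue :: ('a \<times> 'a) measure). P (snd z)" by (simp add: AE_completion_iff)
qed

definition increment :: "('a \<Rightarrow> real) \<Rightarrow> 'a \<times> 'a \<Rightarrow> real" where
  "increment u z = u (fst z) - u (snd z)"

lemma AE_increment_cong:
  fixes u v :: "'a::euclidean_space \<Rightarrow> real"
  assumes "AE x in lebesgue. u x = v x"
  shows "AE z in lebesgue. increment u z = increment v z"
  using AE_lebesgue_fst_snd[OF assms] by eventually_elim (simp add: increment_def)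

text \<open>Lets Tonelli arguments run on \<open>lborel\<close> although elements of the Sobolev
  space are only Lebesgue measurable. Multiplying by the indicator makes the representative vanish
  everywhere outside the set.\<close>

lemma borel_representative:
  fixes u :: "'a::euclidean_space \<Rightarrow> real"
  assumes "u \<in> borel_measurable lebesgue" and "AE x in lebesgue. x \<notin> \<Omega> \<longrightarrow> u x = 0" and [measurable]: "\<Omega> \<in> sets borel"
  shows "\<exists>g. g \<in> borel_measurable borel \<and> (\<forall>x. x \<notin> \<Omega> \<longrightarrow> g x = 0) \<and> (AE x in lebesgue. u x = g x)"
proof -
  obtain g where [measurable]: "g \<in> borel_measurable lborel" and g: "AE x in lborel. u x = g x"
    using completion_ex_borel_measurable_real[OF assms(1)] by auto
  have "AE x in lebesgue. u x = indicator \<Omega> x * g x"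
    using assms(2) AE_completion[OF g] by eventually_elim (auto simp: indicator_def)
  then show ?thesis by (intro exI[of _ "\<lambda>x. indicator \<Omega> x * g x"]) auto
qed

lemma increment_measurable_borel [measurable]:
  "g \<in> borel_measurable borel \<Longrightarrow> increment (g :: 'a::euclidean_space \<Rightarrow> real) \<in> borel_measurable borel"
proof -
  assume [measurable]: "g \<in> borel_measurable borel"
  have "increment g \<in> borel_measurable (borel \<Otimes>\<^sub>M borel)" unfolding increment_def[abs_def] by measurable
  then show ?thesis by (simp add: borel_prod)
qed

lemma increment_measurable [measurable]:
  fixes u :: "'a::euclidean_space \<Rightarrow> real"
  assumes "u \<in> borel_measurable lebesgue"
  shows "increment u \<in> borel_measurable lebesgue"
proof -
  obtain g where g: "g \<in> borel_measurable borel" "AE x in lebesgue. u x = g x"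
    using borel_representative[OF assms, of UNIV] by auto
  have "increment g \<in> borel_measurable lebesgue"
    using g(1) by (intro measurable_completion) simp
  moreover have "AE z in lebesgue. increment g z = increment u z"
    using AE_increment_cong[OF g(2)] by eventually_elim simp
  ultimately show ?thesis by (rule borel_measurable_AE)
qed

definition gagliardo_quotient :: "real \<Rightarrow> real \<Rightarrow> ('a::euclidean_space \<Rightarrow> real) \<Rightarrow> 'a \<times> 'a \<Rightarrow> real" where
  "gagliardo_quotient p \<sigma> u z = \<bar>increment u z\<bar> powr p / norm (fst z - snd z) powr (real DIM('a) + \<sigma>)"

lemma gagliardo_quotient_nonneg [simp]: "0 \<le> gagliardo_quotient p \<sigma> u z"
  by (simp add: gagliardo_quotient_def)

lemma norm_diff_measurable [measurable]:
  "(\<lambda>z :: 'a::euclidean_space \<times> 'a. norm (fst z - snd z)) \<in> borel_measurable borel"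
proof -
  have "(\<lambda>z :: 'a \<times> 'a. norm (fst z - snd z)) \<in> borel_measurable (borel \<Otimes>\<^sub>M borel)" by measurable
  then show ?thesis by (simp add: borel_prod)
qed

lemma gagliardo_quotient_measurable [measurable]:
  fixes u :: "'a::euclidean_space \<Rightarrow> real"
  assumes [measurable]: "u \<in> borel_measurable lebesgue"
  shows "gagliardo_quotient p \<sigma> u \<in> borel_measurable lebesgue"
proof -
  have [measurable]: "(\<lambda>z :: 'a \<times> 'a. norm (fst z - snd z)) \<in> borel_measurable lebesgue"
    by (intro measurable_completion) simp
  show ?thesis unfolding gagliardo_quotient_def[abs_def] by measurable
qed

lemma nn_integral_gagliardo_quotient:
  fixes g :: "'a::euclidean_space \<Rightarrow> real"
  assumes [measurable]: "g \<in> borel_measurable borel"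
  shows "(\<integral>\<^sup>+z. ennreal (gagliardo_quotient p \<sigma> g z) \<partial>lebesgue) = gagliardo p \<sigma> g"
proof -
  have [measurable]: "gagliardo_quotient p \<sigma> g \<in> borel_measurable borel"
    unfolding gagliardo_quotient_def[abs_def] by measurable
  have "(\<integral>\<^sup>+z. ennreal (gagliardo_quotient p \<sigma> g z) \<partial>lebesgue) = (\<integral>\<^sup>+z. ennreal (gagliardo_quotient p \<sigma> g z) \<partial>(lborel \<Otimes>\<^sub>M lborel))"
    by (simp add: nn_integral_completion lborel_prod)
  also have "\<dots> = (\<integral>\<^sup>+x. \<integral>\<^sup>+y. ennreal (gagliardo_quotient p \<sigma> g (x, y)) \<partial>lborel \<partial>lborel)"
  proof (rule lborel.nn_integral_fst[symmetric])
    have "gagliardo_quotient p \<sigma> g \<in> borel_measurable (borel \<Otimes>\<^sub>M borel)" by (simp add: borel_prod)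
    then show "(\<lambda>z. ennreal (gagliardo_quotient p \<sigma> g z)) \<in> borel_measurable (lborel \<Otimes>\<^sub>M lborel)"
      by (simp add: lborel_prod)
  qed
  finally show ?thesis by (simp add: gagliardo_def gagliardo_quotient_def increment_def)
qed

section \<open>Elements of the fractional Sobolev space\<close>

lemma dyadic_shell:
  fixes t :: real
  assumes "1 \<le> t"
  shows "\<exists>j::nat. 2 powr real j \<le> t \<and> t < 2 powr real (Suc j)"
proof -
  define j where "j = nat \<lfloor>log 2 t\<rfloor>"
  have "0 \<le> log 2 t" using assms by simp
  then have "real j \<le> log 2 t" "log 2 t < real (Suc j)" unfolding j_def by linarith+
  then have "2 powr real j \<le> t" "t < 2 powr real (Suc j)"
    using assms by (simp_all add: le_log_iff log_less_iff)
  then show ?thesis by blast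
qed

text \<open>The kernel is split into dyadic shells: \<sigma> > 0 gives a geometric series at
  infinity, \<sigma> < p gives one at the origin.\<close>

lemma truncated_kernel_bound:
  assumes \<sigma>: "0 < \<sigma>" "\<sigma> < p"
  shows "\<exists>C\<ge>0. \<forall>x :: 'a::euclidean_space.
    (\<integral>\<^sup>+y. ennreal (min 1 (norm (x - y)) powr p / norm (x - y) powr (real DIM('a) + \<sigma>)) \<partial>lborel) \<le> ennreal C"
proof -
  define n where "n = real DIM('a)"
  define \<alpha> where "\<alpha> = n + \<sigma>"
  define V where "V = unit_ball_vol n"
  have V: "0 < V" and n: "0 < n" by (auto simp: V_def n_def)
  have \<alpha>: "0 < \<alpha>" using n \<sigma> by (simp add: \<alpha>_def)
  \<comment> \<open>A bound of the kernel on a shell times the volume of a ball containing it;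
    \<open>a\<close> belongs to the shells outside the unit ball, \<open>b\<close> to those
    inside.\<close>
  define a where "a j = 2 powr (- (real j * \<alpha>)) * (V * 2 powr (real (Suc j) * n))" for j :: nat
  define b where "b j = 2 powr (- (real j * p) + real (Suc j) * \<alpha>) * (V * 2 powr ((1 - real j) * n))" for j :: nat
  have a: "a j = V * 2 powr n * (2 powr (- \<sigma>)) ^ j" for j
    by (simp add: a_def \<alpha>_def powr_realpow[symmetric] powr_powr algebra_simps flip: powr_add)
  have b: "b j = V * 2 powr (2 * n + \<sigma>) * (2 powr (\<sigma> - p)) ^ j" for j
    by (simp add: b_def \<alpha>_def powr_realpow[symmetric] powr_powr algebra_simps flip: powr_add)
  have g: "2 powr (- \<sigma>) < (1 :: real)" "2 powr (\<sigma> - p) < (1 :: real)"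
    using \<sigma> powr_less_mono[of "- \<sigma>" 0 2] powr_less_mono[of "\<sigma> - p" 0 2] by auto
  have sa: "summable a" unfolding a using g by (intro summable_mult summable_geometric) auto
  have sb: "summable b" unfolding b using g by (intro summable_mult summable_geometric) auto
  have nonneg: "0 \<le> a j" "0 \<le> b j" for j using V by (auto simp: a_def b_def)
  define C where "C = suminf a + suminf b"
  have "0 \<le> C" unfolding C_def using sa sb nonneg by (intro add_nonneg_nonneg suminf_nonneg) auto
  moreover have "(\<integral>\<^sup>+y. ennreal (min 1 (norm (x - y)) powr p / norm (x - y) powr \<alpha>) \<partial>lborel) \<le> ennreal C" for x :: 'a
  proof -
    define F where "F j y = ennreal (2 powr (- (real j * \<alpha>))) * indicator (ball x (2 powr real (Suc j))) y" for j :: nat and y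
    define G where "G j y = ennreal (2 powr (- (real j * p) + real (Suc j) * \<alpha>)) * indicator (ball x (2 powr (1 - real j))) y" for j :: nat and y
    have [measurable]: "ball x r \<in> sets borel" for r by simp
    have [measurable]: "F j \<in> borel_measurable borel" "G j \<in> borel_measurable borel" for j
      unfolding F_def[abs_def] G_def[abs_def] by measurable
    have ball: "emeasure lborel (ball x (2 powr e)) = ennreal (V * 2 powr (e * n))" for e
      by (simp add: emeasure_ball V_def n_def powr_powr flip: powr_realpow)
    have Fi: "(\<integral>\<^sup>+y. F j y \<partial>lborel) = ennreal (a j)" for j
      unfolding F_def a_def
      by (subst nn_integral_cmult_indicator, simp, subst ball, rule ennreal_mult'[symmetric]) simp
    have Gi: "(\<integral>\<^sup>+y. G j y \<partial>lborel) = ennreal (b j)" for j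
      unfolding G_def b_def
      by (subst nn_integral_cmult_indicator, simp, subst ball, rule ennreal_mult'[symmetric]) simp
    have "ennreal (min 1 (norm (x - y)) powr p / norm (x - y) powr \<alpha>) \<le> (\<Sum>j. F j y) + (\<Sum>j. G j y)" for y
    proof -
      define t where "t = norm (x - y)"
      consider "t = 0" | "1 \<le> t" | "0 < t" "t < 1" unfolding t_def by force
      then have "ennreal (min 1 t powr p / t powr \<alpha>) \<le> (\<Sum>j. F j y) + (\<Sum>j. G j y)"
      proof cases
        case 1
        then show ?thesis by simp
      next
        case 2
        obtain j where j: "2 powr real j \<le> t" "t < 2 powr real (Suc j)" using dyadic_shell[OF 2] by auto
        have "min 1 t powr p / t powr \<alpha> = 1 / t powr \<alpha>" using 2 by simp
        also have "\<dots> \<le> 1 / (2 powr real j) powr \<alpha>"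
          using j 2 \<alpha> by (intro divide_left_mono powr_mono2 mult_pos_pos) auto
        also have "\<dots> = 2 powr (- (real j * \<alpha>))" by (simp add: powr_powr powr_minus field_simps)
        finally have "ennreal (min 1 t powr p / t powr \<alpha>) \<le> F j y"
          using j(2) by (simp add: F_def t_def dist_norm ennreal_leI)
        also have "\<dots> \<le> (\<Sum>j. F j y)" using sum_le_suminf[OF summableI, of "{j}" "\<lambda>j. F j y"] by simp
        finally show ?thesis by (simp add: add_increasing2)
      next
        case 3
        obtain j where j: "2 powr real j \<le> 1 / t" "1 / t < 2 powr real (Suc j)" using dyadic_shell[of "1 / t"] 3 by auto
        have t1: "t \<le> 2 powr (- real j)"
          using j 3 by (simp add: powr_minus field_simps)
        have "1 < t * 2 powr real (Suc j)"
          using j(2) 3 by (simp add: pos_divide_less_eq mult.commute del: of_nat_Suc)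
        then have t2: "2 powr (- real (Suc j)) < t"
          unfolding powr_minus_divide by (simp add: pos_divide_less_eq del: of_nat_Suc)
        have "min 1 t powr p / t powr \<alpha> = t powr p / t powr \<alpha>" using 3 by simp
        also have "\<dots> \<le> (2 powr (- real j)) powr p / (2 powr (- real (Suc j))) powr \<alpha>"
          using t1 t2 3 \<alpha> \<sigma> by (intro frac_le powr_mono2) auto
        also have "\<dots> = 2 powr (- (real j * p)) / 2 powr (- (real (Suc j) * \<alpha>))"
          unfolding powr_powr by (simp only: mult_minus_left)
        also have "\<dots> = 2 powr (- (real j * p) + real (Suc j) * \<alpha>)"
          unfolding powr_diff[symmetric] by simp
        finally have *: "min 1 t powr p / t powr \<alpha> \<le> 2 powr (- (real j * p) + real (Suc j) * \<alpha>)" .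
        \<comment> \<open>On this shell t may equal 2^(-j) while balls are open, hence the doubled
          radius.\<close>
        have "t < 2 powr (1 - real j)"
        proof -
          have "2 powr (- real j) < 2 powr (1 - real j)" by simp
          with t1 show ?thesis by (rule order_le_less_trans)
        qed
        then have "ennreal (min 1 t powr p / t powr \<alpha>) \<le> G j y"
          using ennreal_leI[OF *] by (simp add: G_def t_def dist_norm)
        also have "\<dots> \<le> (\<Sum>j. G j y)" using sum_le_suminf[OF summableI, of "{j}" "\<lambda>j. G j y"] by simp
        finally show ?thesis by (simp add: add_increasing)
      qed
      then show ?thesis unfolding t_def .
    qed
    then have "(\<integral>\<^sup>+y. ennreal (min 1 (norm (x - y)) powr p / norm (x - y) powr \<alpha>) \<partial>lborel)
       \<le> (\<integral>\<^sup>+y. (\<Sum>j. F j y) + (\<Sum>j. G j y) \<partial>lborel)" by (rule nn_integral_mono)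
    also have "\<dots> = (\<Sum>j. ennreal (a j)) + (\<Sum>j. ennreal (b j))"
      by (simp add: nn_integral_add nn_integral_suminf Fi Gi)
    also have "\<dots> = ennreal C"
      unfolding C_def using sa sb nonneg
      by (simp add: suminf_ennreal2 suminf_nonneg flip: ennreal_plus)
    finally show ?thesis .
  qed
  ultimately show ?thesis unfolding \<alpha>_def n_def by blast
qed

text \<open>A pair contributes only if one of its points lies in the set. By symmetry of the kernel
  the energy is at most twice an integral over points of a set of finite measure, where the inner
  integral is uniformly bounded.\<close>

lemma gagliardo_finite:
  fixes u :: "'a::euclidean_space \<Rightarrow> real"
  assumes \<sigma>: "0 < \<sigma>" "\<sigma> < p" and \<Omega> [measurable]: "\<Omega> \<in> sets borel" and fin: "emeasure lborel \<Omega> < top"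
    and u0: "\<And>x. x \<notin> \<Omega> \<Longrightarrow> u x = 0" and "0 \<le> L"
    and lip: "\<And>x y. \<bar>u x - u y\<bar> \<le> L * min 1 (norm (x - y))"
  shows "gagliardo p \<sigma> u < top"
proof -
  define k where "k z = min 1 (norm z) powr p / norm z powr (real DIM('a) + \<sigma>)" for z :: 'a
  obtain C where C: "\<And>x. (\<integral>\<^sup>+y. ennreal (k (x - y)) \<partial>lborel) \<le> ennreal C"
    using truncated_kernel_bound[OF \<sigma>] unfolding k_def by blast
  have [measurable]: "k \<in> borel_measurable borel" unfolding k_def[abs_def] by measurable
  have sym: "k (x - y) = k (y - x)" for x y by (simp add: k_def norm_minus_commute)
  have k0: "0 \<le> k z" for z by (simp add: k_def)
  have I: "(\<integral>\<^sup>+x. \<integral>\<^sup>+y. indicator \<Omega> x * ennreal (k (x - y)) \<partial>lborel \<partial>lborel) < top"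
  proof -
    have "(\<integral>\<^sup>+x. \<integral>\<^sup>+y. indicator \<Omega> x * ennreal (k (x - y)) \<partial>lborel \<partial>lborel) = (\<integral>\<^sup>+x. indicator \<Omega> x * (\<integral>\<^sup>+y. ennreal (k (x - y)) \<partial>lborel) \<partial>lborel)"
      by (simp add: nn_integral_cmult)
    also have "\<dots> \<le> (\<integral>\<^sup>+x. ennreal C * indicator \<Omega> x \<partial>lborel)"
      using C by (intro nn_integral_mono) (auto simp: indicator_def)
    also have "\<dots> < top" using fin by (simp add: nn_integral_cmult_indicator ennreal_mult_less_top)
    finally show ?thesis .
  qed
  have "gagliardo p \<sigma> u \<le> (\<integral>\<^sup>+x. \<integral>\<^sup>+y. ennreal (L powr p) * (indicator \<Omega> x * ennreal (k (x - y)) + indicator \<Omega> y * ennreal (k (y - x))) \<partial>lborel \<partial>lborel)"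
    unfolding gagliardo_def
  proof (intro nn_integral_mono)
    fix x y
    show "ennreal (\<bar>u x - u y\<bar> powr p / norm (x - y) powr (real DIM('a) + \<sigma>)) \<le>
      ennreal (L powr p) * (indicator \<Omega> x * ennreal (k (x - y)) + indicator \<Omega> y * ennreal (k (y - x)))"
    proof (cases "x \<in> \<Omega> \<or> y \<in> \<Omega>")
      case True
      have "\<bar>u x - u y\<bar> powr p \<le> (L * min 1 (norm (x - y))) powr p"
        using lip[of x y] \<sigma> by (intro powr_mono2) auto
      also have "\<dots> = L powr p * min 1 (norm (x - y)) powr p" by (rule powr_mult)
      finally have "\<bar>u x - u y\<bar> powr p / norm (x - y) powr (real DIM('a) + \<sigma>) \<le> L powr p * k (x - y)"
        by (simp add: k_def divide_right_mono)
      then have "ennreal (\<bar>u x - u y\<bar> powr p / norm (x - y) powr (real DIM('a) + \<sigma>)) \<le> ennreal (L powr p) * ennreal (k (x - y))"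
        by (simp add: ennreal_leI flip: ennreal_mult')
      also have "\<dots> \<le> ennreal (L powr p) * (indicator \<Omega> x * ennreal (k (x - y)) + indicator \<Omega> y * ennreal (k (y - x)))"
        using True by (intro mult_left_mono) (auto simp: sym[of y x] indicator_def)
      finally show ?thesis .
    qed (use u0 in simp)
  qed
  also have "\<dots> = ennreal (L powr p) * ((\<integral>\<^sup>+x. \<integral>\<^sup>+y. indicator \<Omega> x * ennreal (k (x - y)) \<partial>lborel \<partial>lborel)
      + (\<integral>\<^sup>+x. \<integral>\<^sup>+y. indicator \<Omega> y * ennreal (k (y - x)) \<partial>lborel \<partial>lborel))"
    by (simp add: nn_integral_cmult nn_integral_add)
  also have "(\<integral>\<^sup>+x. \<integral>\<^sup>+y. indicator \<Omega> y * ennreal (k (y - x)) \<partial>lborel \<partial>lborel) = (\<integral>\<^sup>+y. \<integral>\<^sup>+x. indicator \<Omega> y * ennreal (k (y - x)) \<partial>lborel \<partial>lborel)"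
    by (rule lborel_pair.Fubini') measurable
  also have "ennreal (L powr p) * ((\<integral>\<^sup>+x. \<integral>\<^sup>+y. indicator \<Omega> x * ennreal (k (x - y)) \<partial>lborel \<partial>lborel)
      + (\<integral>\<^sup>+x. \<integral>\<^sup>+y. indicator \<Omega> x * ennreal (k (x - y)) \<partial>lborel \<partial>lborel)) < top"
    using I by (simp add: ennreal_mult_less_top)
  finally show ?thesis .
qed

lemma Wsp0_iff:
  fixes u :: "'a::euclidean_space \<Rightarrow> real"
  shows "u \<in> Wsp0 s p \<Omega> \<longleftrightarrow> u \<in> borel_measurable lebesgue \<and> (AE x in lebesgue. x \<notin> \<Omega> \<longrightarrow> u x = 0) \<and>
     (\<integral>\<^sup>+x. ennreal (\<bar>u x\<bar> powr p) \<partial>lebesgue) < top \<and>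
     (\<integral>\<^sup>+z. ennreal (gagliardo_quotient p (s * p) u z) \<partial>lebesgue) < top"
proof -
  have eq: "(\<lambda>(x, y). \<bar>u x - u y\<bar> powr p / norm (x - y) powr (real DIM('a) + s * p)) = gagliardo_quotient p (s * p) u"
    by (auto simp: gagliardo_quotient_def increment_def)
  have 1: "integrable lebesgue (\<lambda>x. \<bar>u x\<bar> powr p) \<longleftrightarrow> (\<integral>\<^sup>+x. ennreal (\<bar>u x\<bar> powr p) \<partial>lebesgue) < top"
    if [measurable]: "u \<in> borel_measurable lebesgue" by (simp add: integrable_iff_bounded)
  have 2: "integrable lebesgue (gagliardo_quotient p (s * p) u) \<longleftrightarrow> (\<integral>\<^sup>+z. ennreal (gagliardo_quotient p (s * p) u z) \<partial>lebesgue) < top"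
    if [measurable]: "u \<in> borel_measurable lebesgue" by (simp add: integrable_iff_bounded)
  show ?thesis unfolding Wsp0_def Wsp_def mem_Collect_eq eq using 1 2 by auto
qed

lemma Wsp0_representative:
  fixes u :: "'a::euclidean_space \<Rightarrow> real"
  assumes u: "u \<in> Wsp0 s p \<Omega>" and \<Omega>: "\<Omega> \<in> sets borel"
  shows "\<exists>g. g \<in> borel_measurable borel \<and> (\<forall>x. x \<notin> \<Omega> \<longrightarrow> g x = 0) \<and> (AE x in lebesgue. u x = g x) \<and>
    (\<integral>\<^sup>+x. ennreal (\<bar>g x\<bar> powr p) \<partial>lborel) < top \<and>
    gagliardo p (s * p) g = (\<integral>\<^sup>+z. ennreal (gagliardo_quotient p (s * p) u z) \<partial>lebesgue)"
proof -
  obtain g where g: "g \<in> borel_measurable borel" "\<forall>x. x \<notin> \<Omega> \<longrightarrow> g x = 0" "AE x in lebesgue. u x = g x"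
    using borel_representative[of u \<Omega>] u \<Omega> by (auto simp: Wsp0_iff)
  have "(\<integral>\<^sup>+x. ennreal (\<bar>g x\<bar> powr p) \<partial>lborel) = (\<integral>\<^sup>+x. ennreal (\<bar>g x\<bar> powr p) \<partial>lebesgue)"
    by (simp add: nn_integral_completion)
  also have "\<dots> = (\<integral>\<^sup>+x. ennreal (\<bar>u x\<bar> powr p) \<partial>lebesgue)"
    using g(3) by (intro nn_integral_cong_AE) (auto elim!: eventually_mono)
  finally have "(\<integral>\<^sup>+x. ennreal (\<bar>g x\<bar> powr p) \<partial>lborel) = (\<integral>\<^sup>+x. ennreal (\<bar>u x\<bar> powr p) \<partial>lebesgue)" .
  moreover have "gagliardo p (s * p) g = (\<integral>\<^sup>+z. ennreal (gagliardo_quotient p (s * p) u z) \<partial>lebesgue)"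
    unfolding nn_integral_gagliardo_quotient[OF g(1), symmetric] using AE_increment_cong[OF g(3)]
    by (intro nn_integral_cong_AE) (auto elim!: eventually_mono simp: gagliardo_quotient_def)
  ultimately show ?thesis using g u by (auto simp: Wsp0_iff)
qed

lemma borel_in_Wsp0:
  fixes g :: "'a::euclidean_space \<Rightarrow> real"
  assumes "g \<in> borel_measurable borel" "\<And>x. x \<notin> \<Omega> \<Longrightarrow> g x = 0"
    "(\<integral>\<^sup>+x. ennreal (\<bar>g x\<bar> powr p) \<partial>lborel) < top" "gagliardo p (s * p) g < top"
  shows "g \<in> Wsp0 s p \<Omega>"
  unfolding Wsp0_iff nn_integral_gagliardo_quotient[OF assms(1)]
  using assms by (simp add: nn_integral_completion measurable_completion)

text \<open>The set where \<open>b\<close> is positive is merely measurable. It contains a compact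
  \<open>T\<close> of positive measure, and Lipschitz cut-offs of the distance to \<open>T\<close>
  decrease to its indicator, so the integrals tend to the positive integral of \<open>b\<close> over
  \<open>T\<close>. As \<open>T\<close> has positive distance \<open>d\<close> from the complement,
  late cut-offs vanish outside the domain.\<close>

lemma Wsp0_positive_weighted_integral:
  fixes \<Omega> :: "'a::euclidean_space set"
  assumes \<Omega>: "open \<Omega>" "bounded \<Omega>" and s: "0 < s" "s < 1" and p: "0 < p" and r: "0 < r"
    and b [measurable]: "b \<in> borel_measurable (lebesgue_on \<Omega>)" and bc: "AE x in lebesgue_on \<Omega>. \<bar>b x\<bar> \<le> c"
    and pos: "\<not> (AE x in lebesgue_on \<Omega>. max (b x) 0 = 0)"
  shows "\<exists>u\<in>Wsp0 s p \<Omega>. 0 < (\<integral>x. b x * \<bar>u x\<bar> powr r \<partial>lebesgue_on \<Omega>)"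
proof -
  have [measurable]: "\<Omega> \<in> sets borel" "\<Omega> \<in> sets lebesgue" using \<Omega> by auto
  have fin: "emeasure lborel \<Omega> < top" using \<Omega>(2) emeasure_bounded_finite by auto
  have finL: "emeasure (lebesgue_on \<Omega>) (space (lebesgue_on \<Omega>)) < top"
    using fin by (simp add: emeasure_restrict_space)
  define P where "P = {x \<in> \<Omega>. 0 < b x}"
  have P: "P \<in> sets lebesgue"
  proof -
    have "{x \<in> space (lebesgue_on \<Omega>). 0 < b x} \<in> sets (lebesgue_on \<Omega>)" by measurable
    then show ?thesis by (auto simp: P_def sets_restrict_space_iff)
  qed
  have "emeasure lebesgue P \<noteq> 0"
  proof
    assume "emeasure lebesgue P = 0"
    then have "AE x in lebesgue. x \<notin> P" using P by (intro AE_not_in) (auto simp: null_sets_def)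
    then have "AE x in lebesgue_on \<Omega>. max (b x) 0 = 0"
      by (subst AE_restrict_space_iff) (auto elim!: eventually_mono simp: P_def)
    then show False using pos by simp
  qed
  moreover have "emeasure lebesgue P \<le> emeasure lebesgue \<Omega>" by (intro emeasure_mono) (auto simp: P_def)
  ultimately obtain e where e: "emeasure lebesgue P = ennreal e" "0 < e"
    using fin by (cases "emeasure lebesgue P") (auto simp: top_unique)
  obtain T where T: "closed T" "T \<subseteq> P" "P - T \<in> lmeasurable" "emeasure lebesgue (P - T) < ennreal e"
    using sets_lebesgue_inner_closed[OF P e(2)] by blast
  have [measurable]: "T \<in> sets borel" using T by auto
  have "T \<subseteq> \<Omega>" using T by (auto simp: P_def)
  have "emeasure lebesgue T \<noteq> 0"
  proof
    assume "emeasure lebesgue T = 0"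
    have "emeasure lebesgue P \<le> emeasure lebesgue ((P - T) \<union> T)" using T P by (intro emeasure_mono) auto
    also have "\<dots> \<le> emeasure lebesgue (P - T) + emeasure lebesgue T"
      using T P by (intro emeasure_subadditive) auto
    finally show False using T(4) e \<open>emeasure lebesgue T = 0\<close> by simp
  qed
  then have "T \<noteq> {}" by auto
  have "compact T" using T \<Omega>(2) \<open>T \<subseteq> \<Omega>\<close> by (simp add: compact_eq_bounded_closed bounded_subset)
  obtain d where d: "0 < d" "\<And>x y. x \<in> T \<Longrightarrow> y \<notin> \<Omega> \<Longrightarrow> d \<le> dist x y"
  proof -
    have "closed (- \<Omega>)" "T \<inter> - \<Omega> = {}" using \<Omega>(1) \<open>T \<subseteq> \<Omega>\<close> by auto
    from separate_compact_closed[OF \<open>compact T\<close> this] show ?thesis using that by blast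
  qed
  have infd: "d \<le> infdist y T" if "y \<notin> \<Omega>" for y
    using \<open>T \<noteq> {}\<close> d(2)[OF _ that] by (auto simp: infdist_notempty dist_commute intro!: cINF_greatest)
  define f where "f n x = max 0 (1 - real (Suc n) * infdist x T)" for n x
  have fcont: "continuous_on UNIV (f n)" for n unfolding f_def by (intro continuous_intros)
  have [measurable]: "f n \<in> borel_measurable borel" for n by (intro borel_measurable_continuous_onI fcont)
  have [measurable]: "f n \<in> borel_measurable (lebesgue_on \<Omega>)" for n
    by (intro measurable_restrict_space1 measurable_completion) simp
  have f1: "0 \<le> f n x" "f n x \<le> 1" for n x
    using infdist_nonneg[of x T] by (auto simp: f_def)
  have flim: "(\<lambda>n. f n x) \<longlonglongrightarrow> indicator T x" for x
  proof (cases "x \<in> T")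
    case True
    then show ?thesis by (simp add: f_def)
  next
    case False
    then have "infdist x T \<noteq> 0" using in_closed_iff_infdist_zero[OF T(1) \<open>T \<noteq> {}\<close>] by auto
    then have i: "0 < infdist x T" using infdist_nonneg[of x T] by simp
    obtain n0 where n0: "1 / infdist x T \<le> real n0" using real_arch_simple by blast
    have "f n x = 0" if "n \<ge> n0" for n
    proof -
      have "1 / infdist x T \<le> real (Suc n)" using n0 that by linarith
      then have "1 \<le> real (Suc n) * infdist x T" using i by (simp add: pos_divide_le_eq)
      then show ?thesis by (simp add: f_def)
    qed
    then show ?thesis using False by (intro tendsto_eventually) (auto simp: eventually_sequentially)
  qed
  have "(\<lambda>n. \<integral>x. b x * \<bar>f n x\<bar> powr r \<partial>lebesgue_on \<Omega>) \<longlonglongrightarrow> (\<integral>x. b x * \<bar>indicator T x\<bar> powr r \<partial>lebesgue_on \<Omega>)"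
  proof (rule integral_dominated_convergence[where w="\<lambda>x. c"])
    show "integrable (lebesgue_on \<Omega>) (\<lambda>x. c)" using finL by (simp add: integrable_iff_bounded ennreal_mult_less_top)
    have "(\<lambda>n. b x * \<bar>f n x\<bar> powr r) \<longlonglongrightarrow> b x * \<bar>indicator T x\<bar> powr r" for x
      using r by (intro tendsto_intros tendsto_powr2 flim) auto
    then show "AE x in lebesgue_on \<Omega>. (\<lambda>n. b x * \<bar>f n x\<bar> powr r) \<longlonglongrightarrow> b x * \<bar>indicator T x\<bar> powr r" by simp
    show "AE x in lebesgue_on \<Omega>. norm (b x * \<bar>f n x\<bar> powr r) \<le> c" for n
      using bc
    proof eventually_elim
      case (elim x)
      have "\<bar>f n x\<bar> powr r \<le> 1 powr r" using f1[of n x] r by (intro powr_mono2) auto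
      then have "\<bar>b x\<bar> * \<bar>f n x\<bar> powr r \<le> c * 1" using elim by (intro mult_mono) auto
      then show ?case by (simp add: abs_mult)
    qed
    have "indicator T \<in> borel_measurable (lebesgue_on \<Omega>)"
      by (intro measurable_restrict_space1 measurable_completion) simp
    then show "(\<lambda>x. b x * \<bar>indicator T x\<bar> powr r) \<in> borel_measurable (lebesgue_on \<Omega>)" by measurable
  qed measurable
  also have "(\<integral>x. b x * \<bar>indicator T x\<bar> powr r \<partial>lebesgue_on \<Omega>) = (\<integral>x. b x * indicator T x \<partial>lebesgue_on \<Omega>)"
    by (intro Bochner_Integration.integral_cong) (auto simp: indicator_def)
  finally have lim: "(\<lambda>n. \<integral>x. b x * \<bar>f n x\<bar> powr r \<partial>lebesgue_on \<Omega>) \<longlonglongrightarrow> (\<integral>x. b x * indicator T x \<partial>lebesgue_on \<Omega>)" .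
  have "0 < (\<integral>x. b x * indicator T x \<partial>lebesgue_on \<Omega>)"
  proof -
    have Tm [measurable]: "indicator T \<in> borel_measurable (lebesgue_on \<Omega>)"
      by (intro measurable_restrict_space1 measurable_completion) simp
    have bT: "0 \<le> b x * indicator T x" for x using T(2) by (auto simp: P_def indicator_def)
    have i: "integrable (lebesgue_on \<Omega>) (\<lambda>x. b x * indicator T x)"
    proof (rule Bochner_Integration.integrable_bound[where f="\<lambda>x. c"])
      show "integrable (lebesgue_on \<Omega>) (\<lambda>x. c)" using finL by (simp add: integrable_iff_bounded ennreal_mult_less_top)
      show "AE x in lebesgue_on \<Omega>. norm (b x * indicator T x) \<le> norm c"
        using bc by eventually_elim (auto simp: indicator_def)
    qed measurable
    have "(\<integral>x. b x * indicator T x \<partial>lebesgue_on \<Omega>) \<noteq> 0"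
    proof
      assume "(\<integral>x. b x * indicator T x \<partial>lebesgue_on \<Omega>) = 0"
      then have "AE x in lebesgue_on \<Omega>. b x * indicator T x = 0"
        using integral_nonneg_eq_0_iff_AE[OF i] bT by auto
      then have "AE x in lebesgue. x \<in> \<Omega> \<longrightarrow> b x * indicator T x = 0"
        by (subst (asm) AE_restrict_space_iff) auto
      then have "AE x in lebesgue. x \<notin> T"
        by eventually_elim (use T(2) in \<open>auto simp: P_def indicator_def split: if_splits\<close>)
      then have "emeasure lebesgue T = 0"
        by (subst (asm) AE_iff_null_sets[symmetric]) (auto simp: null_sets_def)
      then show False using \<open>emeasure lebesgue T \<noteq> 0\<close> by simp
    qed
    moreover have "0 \<le> (\<integral>x. b x * indicator T x \<partial>lebesgue_on \<Omega>)" using bT by (intro integral_nonneg_AE) auto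
    ultimately show ?thesis by simp
  qed
  then have ev: "\<forall>\<^sub>F n in sequentially. 0 < (\<integral>x. b x * \<bar>f n x\<bar> powr r \<partial>lebesgue_on \<Omega>)"
    using lim by (intro order_tendstoD)
  obtain n0 where n0: "1 / d \<le> real n0" using real_arch_simple by blast
  obtain n where n: "0 < (\<integral>x. b x * \<bar>f n x\<bar> powr r \<partial>lebesgue_on \<Omega>)" "n0 \<le> n"
    using eventually_conj[OF ev eventually_ge_at_top[of n0]] by (auto dest!: eventually_happens)
  have f0: "f n x = 0" if "x \<notin> \<Omega>" for x
  proof -
    have "1 / d \<le> real (Suc n)" using n0 n(2) by linarith
    then have "1 \<le> real (Suc n) * d" using d(1) by (simp add: pos_divide_le_eq)
    also have "\<dots> \<le> real (Suc n) * infdist x T" using infd[OF that] by (intro mult_left_mono) auto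
    finally show ?thesis by (simp add: f_def)
  qed
  have "f n \<in> Wsp0 s p \<Omega>"
  proof (rule borel_in_Wsp0[OF _ f0])
    show "f n \<in> borel_measurable borel" by measurable
    have "ennreal (\<bar>f n x\<bar> powr p) \<le> indicator \<Omega> x" for x
    proof (cases "x \<in> \<Omega>")
      case True
      have "\<bar>f n x\<bar> powr p \<le> 1 powr p" using f1[of n x] p by (intro powr_mono2) auto
      then show ?thesis using True by (simp add: ennreal_le_1)
    qed (use f0 in simp)
    then have "(\<integral>\<^sup>+x. ennreal (\<bar>f n x\<bar> powr p) \<partial>lborel) \<le> (\<integral>\<^sup>+x. indicator \<Omega> x \<partial>lborel)" by (rule nn_integral_mono)
    then show "(\<integral>\<^sup>+x. ennreal (\<bar>f n x\<bar> powr p) \<partial>lborel) < top" using fin by (simp add: order_le_less_trans)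
    show "gagliardo p (s * p) (f n) < top"
    proof (rule gagliardo_finite[OF _ _ _ fin f0, where L="real (Suc n)"])
      show "0 < s * p" "s * p < p" using s p by auto
      fix x y
      have "\<bar>f n x - f n y\<bar> \<le> \<bar>real (Suc n) * infdist x T - real (Suc n) * infdist y T\<bar>" by (auto simp: f_def)
      also have "\<dots> = real (Suc n) * \<bar>infdist x T - infdist y T\<bar>" by (simp add: abs_mult flip: right_diff_distrib)
      also have "\<dots> \<le> real (Suc n) * norm (x - y)"
        using infdist_triangle_abs[of x T y] by (intro mult_left_mono) (auto simp: dist_norm)
      finally have 1: "\<bar>f n x - f n y\<bar> \<le> real (Suc n) * norm (x - y)" .
      have "\<bar>f n x - f n y\<bar> \<le> 1" using f1[of n x] f1[of n y] by linarith
      also have "1 \<le> real (Suc n) * 1" by simp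
      finally show "\<bar>f n x - f n y\<bar> \<le> real (Suc n) * min 1 (norm (x - y))" using 1 by (simp add: min_def)
    qed auto
  qed
  then show ?thesis using n(1) by blast
qed

section \<open>The energy functional\<close>

lemma signed_power_continuous:
  fixes r :: real
  assumes "1 < r"
  shows "continuous_on UNIV (\<lambda>x::real. sgn x * \<bar>x\<bar> powr (r - 1))"
proof -
  have eq: "(\<lambda>x::real. sgn x * \<bar>x\<bar> powr (r - 1)) = (\<lambda>x. max x 0 powr (r - 1) - max (- x) 0 powr (r - 1))"
    by (auto simp: fun_eq_iff sgn_if max_def)
  show ?thesis
    unfolding eq using assms by (intro continuous_intros continuous_on_powr') auto
qed

lemma abs_powr_has_derivative:
  fixes r x :: real
  assumes "1 < r"
  shows "((\<lambda>x. \<bar>x\<bar> powr r) has_real_derivative r * (sgn x * \<bar>x\<bar> powr (r - 1))) (at x)"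
proof -
  consider "0 < x" | "x < 0" | "x = 0" by linarith
  then show ?thesis
  proof cases
    case 1
    have "((\<lambda>x. x powr r) has_real_derivative r * (sgn x * \<bar>x\<bar> powr (r - 1))) (at x)"
      using 1 by (auto intro!: derivative_eq_intros)
    then show ?thesis
      by (rule has_field_derivative_transform_within_open[of _ _ _ "{0<..}"]) (use 1 in auto)
  next
    case 2
    have "((\<lambda>x. (- x) powr r) has_real_derivative r * (sgn x * \<bar>x\<bar> powr (r - 1))) (at x)"
      using 2 by (auto intro!: derivative_eq_intros)
    then show ?thesis
      by (rule has_field_derivative_transform_within_open[of _ _ _ "{..<0}"]) (use 2 in auto)
  next
    case 3
    have "((\<lambda>h::real. \<bar>h\<bar> powr (r - 1)) \<longlongrightarrow> \<bar>0\<bar> powr (r - 1)) (at 0)"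
      using assms by (intro tendsto_powr2 tendsto_rabs tendsto_const tendsto_ident_at) auto
    then have lim: "((\<lambda>h::real. \<bar>h\<bar> powr (r - 1)) \<longlongrightarrow> 0) (at 0)" using assms by simp
    have "((\<lambda>h::real. \<bar>h\<bar> powr r / h) \<longlongrightarrow> 0) (at 0)"
      by (rule Lim_null_comparison[OF always_eventually lim]) (auto simp: powr_diff)
    then show ?thesis using 3 by (simp add: has_field_derivative_iff)
  qed
qed

text \<open>The definition of the potential goes through |t|. An antiderivative of the odd function
  \<open>A\<close> on the whole line is even, hence differs from the potential by a constant, and
  differentiability at 0 needs no separate treatment.\<close>

lemma potential_has_derivative:
  assumes A: "continuous_on UNIV A" and odd: "\<And>t. A (- t) = - A t"
  shows "(potential A has_real_derivative A t) (at t)"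
proof -
  have "\<exists>G. \<forall>x. -\<infinity> < ereal x \<longrightarrow> ereal x < \<infinity> \<longrightarrow> (G has_vector_derivative A x) (at x)"
    using A by (intro einterval_antiderivative) (auto simp: continuous_on_eq_continuous_at)
  then obtain G where "\<And>x. (G has_vector_derivative A x) (at x)" by auto
  then have G: "(G has_real_derivative A x) (at x)" for x
    by (simp add: has_real_derivative_iff_has_vector_derivative)
  have "((\<lambda>x. G (- x) - G x) has_real_derivative 0) (at x)" for x
  proof -
    have "((\<lambda>x. G (- x)) has_real_derivative A (- x) * - 1) (at x)"
      by (rule DERIV_chain2[OF G]) (auto intro!: derivative_eq_intros)
    from DERIV_diff[OF this G] show ?thesis by (simp add: odd)
  qed
  then have even: "G (- x) - G x = G (- 0) - G 0" for x
    using DERIV_isconst_all[of "\<lambda>x. G (- x) - G x"] by blast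
  have "potential A t = G t - G 0" for t
  proof -
    have "(A has_integral (G \<bar>t\<bar> - G 0)) {0..\<bar>t\<bar>}"
      using G by (intro fundamental_theorem_of_calculus)
        (auto simp: has_real_derivative_iff_has_vector_derivative[symmetric] intro: has_field_derivative_at_within)
    then have "potential A t = G \<bar>t\<bar> - G 0" by (simp add: potential_def integral_unique)
    then show ?thesis using even[of t] by (simp add: abs_if split: if_splits)
  qed
  then have "potential A = (\<lambda>t. G t - G 0)" by auto
  then show ?thesis using G[of t] by (auto intro!: derivative_eq_intros)
qed

locale fractional_problem =
  fixes \<Omega> :: "'a::euclidean_space set"
    and s l p m m1 m2 cA CA b0 b1 cw :: real
    and A A' :: "real \<Rightarrow> real"
    and K :: "'a \<times> 'a \<Rightarrow> real"
    and a b :: "'a \<Rightarrow> real"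
  assumes dom: "open \<Omega>" "bounded \<Omega>"
    and s: "0 < s" "s < 1"
    and exponents: "1 < m1" "m1 < l" "l \<le> p" "p \<le> m" "m < m2"
      "m2 < real DIM('a) * p / (real DIM('a) - s * p)" "s * p < real DIM('a)"
    and A_odd: "\<And>t. A (- t) = - A t"
    and A_deriv: "\<And>t. (A has_real_derivative A' t) (at t)" "continuous_on UNIV A'"
    and A_growth: "cA > 0" "CA > 0"
      "\<And>t. A t * t \<ge> cA * \<bar>t\<bar> powr p"
      "\<And>t. \<bar>A t\<bar> \<le> CA * \<bar>t\<bar> powr (p - 1)"
    and A_i: "\<And>t. l * potential A t \<le> A t * t" "\<And>t. A t * t \<le> p * potential A t"
    and A_ii: "\<And>t. (l - 1) * (A t * t) \<le> t\<^sup>2 * A' t" "\<And>t. t\<^sup>2 * A' t \<le> (m - 1) * (A t * t)"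
    and K_meas: "K \<in> borel_measurable lebesgue"
    and K_nonneg: "\<And>x y. K (x, y) \<ge> 0"
    and K_bounds: "0 < b0"
      "\<And>x y. x \<noteq> y \<Longrightarrow> b0 \<le> K (x, y) * norm (x - y) powr (real DIM('a) + s * p)"
      "\<And>x y. x \<noteq> y \<Longrightarrow> K (x, y) * norm (x - y) powr (real DIM('a) + s * p) \<le> b1"
    and weights: "a \<in> borel_measurable (lebesgue_on \<Omega>)" "b \<in> borel_measurable (lebesgue_on \<Omega>)"
      "AE x in lebesgue_on \<Omega>. \<bar>a x\<bar> \<le> cw" "AE x in lebesgue_on \<Omega>. \<bar>b x\<bar> \<le> cw" "0 \<le> cw"
      "\<not> (AE x in lebesgue_on \<Omega>. max (b x) 0 = 0)"
begin

abbreviation "W \<equiv> Wsp0 s p \<Omega>"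

definition kint :: "(real \<Rightarrow> real) \<Rightarrow> ('a \<Rightarrow> real) \<Rightarrow> real" where
  "kint f u = (\<integral>z. K z * f (increment u z) \<partial>lebesgue)"

definition dkint :: "('a \<Rightarrow> real) \<Rightarrow> ('a \<Rightarrow> real) \<Rightarrow> real" where
  "dkint u v = (\<integral>z. K z * (A (increment u z) * increment v z) \<partial>lebesgue)"

definition wint :: "('a \<Rightarrow> real) \<Rightarrow> real \<Rightarrow> ('a \<Rightarrow> real) \<Rightarrow> real" where
  "wint w r u = (\<integral>x. w x * \<bar>u x\<bar> powr r \<partial>lebesgue_on \<Omega>)"

text \<open>The form with \<open>sgn\<close> and exponent r - 1 is continuous at 0 for every r > 1;
  \<open>weak_solution_iff\<close> identifies it with the integrand |u|^(r-2) u v.\<close>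

definition dwint :: "('a \<Rightarrow> real) \<Rightarrow> real \<Rightarrow> ('a \<Rightarrow> real) \<Rightarrow> ('a \<Rightarrow> real) \<Rightarrow> real" where
  "dwint w r u v = (\<integral>x. w x * (sgn (u x) * \<bar>u x\<bar> powr (r - 1) * v x) \<partial>lebesgue_on \<Omega>)"

abbreviation "N \<equiv> kint (\<lambda>t. \<bar>t\<bar> powr p)"
abbreviation "P \<equiv> kint (potential A)"
abbreviation "B \<equiv> kint (\<lambda>t. A t * t)"
abbreviation "H \<equiv> kint (\<lambda>t. t\<^sup>2 * A' t)"

lemma p: "1 < p" "0 < p" and sp: "0 < s * p" and l: "1 < l" "0 < l" and m: "1 < m"
  using exponents s by auto

lemma \<Omega>_sets [measurable]: "\<Omega> \<in> sets borel" "\<Omega> \<in> sets lebesgue"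
  using dom by auto

lemma \<Omega>_finite: "emeasure lborel \<Omega> < top" "emeasure (lebesgue_on \<Omega>) (space (lebesgue_on \<Omega>)) < top"
proof -
  show "emeasure lborel \<Omega> < top" using dom(2) emeasure_bounded_finite by auto
  then show "emeasure (lebesgue_on \<Omega>) (space (lebesgue_on \<Omega>)) < top"
    by (simp add: emeasure_restrict_space)
qed

definition q :: real where "q = critical_exponent TYPE('a) p (s * p)"

lemma q: "m1 < q" "m2 < q" "p < q"
  using exponents by (auto simp: q_def critical_exponent_def)

lemma K_nonneg': "0 \<le> K z"
  using K_nonneg by (cases z) auto

lemma A_cont: "continuous_on UNIV A"
  using A_deriv(1) by (meson DERIV_isCont continuous_at_imp_continuous_on)

lemma A_mult_nonneg: "0 \<le> A t * t"
  using A_growth(1) A_growth(3)[of t] by (smt (verit) mult_nonneg_nonneg powr_ge_zero)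

lemma A_mult_bound: "\<bar>A t * t\<bar> \<le> CA * \<bar>t\<bar> powr p"
proof -
  have "\<bar>A t * t\<bar> \<le> CA * \<bar>t\<bar> powr (p - 1) * \<bar>t\<bar>"
    unfolding abs_mult using A_growth(4)[of t] by (intro mult_right_mono) auto
  also have "\<dots> = CA * \<bar>t\<bar> powr p"
    using powr_mult_base[of "\<bar>t\<bar>" "p - 1"] by (simp add: mult_ac)
  finally show ?thesis .
qed

lemma potential_nonneg: "0 \<le> potential A t"
  using A_i(2)[of t] A_mult_nonneg[of t] p by (smt (verit) mult_pos_neg)

lemma potential_bound: "\<bar>potential A t\<bar> \<le> CA / l * \<bar>t\<bar> powr p"
proof -
  have "l * potential A t \<le> CA * \<bar>t\<bar> powr p"
    using A_i(1)[of t] A_mult_bound[of t] by linarith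
  then show ?thesis using l potential_nonneg[of t] by (simp add: field_simps)
qed

lemma potential_deriv: "(potential A has_real_derivative A t) (at t)"
  using A_cont A_odd by (rule potential_has_derivative)

lemma potential_cont: "continuous_on UNIV (potential A)"
  using potential_deriv by (meson DERIV_isCont continuous_at_imp_continuous_on)

lemma A'_bound: "\<bar>t\<^sup>2 * A' t\<bar> \<le> (m - 1) * CA * \<bar>t\<bar> powr p"
proof -
  have "0 \<le> (l - 1) * (A t * t)" using l by (intro mult_nonneg_nonneg[OF _ A_mult_nonneg]) auto
  then have "\<bar>t\<^sup>2 * A' t\<bar> \<le> (m - 1) * (A t * t)" using A_ii[of t] by linarith
  also have "\<dots> \<le> (m - 1) * (CA * \<bar>t\<bar> powr p)" using A_mult_bound[of t] m by (intro mult_left_mono) auto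
  finally show ?thesis by simp
qed

lemma A'_mult_bound: "\<bar>A' t * t\<bar> \<le> (m - 1) * CA * \<bar>t\<bar> powr (p - 1)"
proof (cases "t = 0")
  case False
  have "\<bar>A' t * t\<bar> * \<bar>t\<bar> \<le> (m - 1) * CA * (\<bar>t\<bar> powr (p - 1) * \<bar>t\<bar>)"
    using A'_bound[of t] powr_mult_base[of "\<bar>t\<bar>" "p - 1"] by (simp add: abs_mult power2_eq_square mult_ac)
  then have "\<bar>A' t * t\<bar> * \<bar>t\<bar> \<le> (m - 1) * CA * \<bar>t\<bar> powr (p - 1) * \<bar>t\<bar>" by (simp add: mult_ac)
  then show ?thesis using False by (simp only: mult_le_cancel_right)
qed simp

section \<open>The Sobolev space as a vector space and its kernel integrals\<close>

lemma W_measurable: "u \<in> W \<Longrightarrow> u \<in> borel_measurable lebesgue"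
  by (simp add: Wsp0_iff)

lemma increment_lincomb: "increment (\<lambda>x. c * u x + d * v x) = (\<lambda>z. c * increment u z + d * increment v z)"
  for c d :: real and u v :: "'a \<Rightarrow> real"
  by (auto simp: increment_def algebra_simps)

lemma W_lincomb:
  assumes u: "u \<in> W" and v: "v \<in> W"
  shows "(\<lambda>x. c * u x + d * v x) \<in> W"
proof -
  \<comment> \<open>Membership in \<open>W\<close> is two weighted integrability conditions, one on
    functions with weight 1 and one on increments with weight \<open>k\<close>, plus vanishing
    outside the domain. Each of these is stable under linear combinations.\<close>
  define k :: "'a \<times> 'a \<Rightarrow> real" where "k z = 1 / norm (fst z - snd z) powr (real DIM('a) + s * p)" for z
  have k: "k \<in> borel_measurable lebesgue"
  proof -
    have "k \<in> borel_measurable borel" unfolding k_def[abs_def] by measurable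
    then show ?thesis by (intro measurable_completion) simp
  qed
  have "integrable lebesgue (gagliardo_quotient p (s * p) u) \<longleftrightarrow> (\<integral>\<^sup>+z. ennreal (gagliardo_quotient p (s * p) u z) \<partial>lebesgue) < top"
    "integrable lebesgue (\<lambda>x. \<bar>u x\<bar> powr p) \<longleftrightarrow> (\<integral>\<^sup>+x. ennreal (\<bar>u x\<bar> powr p) \<partial>lebesgue) < top"
    if [measurable]: "u \<in> borel_measurable lebesgue" for u :: "'a \<Rightarrow> real" by (simp_all add: integrable_iff_bounded)
  then have W: "u \<in> W \<longleftrightarrow> u \<in> weighted_Lp lebesgue (\<lambda>_. 1) p \<and> increment u \<in> weighted_Lp lebesgue k p
     \<and> (AE x in lebesgue. x \<notin> \<Omega> \<longrightarrow> u x = 0)" for u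
    by (auto simp: Wsp0_iff weighted_Lp_def k_def gagliardo_quotient_def[abs_def])
  have "AE x in lebesgue. x \<notin> \<Omega> \<longrightarrow> c * u x + d * v x = 0"
    using u[unfolded W] v[unfolded W] by (auto elim: eventually_elim2)
  then show ?thesis
    using u[unfolded W] v[unfolded W] p k unfolding W increment_lincomb
    by (auto intro!: weighted_Lp_lincomb)
qed

text \<open>The kernel bounds hold off the diagonal only; on the diagonal the increment is 0 and all
  terms vanish.\<close>

lemma kernel_quotient:
  fixes u :: "'a \<Rightarrow> real"
  shows "b0 * gagliardo_quotient p (s * p) u z \<le> K z * \<bar>increment u z\<bar> powr p"
    and "K z * \<bar>increment u z\<bar> powr p \<le> b1 * gagliardo_quotient p (s * p) u z"
proof -
  obtain x y where z: "z = (x, y)" by (cases z)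
  define n where "n = norm (x - y) powr (real DIM('a) + s * p)"
  have "b0 * (\<bar>u x - u y\<bar> powr p / n) \<le> K (x, y) * \<bar>u x - u y\<bar> powr p \<and>
     K (x, y) * \<bar>u x - u y\<bar> powr p \<le> b1 * (\<bar>u x - u y\<bar> powr p / n)"
  proof (cases "x = y")
    case False
    then have n: "0 < n" by (simp add: n_def)
    have "b0 / n \<le> K (x, y)" "K (x, y) \<le> b1 / n"
      using K_bounds(2,3)[OF False, folded n_def] n by (auto simp: field_simps)
    then have "b0 / n * \<bar>u x - u y\<bar> powr p \<le> K (x, y) * \<bar>u x - u y\<bar> powr p"
      "K (x, y) * \<bar>u x - u y\<bar> powr p \<le> b1 / n * \<bar>u x - u y\<bar> powr p"
      by (intro mult_right_mono; simp)+
    then show ?thesis by simp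
  qed simp
  then show "b0 * gagliardo_quotient p (s * p) u z \<le> K z * \<bar>increment u z\<bar> powr p"
    "K z * \<bar>increment u z\<bar> powr p \<le> b1 * gagliardo_quotient p (s * p) u z"
    by (auto simp: z n_def gagliardo_quotient_def increment_def)
qed

lemma b1: "0 \<le> b1"
proof -
  obtain e :: 'a where "e \<in> Basis" using nonempty_Basis by blast
  then have "e \<noteq> 0" by auto
  then show ?thesis using K_bounds(1) K_bounds(2)[of e 0] K_bounds(3)[of e 0] by linarith
qed

lemma increment_Lp:
  assumes u: "u \<in> W"
  shows "increment u \<in> weighted_Lp lebesgue K p"
proof -
  note [measurable] = W_measurable[OF u] K_meas
  have "integrable lebesgue (gagliardo_quotient p (s * p) u)"
    using u by (auto simp: integrable_iff_bounded Wsp0_iff)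
  then have "integrable lebesgue (\<lambda>z. b1 * gagliardo_quotient p (s * p) u z)" by (rule integrable_mult_right)
  then have "integrable lebesgue (\<lambda>z. K z * \<bar>increment u z\<bar> powr p)"
  proof (rule Bochner_Integration.integrable_bound)
    show "AE z in lebesgue. norm (K z * \<bar>increment u z\<bar> powr p) \<le> norm (b1 * gagliardo_quotient p (s * p) u z)"
    proof (rule AE_I2)
      fix z
      have "norm (K z * \<bar>increment u z\<bar> powr p) = K z * \<bar>increment u z\<bar> powr p" using K_nonneg'[of z] by simp
      also have "\<dots> \<le> b1 * gagliardo_quotient p (s * p) u z" by (rule kernel_quotient)
      also have "\<dots> \<le> norm (b1 * gagliardo_quotient p (s * p) u z)" by simp
      finally show "norm (K z * \<bar>increment u z\<bar> powr p) \<le> norm (b1 * gagliardo_quotient p (s * p) u z)" .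
    qed
  qed measurable
  then show ?thesis by (simp add: weighted_Lp_def)
qed

lemma kint_integrable:
  assumes "u \<in> W" "continuous_on UNIV f" "\<And>t. \<bar>f t\<bar> \<le> C * \<bar>t\<bar> powr p"
  shows "integrable lebesgue (\<lambda>z. K z * f (increment u z))"
  using integrable_power_growth[OF p(2) K_meas increment_Lp[OF assms(1)] assms(2,3)] .

lemma abs_powr_cont: "1 < r \<Longrightarrow> continuous_on UNIV (\<lambda>t::real. \<bar>t\<bar> powr r)"
  using abs_powr_has_derivative by (meson DERIV_isCont continuous_at_imp_continuous_on)

lemma kint_integrable_all:
  assumes "u \<in> W"
  shows "integrable lebesgue (\<lambda>z. K z * \<bar>increment u z\<bar> powr p)"
    "integrable lebesgue (\<lambda>z. K z * potential A (increment u z))"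
    "integrable lebesgue (\<lambda>z. K z * (A (increment u z) * increment u z))"
    "integrable lebesgue (\<lambda>z. K z * ((increment u z)\<^sup>2 * A' (increment u z)))"
proof -
  show "integrable lebesgue (\<lambda>z. K z * \<bar>increment u z\<bar> powr p)"
    using abs_powr_cont p by (intro kint_integrable[OF assms, of _ 1]) auto
  show "integrable lebesgue (\<lambda>z. K z * potential A (increment u z))"
    by (rule kint_integrable[OF assms potential_cont potential_bound])
  show "integrable lebesgue (\<lambda>z. K z * (A (increment u z) * increment u z))"
    by (rule kint_integrable[OF assms _ A_mult_bound]) (intro continuous_intros A_cont)
  show "integrable lebesgue (\<lambda>z. K z * ((increment u z)\<^sup>2 * A' (increment u z)))"
    by (rule kint_integrable[OF assms _ A'_bound]) (intro continuous_intros A_deriv)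
qed

lemma kint_mono:
  assumes "integrable lebesgue (\<lambda>z. K z * f (increment u z))" "integrable lebesgue (\<lambda>z. K z * g (increment u z))"
    and "\<And>t. x * f t \<le> y * g t"
  shows "x * kint f u \<le> y * kint g u"
proof -
  have "(\<integral>z. x * (K z * f (increment u z)) \<partial>lebesgue) \<le> (\<integral>z. y * (K z * g (increment u z)) \<partial>lebesgue)"
  proof (rule integral_mono)
    fix z
    have "K z * (x * f (increment u z)) \<le> K z * (y * g (increment u z))"
      using assms(3) K_nonneg'[of z] by (intro mult_left_mono) auto
    then show "x * (K z * f (increment u z)) \<le> y * (K z * g (increment u z))" by (simp add: mult_ac)
  qed (use assms in auto)
  then show ?thesis by (simp add: kint_def)
qed

lemma N_nonneg: "0 \<le> N u"
  unfolding kint_def using K_nonneg' by (intro integral_nonneg_AE) auto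

lemma quotient_N:
  assumes u: "u \<in> W"
  shows "(\<integral>\<^sup>+z. ennreal (gagliardo_quotient p (s * p) u z) \<partial>lebesgue) \<le> ennreal (N u / b0)"
proof -
  note [measurable] = W_measurable[OF u]
  have "ennreal b0 * (\<integral>\<^sup>+z. ennreal (gagliardo_quotient p (s * p) u z) \<partial>lebesgue) = (\<integral>\<^sup>+z. ennreal (b0 * gagliardo_quotient p (s * p) u z) \<partial>lebesgue)"
    using K_bounds(1) by (simp add: nn_integral_cmult ennreal_mult)
  also have "\<dots> \<le> (\<integral>\<^sup>+z. ennreal (K z * \<bar>increment u z\<bar> powr p) \<partial>lebesgue)"
    using kernel_quotient(1) by (intro nn_integral_mono ennreal_leI)
  also have "\<dots> = ennreal (N u)"
    unfolding kint_def using kint_integrable_all(1)[OF u] K_nonneg' by (intro nn_integral_eq_integral) auto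
  finally have "ennreal (1 / b0) * (ennreal b0 * (\<integral>\<^sup>+z. ennreal (gagliardo_quotient p (s * p) u z) \<partial>lebesgue)) \<le> ennreal (1 / b0) * ennreal (N u)"
    by (intro mult_left_mono) auto
  moreover have "ennreal (1 / b0) * ennreal b0 = 1" "ennreal (1 / b0) * ennreal (N u) = ennreal (N u / b0)"
    using K_bounds(1) by (simp_all flip: ennreal_mult')
  ultimately show ?thesis by (simp flip: mult.assoc)
qed

lemma sobolev_W:
  assumes r: "0 < r" "r \<le> q"
  shows "\<exists>D>0. \<forall>u\<in>W. (\<integral>\<^sup>+x. ennreal (\<bar>u x\<bar> powr r) \<partial>lebesgue) \<le> ennreal (D * N u powr (r / p))"
proof -
  obtain D where D: "D > 0" "\<And>u E. u \<in> borel_measurable borel \<Longrightarrow> (\<integral>\<^sup>+x. ennreal (\<bar>u x\<bar> powr p) \<partial>lborel) < top \<Longrightarrow>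
     (AE x in lborel. x \<notin> \<Omega> \<longrightarrow> u x = 0) \<Longrightarrow> gagliardo p (s * p) u \<le> ennreal E \<Longrightarrow> 0 \<le> E \<Longrightarrow>
     (\<integral>\<^sup>+x. ennreal (\<bar>u x\<bar> powr r) \<partial>lborel) \<le> ennreal (D * E powr (r / p))"
    using sobolev_subcritical[OF sp exponents(7) p(1) q_def r \<Omega>_sets(1) \<Omega>_finite(1)] by auto
  have "(\<integral>\<^sup>+x. ennreal (\<bar>u x\<bar> powr r) \<partial>lebesgue) \<le> ennreal (D * (1 / b0) powr (r / p) * N u powr (r / p))" if u: "u \<in> W" for u
  proof -
    obtain g where g: "g \<in> borel_measurable borel" "\<forall>x. x \<notin> \<Omega> \<longrightarrow> g x = 0" "AE x in lebesgue. u x = g x"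
      "(\<integral>\<^sup>+x. ennreal (\<bar>g x\<bar> powr p) \<partial>lborel) < top" "gagliardo p (s * p) g = (\<integral>\<^sup>+z. ennreal (gagliardo_quotient p (s * p) u z) \<partial>lebesgue)"
      using Wsp0_representative[OF u \<Omega>_sets(1)] by blast
    have "(\<integral>\<^sup>+x. ennreal (\<bar>u x\<bar> powr r) \<partial>lebesgue) = (\<integral>\<^sup>+x. ennreal (\<bar>g x\<bar> powr r) \<partial>lebesgue)"
      using g(3) by (intro nn_integral_cong_AE) (auto elim!: eventually_mono)
    also have "\<dots> = (\<integral>\<^sup>+x. ennreal (\<bar>g x\<bar> powr r) \<partial>lborel)" by (simp add: nn_integral_completion)
    also have "\<dots> \<le> ennreal (D * (N u / b0) powr (r / p))"
      using g quotient_N[OF u] N_nonneg[of u] K_bounds(1) by (intro D) auto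
    also have "(N u / b0) powr (r / p) = (1 / b0 * N u) powr (r / p)" by simp
    also have "\<dots> = (1 / b0) powr (r / p) * N u powr (r / p)" by (rule powr_mult)
    finally show ?thesis by (simp add: mult_ac)
  qed
  then show ?thesis using D(1) K_bounds(1) by (intro exI[of _ "D * (1 / b0) powr (r / p)"]) auto
qed

lemma nn_integral_lebesgue_on_le: "(\<integral>\<^sup>+x. f x \<partial>lebesgue_on \<Omega>) \<le> (\<integral>\<^sup>+x. f x \<partial>lebesgue)"
  by (subst nn_integral_restrict_space) (auto intro!: nn_integral_mono simp: indicator_def)

lemma W_lebesgue_on_measurable: "u \<in> W \<Longrightarrow> u \<in> borel_measurable (lebesgue_on \<Omega>)"
  by (intro measurable_restrict_space1 W_measurable)

definition admissible_weight :: "('a \<Rightarrow> real) \<Rightarrow> bool" where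
  "admissible_weight w \<longleftrightarrow> w \<in> borel_measurable (lebesgue_on \<Omega>) \<and> (AE x in lebesgue_on \<Omega>. \<bar>w x\<bar> \<le> cw)"

lemma W_weighted_Lp:
  assumes u: "u \<in> W" and w: "admissible_weight w" and r: "0 < r" "r \<le> q"
  shows "u \<in> weighted_Lp (lebesgue_on \<Omega>) w r"
proof -
  have "q \<le> q" "0 < q" using q p by auto
  then obtain D where D: "\<And>u. u \<in> W \<Longrightarrow> (\<integral>\<^sup>+x. ennreal (\<bar>u x\<bar> powr q) \<partial>lebesgue) \<le> ennreal (D * N u powr (q / p))"
    using sobolev_W[of q] by auto
  have "(\<integral>\<^sup>+x. ennreal (\<bar>u x\<bar> powr q) \<partial>lebesgue_on \<Omega>) < top"
    using nn_integral_lebesgue_on_le D[OF u] by (meson ennreal_less_top order_le_less_trans)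
  then show ?thesis
    using w W_lebesgue_on_measurable[OF u] r \<Omega>_finite(2)
    by (intro integrable_lower_power[of _ _ r q w cw]) (auto simp: admissible_weight_def)
qed

lemma wint_bound:
  assumes r: "0 < r" "r \<le> q"
  shows "\<exists>D>0. \<forall>u\<in>W. \<forall>w. admissible_weight w \<longrightarrow> \<bar>wint w r u\<bar> \<le> D * N u powr (r / p)"
proof -
  obtain D where D: "D > 0" "\<And>u. u \<in> W \<Longrightarrow> (\<integral>\<^sup>+x. ennreal (\<bar>u x\<bar> powr r) \<partial>lebesgue) \<le> ennreal (D * N u powr (r / p))"
    using sobolev_W[OF r] by auto
  \<comment> \<open>The summand 1 keeps the constant positive if \<open>cw\<close> is 0.\<close>
  have "\<bar>wint w r u\<bar> \<le> (cw * D + 1) * N u powr (r / p)" if u: "u \<in> W" and w: "admissible_weight w" for u w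
  proof -
    have [measurable]: "u \<in> borel_measurable (lebesgue_on \<Omega>)" using u by (rule W_lebesgue_on_measurable)
    have "ennreal \<bar>wint w r u\<bar> \<le> (\<integral>\<^sup>+x. ennreal (norm (w x * \<bar>u x\<bar> powr r)) \<partial>lebesgue_on \<Omega>)"
      using integral_norm_bound_ennreal[of "lebesgue_on \<Omega>" "\<lambda>x. w x * \<bar>u x\<bar> powr r"] W_weighted_Lp[OF u w r]
      by (simp add: wint_def weighted_Lp_def)
    also have "\<dots> \<le> (\<integral>\<^sup>+x. ennreal cw * ennreal (\<bar>u x\<bar> powr r) \<partial>lebesgue_on \<Omega>)"
    proof (rule nn_integral_mono_AE)
      show "AE x in lebesgue_on \<Omega>. ennreal (norm (w x * \<bar>u x\<bar> powr r)) \<le> ennreal cw * ennreal (\<bar>u x\<bar> powr r)"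
        using w[unfolded admissible_weight_def, THEN conjunct2]
      proof eventually_elim
        case (elim x)
        then have "norm (w x * \<bar>u x\<bar> powr r) \<le> cw * \<bar>u x\<bar> powr r" by (simp add: abs_mult mult_right_mono)
        then show ?case using weights(5) by (simp add: ennreal_leI flip: ennreal_mult)
      qed
    qed
    also have "\<dots> = ennreal cw * (\<integral>\<^sup>+x. ennreal (\<bar>u x\<bar> powr r) \<partial>lebesgue_on \<Omega>)" by (simp add: nn_integral_cmult)
    also have "\<dots> \<le> ennreal cw * ennreal (D * N u powr (r / p))"
      using nn_integral_lebesgue_on_le D(2)[OF u] by (intro mult_left_mono) (auto intro: order_trans)
    also have "\<dots> = ennreal (cw * (D * N u powr (r / p)))" using weights(5) D(1) by (simp flip: ennreal_mult)
    finally have "\<bar>wint w r u\<bar> \<le> cw * (D * N u powr (r / p))"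
      using weights(5) D(1) by (subst (asm) ennreal_le_iff) auto
    then show ?thesis by (simp add: distrib_right mult.assoc add_increasing2)
  qed
  then show ?thesis using weights(5) D(1) by (intro exI[of _ "cw * D + 1"]) (auto intro: add_nonneg_pos)
qed

text \<open>Vanishing energy forces \<open>u\<close> to be 0, not merely constant, because the
  Sobolev inequality with exponent p bounds the L^p integral by \<open>N\<close>.\<close>

lemma N_eq_0_iff:
  assumes u: "u \<in> W"
  shows "0 < N u \<longleftrightarrow> \<not> (AE x in lebesgue. u x = 0)"
proof -
  note [measurable] = W_measurable[OF u]
  have "N u = 0" if "AE x in lebesgue. u x = 0"
  proof -
    have "AE z in lebesgue. K z * \<bar>increment u z\<bar> powr p = 0"
      using AE_increment_cong[OF that] by eventually_elim (simp add: increment_def)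
    then show ?thesis unfolding kint_def by (rule integral_eq_zero_AE)
  qed
  moreover have "AE x in lebesgue. u x = 0" if "N u = 0"
  proof -
    obtain D where D: "\<And>u. u \<in> W \<Longrightarrow> (\<integral>\<^sup>+x. ennreal (\<bar>u x\<bar> powr p) \<partial>lebesgue) \<le> ennreal (D * N u powr (p / p))"
      using sobolev_W[of p] q p by auto
    have "(\<integral>\<^sup>+x. ennreal (\<bar>u x\<bar> powr p) \<partial>lebesgue) = 0" using D[OF u] that by simp
    then have "AE x in lebesgue. ennreal (\<bar>u x\<bar> powr p) = 0" by (subst (asm) nn_integral_0_iff_AE) auto
    then show ?thesis by eventually_elim simp
  qed
  ultimately show ?thesis using N_nonneg[of u] by (auto simp: less_le)
qed

text \<open>A ray is the line through the zero function in direction \<open>increment u\<close>, so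
  the general derivative formula applies with base point 0.\<close>

lemma kint_ray_derivative:
  assumes u: "u \<in> W" and "0 < t"
    and f: "\<And>x. (f has_real_derivative f' x) (at x)" "\<And>x. \<bar>f x\<bar> \<le> C * \<bar>x\<bar> powr p"
    and f': "continuous_on UNIV f'" "\<And>x. \<bar>f' x\<bar> \<le> C' * \<bar>x\<bar> powr (p - 1)"
  shows "((\<lambda>t. kint f (\<lambda>x. t * u x)) has_real_derivative kint (\<lambda>x. f' x * x) (\<lambda>x. t * u x) / t) (at t)"
proof -
  have 0: "(\<lambda>z. 0) \<in> weighted_Lp lebesgue K p" by (simp add: weighted_Lp_def)
  have inc: "increment (\<lambda>x. t * u x) z = t * increment u z" for t z by (simp add: increment_def right_diff_distrib)
  have "((\<lambda>e. \<integral>z. K z * f (0 + e * increment u z) \<partial>lebesgue) has_real_derivative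
     (\<integral>z. K z * (f' (0 + t * increment u z) * increment u z) \<partial>lebesgue)) (at t)"
    by (rule integral_functional_derivative[OF p(1) K_meas 0 increment_Lp[OF u] f f'])
  moreover have "kint (\<lambda>x. f' x * x) (\<lambda>x. t * u x)
      = (\<integral>z. t * (K z * (f' (0 + t * increment u z) * increment u z)) \<partial>lebesgue)"
    unfolding kint_def inc by (intro Bochner_Integration.integral_cong) (auto simp: mult_ac)
  then have "(\<integral>z. K z * (f' (0 + t * increment u z) * increment u z) \<partial>lebesgue) = kint (\<lambda>x. f' x * x) (\<lambda>x. t * u x) / t"
    using \<open>0 < t\<close> by simp
  ultimately show ?thesis by (simp add: kint_def inc)
qed

lemma dkint_line:
  assumes u: "u \<in> W" and v: "v \<in> W"
  shows "((\<lambda>e. P (\<lambda>x. u x + e * v x)) has_real_derivative dkint (\<lambda>x. u x + e * v x) v) (at e)"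
proof -
  have inc: "increment (\<lambda>x. u x + e * v x) z = increment u z + e * increment v z" for e z
    by (simp add: increment_def algebra_simps)
  show ?thesis
    unfolding kint_def dkint_def inc
    by (rule integral_functional_derivative[OF p(1) K_meas increment_Lp[OF u] increment_Lp[OF v] potential_deriv potential_bound A_cont A_growth(4)])
qed

lemma dkint_continuous:
  assumes u: "u \<in> W" and v: "v \<in> W" and lim: "c \<longlonglongrightarrow> 1" "d \<longlonglongrightarrow> 0"
  shows "(\<lambda>n. dkint (\<lambda>x. c n * u x + d n * v x) v) \<longlonglongrightarrow> dkint u v"
proof -
  have "continuous_on UNIV (\<lambda>z::real \<times> real. A (fst z) * snd z)"
    by (intro continuous_intros continuous_on_compose2[OF A_cont]) auto
  moreover have "\<bar>A x * y\<bar> \<le> CA * (\<bar>x\<bar> + \<bar>y\<bar>) powr p" for x y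
    using A_growth p by (intro power_growth_pairing_bound) auto
  ultimately show ?thesis
    using integral_functional_continuous(2)[OF p(2) K_meas increment_Lp[OF u] increment_Lp[OF v], of "\<lambda>z. A (fst z) * snd z" CA c 1 d 0] lim
    by (simp add: dkint_def increment_lincomb)
qed

lemma wint_line:
  assumes u: "u \<in> W" and v: "v \<in> W" and w: "admissible_weight w" and r: "1 < r" "r \<le> q"
  shows "((\<lambda>e. wint w r (\<lambda>x. u x + e * v x)) has_real_derivative r * dwint w r (\<lambda>x. u x + e * v x) v) (at e)"
proof -
  have w': "w \<in> borel_measurable (lebesgue_on \<Omega>)" using w by (simp add: admissible_weight_def)
  have uv: "u \<in> weighted_Lp (lebesgue_on \<Omega>) w r" "v \<in> weighted_Lp (lebesgue_on \<Omega>) w r"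
    using W_weighted_Lp[OF _ w, of _ r] u v r by auto
  have "((\<lambda>e. wint w r (\<lambda>x. u x + e * v x)) has_real_derivative
    (\<integral>x. w x * (r * (sgn (u x + e * v x) * \<bar>u x + e * v x\<bar> powr (r - 1)) * v x) \<partial>lebesgue_on \<Omega>)) (at e)"
    unfolding wint_def
  proof (rule integral_functional_derivative[OF r(1) w' uv abs_powr_has_derivative[OF r(1)]])
    show "continuous_on UNIV (\<lambda>x::real. r * (sgn x * \<bar>x\<bar> powr (r - 1)))"
      by (intro continuous_intros signed_power_continuous r)
    show "\<bar>\<bar>x\<bar> powr r\<bar> \<le> 1 * \<bar>x\<bar> powr r" for x :: real by simp
    show "\<bar>r * (sgn x * \<bar>x\<bar> powr (r - 1))\<bar> \<le> r * \<bar>x\<bar> powr (r - 1)" for x :: real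
      using r by (auto simp: abs_mult sgn_if)
  qed
  moreover have "(\<integral>x. w x * (r * (sgn (u x + e * v x) * \<bar>u x + e * v x\<bar> powr (r - 1)) * v x) \<partial>lebesgue_on \<Omega>)
     = r * dwint w r (\<lambda>x. u x + e * v x) v"
    unfolding dwint_def by (subst integral_mult_right_zero[symmetric]) (simp add: mult_ac)
  ultimately show ?thesis by simp
qed

lemma dwint_continuous:
  assumes u: "u \<in> W" and v: "v \<in> W" and w: "admissible_weight w" and r: "1 < r" "r \<le> q"
    and lim: "c \<longlonglongrightarrow> 1" "d \<longlonglongrightarrow> 0"
  shows "integrable (lebesgue_on \<Omega>) (\<lambda>x. w x * (sgn (u x) * \<bar>u x\<bar> powr (r - 1) * v x))"
    and "(\<lambda>n. dwint w r (\<lambda>x. c n * u x + d n * v x) v) \<longlonglongrightarrow> dwint w r u v"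
proof -
  have w': "w \<in> borel_measurable (lebesgue_on \<Omega>)" using w by (simp add: admissible_weight_def)
  have uv: "u \<in> weighted_Lp (lebesgue_on \<Omega>) w r" "v \<in> weighted_Lp (lebesgue_on \<Omega>) w r"
    using W_weighted_Lp[OF _ w, of _ r] u v r by auto
  define \<phi> :: "real \<times> real \<Rightarrow> real" where "\<phi> z = sgn (fst z) * \<bar>fst z\<bar> powr (r - 1) * snd z" for z
  have c: "continuous_on UNIV \<phi>"
    unfolding \<phi>_def
    by (intro continuous_on_mult continuous_on_snd continuous_on_id
        continuous_on_compose2[OF signed_power_continuous[OF r(1)] continuous_on_fst]) auto
  have "\<bar>sgn x * \<bar>x\<bar> powr (r - 1) * y\<bar> \<le> 1 * (\<bar>x\<bar> + \<bar>y\<bar>) powr r" for x y :: real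
    using r by (intro power_growth_pairing_bound) (auto simp: abs_mult sgn_if)
  then have b: "\<bar>\<phi> (x, y)\<bar> \<le> 1 * (\<bar>x\<bar> + \<bar>y\<bar>) powr r" for x y by (simp add: \<phi>_def)
  have "0 < r" using r by simp
  from integral_functional_continuous[OF this w' uv c b lim]
  show "integrable (lebesgue_on \<Omega>) (\<lambda>x. w x * (sgn (u x) * \<bar>u x\<bar> powr (r - 1) * v x))"
    "(\<lambda>n. dwint w r (\<lambda>x. c n * u x + d n * v x) v) \<longlonglongrightarrow> dwint w r u v"
    by (simp_all add: \<phi>_def dwint_def)
qed

text \<open>Almost everywhere convergence on the domain gives almost everywhere convergence of
  increments on the product. Fatou then puts the limit into \<open>W\<close> and, as the potential
  is continuous and nonnegative, yields lower semicontinuity of \<open>P\<close> for every factor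
  \<open>t\<close> at once. The weighted integrals converge because their exponent is below
  \<open>q\<close>, where the sequence is bounded.\<close>

lemma W_compactness:
  assumes f: "\<And>n::nat. f n \<in> W" and bnd: "\<And>n. N (f n) \<le> bnd"
  shows "\<exists>(r :: nat \<Rightarrow> nat) u. strict_mono r \<and> u \<in> W \<and>
    (\<forall>w e. admissible_weight w \<longrightarrow> 0 < e \<longrightarrow> e < q \<longrightarrow> (\<lambda>n. wint w e (f (r n))) \<longlonglongrightarrow> wint w e u) \<and>
    (\<forall>t X L. 0 < t \<longrightarrow> X \<longlonglongrightarrow> L \<longrightarrow> (\<forall>n. P (\<lambda>x. t * f (r n) x) \<le> X n) \<longrightarrow> P (\<lambda>x. t * u x) \<le> L)"
proof -
  have "\<exists>g. g \<in> borel_measurable borel \<and> (\<forall>x. x \<notin> \<Omega> \<longrightarrow> g x = 0) \<and> (AE x in lebesgue. f n x = g x) \<and>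
    (\<integral>\<^sup>+x. ennreal (\<bar>g x\<bar> powr p) \<partial>lborel) < top \<and>
    gagliardo p (s * p) g = (\<integral>\<^sup>+z. ennreal (gagliardo_quotient p (s * p) (f n) z) \<partial>lebesgue)" for n
    by (rule Wsp0_representative[OF f \<Omega>_sets(1)])
  from choice[OF allI, OF this] obtain g where "\<forall>n. g n \<in> borel_measurable borel \<and> (\<forall>x. x \<notin> \<Omega> \<longrightarrow> g n x = 0) \<and>
    (AE x in lebesgue. f n x = g n x) \<and> (\<integral>\<^sup>+x. ennreal (\<bar>g n x\<bar> powr p) \<partial>lborel) < top \<and>
    gagliardo p (s * p) (g n) = (\<integral>\<^sup>+z. ennreal (gagliardo_quotient p (s * p) (f n) z) \<partial>lebesgue)" ..
  then have g: "\<And>n. g n \<in> borel_measurable borel" "\<And>n x. x \<notin> \<Omega> \<Longrightarrow> g n x = 0" "\<And>n. AE x in lebesgue. f n x = g n x"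
    "\<And>n. (\<integral>\<^sup>+x. ennreal (\<bar>g n x\<bar> powr p) \<partial>lborel) < top"
    "\<And>n. gagliardo p (s * p) (g n) = (\<integral>\<^sup>+z. ennreal (gagliardo_quotient p (s * p) (f n) z) \<partial>lebesgue)"
    by blast+
  define E where "E = bnd / b0"
  have bnd0: "0 \<le> bnd" using bnd[of 0] N_nonneg[of "f 0"] by linarith
  have "0 \<le> E" using bnd0 K_bounds(1) by (simp add: E_def)
  have fE: "(\<integral>\<^sup>+z. ennreal (gagliardo_quotient p (s * p) (f n) z) \<partial>lebesgue) \<le> ennreal E" for n
  proof (rule order_trans[OF quotient_N[OF f] ennreal_leI])
    show "N (f n) / b0 \<le> E" using bnd[of n] K_bounds(1) by (simp add: E_def divide_right_mono)
  qed
  have gE: "gagliardo p (s * p) (g n) \<le> ennreal E" for n using fE g(5) by simp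
  obtain r u where r: "strict_mono r" and u: "u \<in> borel_measurable borel" "\<And>x. x \<notin> \<Omega> \<Longrightarrow> u x = 0"
    and conv: "AE x in lborel. (\<lambda>n. g (r n) x) \<longlonglongrightarrow> u x"
    using bounded_gagliardo_AE_convergent_subseq[where u=g, OF sp exponents(7) p(1) \<Omega>_sets(1) \<Omega>_finite(1) g(1,4,2) gE \<open>0 \<le> E\<close>]
    by blast
  have "AE x in lebesgue. \<forall>n. f n x = g n x" using g(3) by (simp add: AE_all_countable)
  then have conv': "AE x in lebesgue. (\<lambda>n. f (r n) x) \<longlonglongrightarrow> u x"
    using AE_completion[OF conv] by eventually_elim simp
  have convD: "AE z in lebesgue. (\<lambda>n. increment (f (r n)) z) \<longlonglongrightarrow> increment u z"
    using AE_lebesgue_fst_snd[OF conv'] by eventually_elim (auto simp: increment_def intro!: tendsto_intros)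
  have um: "u \<in> borel_measurable lebesgue" using u(1) by (intro measurable_completion) simp
  have fm: "f n \<in> borel_measurable lebesgue" for n using f by (rule W_measurable)
  have power_bound: "\<exists>C\<ge>0. \<forall>n. (\<integral>\<^sup>+x. ennreal (\<bar>f n x\<bar> powr e) \<partial>lebesgue) \<le> ennreal C" if ep: "0 < e" "e \<le> q" for e
  proof -
    obtain D where D: "D > 0" "\<And>u. u \<in> W \<Longrightarrow> (\<integral>\<^sup>+x. ennreal (\<bar>u x\<bar> powr e) \<partial>lebesgue) \<le> ennreal (D * N u powr (e / p))"
      using sobolev_W[OF ep] by auto
    have "(\<integral>\<^sup>+x. ennreal (\<bar>f n x\<bar> powr e) \<partial>lebesgue) \<le> ennreal (D * bnd powr (e / p))" for n
    proof -
      have "D * N (f n) powr (e / p) \<le> D * bnd powr (e / p)"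
        using D(1) bnd N_nonneg ep p by (intro mult_left_mono powr_mono2) auto
      then show ?thesis using D(2)[OF f, of n] by (meson ennreal_leI order_trans)
    qed
    then show ?thesis using D(1) by (intro exI[of _ "D * bnd powr (e / p)"]) auto
  qed
  have uW: "u \<in> W"
  proof -
    obtain C where C: "\<And>n. (\<integral>\<^sup>+x. ennreal (\<bar>f n x\<bar> powr p) \<partial>lebesgue) \<le> ennreal C"
      using power_bound[of p] q p by auto
    have "(\<integral>\<^sup>+x. ennreal (\<bar>u x\<bar> powr p) \<partial>lebesgue) \<le> ennreal C"
    proof (rule nn_integral_fatou_tendsto[where f="\<lambda>n x. ennreal (\<bar>f (r n) x\<bar> powr p)", OF _ _ C tendsto_const])
      show "AE x in lebesgue. (\<lambda>n. ennreal (\<bar>f (r n) x\<bar> powr p)) \<longlonglongrightarrow> ennreal (\<bar>u x\<bar> powr p)"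
        using conv' by eventually_elim (use p in \<open>auto intro!: tendsto_ennrealI tendsto_powr2 tendsto_rabs\<close>)
      show "(\<lambda>x. ennreal (\<bar>f (r n) x\<bar> powr p)) \<in> borel_measurable lebesgue" for n using fm by measurable
    qed
    moreover have "(\<integral>\<^sup>+z. ennreal (gagliardo_quotient p (s * p) u z) \<partial>lebesgue) \<le> ennreal E"
    proof (rule nn_integral_fatou_tendsto[where f="\<lambda>n z. ennreal (gagliardo_quotient p (s * p) (f (r n)) z)", OF _ _ fE tendsto_const])
      show "AE z in lebesgue. (\<lambda>n. ennreal (gagliardo_quotient p (s * p) (f (r n)) z)) \<longlonglongrightarrow> ennreal (gagliardo_quotient p (s * p) u z)"
        using convD
      proof eventually_elim
        case (elim z)
        show ?case
        \<comment> \<open>On the diagonal the denominators vanish and all quotients are 0 by the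
          convention for division.\<close>
        proof (cases "norm (fst z - snd z) powr (real DIM('a) + s * p) = 0")
          case True
          then show ?thesis by (simp add: gagliardo_quotient_def)
        next
          case False
          then show ?thesis unfolding gagliardo_quotient_def
            using elim p by (intro tendsto_ennrealI tendsto_divide tendsto_const tendsto_powr2 tendsto_rabs) auto
        qed
      qed
      show "(\<lambda>z. ennreal (gagliardo_quotient p (s * p) (f (r n)) z)) \<in> borel_measurable lebesgue" for n using fm by measurable
    qed
    ultimately show ?thesis unfolding Wsp0_iff using um u(2) by (auto simp: order_le_less_trans)
  qed
  moreover have "(\<lambda>n. wint w e (f (r n))) \<longlonglongrightarrow> wint w e u" if w: "admissible_weight w" and e: "0 < e" "e < q" for w e
  proof -
    obtain C where C: "0 \<le> C" "\<And>n. (\<integral>\<^sup>+x. ennreal (\<bar>f n x\<bar> powr q) \<partial>lebesgue) \<le> ennreal C"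
      using power_bound[of q] e by auto
    have C': "(\<integral>\<^sup>+x. ennreal (\<bar>f (r n) x\<bar> powr q) \<partial>lebesgue_on \<Omega>) \<le> ennreal C" for n
      using nn_integral_lebesgue_on_le C(2) by (rule order_trans)
    have ae: "AE x in lebesgue_on \<Omega>. (\<lambda>n. f (r n) x) \<longlonglongrightarrow> u x"
      using conv' by (subst AE_restrict_space_iff) (auto elim!: eventually_mono)
    show ?thesis
      unfolding wint_def using w weights(5) W_lebesgue_on_measurable[OF f] W_lebesgue_on_measurable[OF uW]
      by (intro weighted_power_integral_tendsto[where c=cw, OF \<Omega>_finite(2) _ _ ae e C' C(1)]) (auto simp: admissible_weight_def)
  qed
  moreover have "P (\<lambda>x. t * u x) \<le> L" if t: "0 < t" and X: "X \<longlonglongrightarrow> L" and le: "\<And>n. P (\<lambda>x. t * f (r n) x) \<le> X n" for t X L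
  proof -
    have inc: "increment (\<lambda>x. t * v x) z = t * increment v z" for v z by (simp add: increment_def right_diff_distrib)
    have scale: "(\<lambda>x. t * v x) \<in> W" if "v \<in> W" for v using W_lincomb[OF that that, of t 0] by simp
    have Pnn: "(\<integral>\<^sup>+z. ennreal (K z * potential A (t * increment v z)) \<partial>lebesgue) = ennreal (P (\<lambda>x. t * v x))" if "v \<in> W" for v
      using nn_integral_eq_integral[OF kint_integrable_all(2)[OF scale[OF that]]] K_nonneg' potential_nonneg
      by (simp add: kint_def inc)
    have P0: "0 \<le> P v" for v unfolding kint_def using K_nonneg' potential_nonneg by (intro integral_nonneg_AE) auto
    have "(\<integral>\<^sup>+z. ennreal (K z * potential A (t * increment u z)) \<partial>lebesgue) \<le> ennreal L"
    proof (rule nn_integral_fatou_tendsto[where f="\<lambda>n z. ennreal (K z * potential A (t * increment (f (r n)) z))" and X="\<lambda>n. ennreal (X n)"])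
      show "AE z in lebesgue. (\<lambda>n. ennreal (K z * potential A (t * increment (f (r n)) z))) \<longlonglongrightarrow> ennreal (K z * potential A (t * increment u z))"
        using convD
      proof eventually_elim
        case (elim z)
        have "(\<lambda>n. potential A (t * increment (f (r n)) z)) \<longlonglongrightarrow> potential A (t * increment u z)"
          using DERIV_isCont[OF potential_deriv] by (rule isCont_tendsto_compose) (intro tendsto_intros elim)
        then show ?case by (intro tendsto_ennrealI tendsto_intros)
      qed
      show "(\<integral>\<^sup>+z. ennreal (K z * potential A (t * increment (f (r n)) z)) \<partial>lebesgue) \<le> ennreal (X n)" for n
        unfolding Pnn[OF f] using le by (rule ennreal_leI)
      show "(\<lambda>n. ennreal (X n)) \<longlonglongrightarrow> ennreal L" using X by (rule tendsto_ennrealI)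
      have [measurable]: "potential A \<in> borel_measurable borel" using potential_cont by (rule borel_measurable_continuous_onI)
      show "(\<lambda>z. ennreal (K z * potential A (t * increment (f (r n)) z))) \<in> borel_measurable lebesgue" for n
        using fm K_meas by measurable
    qed
    moreover have "0 \<le> L" using X le P0 by (intro LIMSEQ_le_const[OF X]) (auto intro: order_trans)
    ultimately show ?thesis unfolding Pnn[OF uW] by simp
  qed
  ultimately show ?thesis using r by blast
qed

end

section \<open>The fractional problem as an instance of the abstract scheme\<close>

context fractional_problem
begin

lemma W_scale: "u \<in> W \<Longrightarrow> (\<lambda>x. t * u x) \<in> W"
  using W_lincomb[of u u t 0] by simp

lemma N_scale:
  assumes "0 < t"
  shows "N (\<lambda>x. t * u x) = t powr p * N u"
proof -
  have "\<bar>increment (\<lambda>x. t * u x) z\<bar> powr p = t powr p * \<bar>increment u z\<bar> powr p" for z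
  proof -
    have "increment (\<lambda>x. t * u x) z = t * increment u z" by (simp add: increment_def right_diff_distrib)
    then show ?thesis using assms by (simp add: abs_mult powr_mult)
  qed
  then show ?thesis by (simp add: kint_def mult.left_commute[of _ "t powr p"])
qed

lemma wint_scale: "0 < t \<Longrightarrow> wint w r (\<lambda>x. t * u x) = t powr r * wint w r u"
  by (simp add: wint_def abs_mult powr_mult mult.left_commute[of _ "t powr r"])

lemma weights_admissible: "admissible_weight a" "admissible_weight b"
  using weights by (auto simp: admissible_weight_def)

lemma instance_nehari_functionals:
  "\<exists>C. nehari_functionals W N P B H (wint a m1) (wint b m2) dkint (dwint a m1) (dwint b m2)
     cA (CA / l) C l p m m1 m2"
proof -
  have r: "0 < m1" "m1 \<le> q" "0 < m2" "m2 \<le> q" "1 < m1" "1 < m2" using exponents q by auto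
  obtain D1 where D1: "D1 > 0" "\<And>u. u \<in> W \<Longrightarrow> \<bar>wint a m1 u\<bar> \<le> D1 * N u powr (m1 / p)"
    using wint_bound[OF r(1,2)] weights_admissible by auto
  obtain D2 where D2: "D2 > 0" "\<And>u. u \<in> W \<Longrightarrow> \<bar>wint b m2 u\<bar> \<le> D2 * N u powr (m2 / p)"
    using wint_bound[OF r(3,4)] weights_admissible by auto
  define C where "C = D1 + D2"
  have "nehari_functionals W N P B H (wint a m1) (wint b m2) dkint (dwint a m1) (dwint b m2)
     cA (CA / l) C l p m m1 m2"
  proof
    fix u v :: "'a \<Rightarrow> real" and t e :: real and c d :: "nat \<Rightarrow> real"
    show "1 < m1" "m1 < l" "l \<le> p" "p \<le> m" "m < m2" using exponents by auto
    show "0 < cA" "0 < CA / l" "0 < C" using A_growth l D1 D2 by (auto simp: C_def)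
    show "\<exists>u\<in>W. 0 < wint b m2 u"
      unfolding wint_def
      by (rule Wsp0_positive_weighted_integral[OF dom s p(2) r(3) weights(2,4,6)])
    assume u: "u \<in> W"
    note int = kint_integrable_all[OF u]
    show "(\<lambda>x. t * u x) \<in> W" using u by (rule W_scale)
    show "0 \<le> N u" by (rule N_nonneg)
    show "cA * N u \<le> B u"
      using kint_mono[OF int(1,3), of cA 1] A_growth(3) by simp
    show "B u \<le> p * P u"
      using kint_mono[OF int(3,2), of 1 p] A_i(2) by simp
    show "P u \<le> CA / l * N u"
      using kint_mono[OF int(2,1), of 1 "CA / l"] potential_bound potential_nonneg by (simp add: abs_of_nonneg)
    show "(l - 1) * B u \<le> H u"
      using kint_mono[OF int(3,4), of "l - 1" 1] A_ii(1) by simp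
    show "H u \<le> (m - 1) * B u"
      using kint_mono[OF int(4,3), of 1 "m - 1"] A_ii(2) by simp
    show "\<bar>wint a m1 u\<bar> \<le> C * N u powr (m1 / p)" "\<bar>wint b m2 u\<bar> \<le> C * N u powr (m2 / p)"
      using D1(2)[OF u] D2(2)[OF u] D1(1) D2(1) powr_ge_zero[of "N u" "m1 / p"] powr_ge_zero[of "N u" "m2 / p"]
      unfolding C_def distrib_right by (smt (verit) mult_nonneg_nonneg)+
    {
      assume t: "0 < t"
      show "N (\<lambda>x. t * u x) = t powr p * N u" using t by (rule N_scale)
      show "wint a m1 (\<lambda>x. t * u x) = t powr m1 * wint a m1 u" "wint b m2 (\<lambda>x. t * u x) = t powr m2 * wint b m2 u"
        using t by (simp_all add: wint_scale)
      show "((\<lambda>t. P (\<lambda>x. t * u x)) has_real_derivative B (\<lambda>x. t * u x) / t) (at t)"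
        by (rule kint_ray_derivative[OF u t potential_deriv potential_bound A_cont A_growth(4)])
      \<comment> \<open>The product rule for A(t) t produces the summand A(t) next to A'(t) t; after
        multiplication by the argument the two give \<open>B\<close> and \<open>H\<close>.\<close>
      have "((\<lambda>t. B (\<lambda>x. t * u x)) has_real_derivative kint (\<lambda>x. (A' x * x + A x) * x) (\<lambda>x. t * u x) / t) (at t)"
      proof (rule kint_ray_derivative[OF u t _ A_mult_bound])
        show "((\<lambda>t. A t * t) has_real_derivative A' x * x + A x) (at x)" for x
          by (auto intro!: derivative_eq_intros A_deriv(1))
        show "continuous_on UNIV (\<lambda>x. A' x * x + A x)" by (intro continuous_intros A_deriv A_cont)
        show "\<bar>A' x * x + A x\<bar> \<le> ((m - 1) * CA + CA) * \<bar>x\<bar> powr (p - 1)" for x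
          using A'_mult_bound[of x] A_growth(4)[of x] unfolding distrib_right by linarith
      qed
      moreover have "kint (\<lambda>x. (A' x * x + A x) * x) v = H v + B v" if "v \<in> W" for v
      proof -
        have "H v + B v = (\<integral>z. K z * ((increment v z)\<^sup>2 * A' (increment v z)) + K z * (A (increment v z) * increment v z) \<partial>lebesgue)"
          unfolding kint_def using kint_integrable_all[OF that] by simp
        also have "\<dots> = kint (\<lambda>x. (A' x * x + A x) * x) v"
          unfolding kint_def by (intro Bochner_Integration.integral_cong) (auto simp: algebra_simps power2_eq_square)
        finally show ?thesis by simp
      qed
      ultimately show "((\<lambda>t. B (\<lambda>x. t * u x)) has_real_derivative (H (\<lambda>x. t * u x) + B (\<lambda>x. t * u x)) / t) (at t)"
        using W_scale[OF u] by simp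
    }
    assume v: "v \<in> W"
    show "(\<lambda>x. u x + t * v x) \<in> W" using W_lincomb[OF u v, of 1 t] by simp
    show "((\<lambda>e. P (\<lambda>x. u x + e * v x)) has_real_derivative dkint (\<lambda>x. u x + e * v x) v) (at e)"
      by (rule dkint_line[OF u v])
    show "((\<lambda>e. wint a m1 (\<lambda>x. u x + e * v x)) has_real_derivative m1 * dwint a m1 (\<lambda>x. u x + e * v x) v) (at e)"
      "((\<lambda>e. wint b m2 (\<lambda>x. u x + e * v x)) has_real_derivative m2 * dwint b m2 (\<lambda>x. u x + e * v x) v) (at e)"
      using wint_line[OF u v] weights_admissible r by auto
    show "dkint u (\<lambda>x. t * v x) = t * dkint u v"
    proof -
      have "increment (\<lambda>x. t * v x) z = t * increment v z" for z by (simp add: increment_def right_diff_distrib)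
      then show ?thesis by (simp add: dkint_def mult.left_commute)
    qed
    show "dwint a m1 u (\<lambda>x. t * v x) = t * dwint a m1 u v" "dwint b m2 u (\<lambda>x. t * v x) = t * dwint b m2 u v"
      by (simp_all add: dwint_def mult.left_commute)
    assume "c \<longlonglongrightarrow> 1" "d \<longlonglongrightarrow> 0"
    then show "(\<lambda>n. dkint (\<lambda>x. c n * u x + d n * v x) v) \<longlonglongrightarrow> dkint u v"
      "(\<lambda>n. dwint a m1 (\<lambda>x. c n * u x + d n * v x) v) \<longlonglongrightarrow> dwint a m1 u v"
      "(\<lambda>n. dwint b m2 (\<lambda>x. c n * u x + d n * v x) v) \<longlonglongrightarrow> dwint b m2 u v"
      using dkint_continuous[OF u v] dwint_continuous(2)[OF u v] weights_admissible r by auto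
  next
    fix f :: "nat \<Rightarrow> 'a \<Rightarrow> real" and bnd
    assume f: "\<And>n. f n \<in> W" "\<And>n. N (f n) \<le> bnd"
    have m: "0 < m1" "m1 < q" "0 < m2" "m2 < q" using exponents q by auto
    show "\<exists>(r :: nat \<Rightarrow> nat) u. strict_mono r \<and> u \<in> W \<and> (\<lambda>n. wint a m1 (f (r n))) \<longlonglongrightarrow> wint a m1 u \<and>
        (\<lambda>n. wint b m2 (f (r n))) \<longlonglongrightarrow> wint b m2 u \<and>
        (\<forall>t X L. 0 < t \<longrightarrow> X \<longlonglongrightarrow> L \<longrightarrow> (\<forall>n. P (\<lambda>x. t * f (r n) x) \<le> X n) \<longrightarrow> P (\<lambda>x. t * u x) \<le> L)"
      using W_compactness[OF f] weights_admissible m by meson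
  qed
  then show ?thesis ..
qed

lemma set_integral_lebesgue_on: "(LINT x:\<Omega>|lebesgue. f x) = (\<integral>x. f x \<partial>lebesgue_on \<Omega>)" for f :: "'a \<Rightarrow> real"
  by (simp add: set_lebesgue_integral_def integral_restrict_space)

lemma energy_eq:
  "energy A K \<Omega> lam a b m1 m2 u = P u - lam / m1 * wint a m1 u - 1 / m2 * wint b m2 u"
proof -
  have "(\<lambda>(x, y). potential A (u x - u y) * K (x, y)) = (\<lambda>z. K z * potential A (increment u z))"
    by (auto simp: increment_def mult.commute)
  then show ?thesis unfolding energy_def set_integral_lebesgue_on by (simp add: kint_def wint_def)
qed

lemma weak_solution_iff:
  assumes u: "u \<in> W"
  shows "weak_solution s p A K \<Omega> lam a b m1 m2 u \<longleftrightarrow> (\<forall>v\<in>W. dkint u v = lam * dwint a m1 u v + dwint b m2 u v)"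
proof -
  have "(\<lambda>(x, y). A (u x - u y) * (v x - v y) * K (x, y)) = (\<lambda>z. K z * (A (increment u z) * increment v z))" for v
    by (auto simp: increment_def mult_ac)
  moreover have "(LINT x:\<Omega>|lebesgue. lam * a x * \<bar>u x\<bar> powr (m1 - 2) * u x * v x + b x * \<bar>u x\<bar> powr (m2 - 2) * u x * v x)
     = lam * dwint a m1 u v + dwint b m2 u v" if v: "v \<in> W" for v
  proof -
    have sgn: "\<bar>t\<bar> powr (r - 2) * t = sgn t * \<bar>t\<bar> powr (r - 1)" for t r :: real
    proof (cases "t = 0")
      case False
      have "\<bar>t\<bar> powr (r - 1) = \<bar>t\<bar> powr (r - 2) * \<bar>t\<bar>"
        using powr_mult_base[of "\<bar>t\<bar>" "r - 2"] by (simp add: mult.commute)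
      then show ?thesis using False by (simp add: sgn_if)
    qed simp
    have r: "1 < m1" "m1 \<le> q" "1 < m2" "m2 \<le> q" using exponents q by auto
    have "(LINT x:\<Omega>|lebesgue. lam * a x * \<bar>u x\<bar> powr (m1 - 2) * u x * v x + b x * \<bar>u x\<bar> powr (m2 - 2) * u x * v x)
      = (\<integral>x. lam * (a x * (sgn (u x) * \<bar>u x\<bar> powr (m1 - 1) * v x)) + b x * (sgn (u x) * \<bar>u x\<bar> powr (m2 - 1) * v x) \<partial>lebesgue_on \<Omega>)"
      unfolding set_integral_lebesgue_on sgn[symmetric] by (simp add: mult_ac)
    also have "\<dots> = lam * dwint a m1 u v + dwint b m2 u v"
      unfolding dwint_def
      using dwint_continuous(1)[OF u v weights_admissible(1) r(1,2) tendsto_const tendsto_const]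
        dwint_continuous(1)[OF u v weights_admissible(2) r(3,4) tendsto_const tendsto_const]
      by simp
    finally show ?thesis .
  qed
  ultimately show ?thesis unfolding weak_solution_def using u by (simp add: dkint_def)
qed

theorem ground_state_minus_ex:
  "\<exists>lam0>0. \<forall>lam. 0 < lam \<and> lam < lam0 \<longrightarrow>
    (\<exists>u. ground_state_minus s p A K \<Omega> lam a b m1 m2 u \<and> energy A K \<Omega> lam a b m1 m2 u > 0)"
proof -
  obtain C where "nehari_functionals W N P B H (wint a m1) (wint b m2) dkint (dwint a m1) (dwint b m2)
     cA (CA / l) C l p m m1 m2"
    using instance_nehari_functionals by blast
  then interpret F: nehari_functionals W N P B H "wint a m1" "wint b m2" dkint "dwint a m1" "dwint b m2"
     cA "CA / l" C l p m m1 m2 .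
  have J: "F.J lam = energy A K \<Omega> lam a b m1 m2" for lam
    by (auto simp: F.J_def energy_eq)
  have NM: "nehari_minus W (F.J lam) = F.NM lam" for lam
  proof -
    \<comment> \<open>Moving from \<open>u\<close> in direction \<open>u\<close> is moving along the
      ray, with the parameter shifted by 1.\<close>
    have pairing: "derivative_pairing (F.J lam) u u = F.fib1 lam u 1" if u: "u \<in> W" for u
    proof -
      have "((\<lambda>t. F.J lam (\<lambda>x. (1 + t) * u x)) has_real_derivative F.fib1 lam u 1 * 1) (at 0)"
        by (rule DERIV_chain2[where f="\<lambda>t. F.J lam (\<lambda>x. t * u x)"])
          (use F.fib_deriv(1)[OF u, of 1 lam] in \<open>auto intro!: derivative_eq_intros\<close>)
      then have "deriv (\<lambda>t. F.J lam (\<lambda>x. (1 + t) * u x)) 0 = F.fib1 lam u 1"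
        by (intro DERIV_imp_deriv) simp
      then show ?thesis by (simp add: derivative_pairing_def distrib_right)
    qed
    \<comment> \<open>\<open>fib1\<close> equals the derivative of the fibering map on the positive
      half-line only, an open neighbourhood of 1, which determines the second derivative
      there.\<close>
    have second: "deriv (deriv (fibering (F.J lam) u)) 1 = F.fib2 lam u 1" if u: "u \<in> W" for u
    proof (rule DERIV_imp_deriv)
      have "F.fib1 lam u t = deriv (fibering (F.J lam) u) t" if "0 < t" for t
        unfolding fibering_def[abs_def] using F.fib_deriv(1)[OF u that, THEN DERIV_imp_deriv] by simp
      then show "(deriv (fibering (F.J lam) u) has_real_derivative F.fib2 lam u 1) (at 1)"
        by (intro has_field_derivative_transform_within_open[OF F.fib_deriv(2)[OF u], of 1 "{0<..}"]) auto
    qed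
    show ?thesis
      using pairing second N_eq_0_iff by (auto simp: nehari_minus_def nehari_def F.NM_def)
  qed
  obtain lam0 where lam0: "lam0 > 0" "\<And>lam. 0 < lam \<Longrightarrow> lam < lam0 \<Longrightarrow>
     \<exists>u\<in>F.NM lam. (\<forall>w\<in>F.NM lam. F.J lam u \<le> F.J lam w) \<and> 0 < F.J lam u \<and>
        (\<forall>v\<in>W. dkint u v = lam * dwint a m1 u v + dwint b m2 u v)"
    using F.ground_state_ex by blast
  have "\<exists>u. ground_state_minus s p A K \<Omega> lam a b m1 m2 u \<and> energy A K \<Omega> lam a b m1 m2 u > 0"
    if lam: "0 < lam" "lam < lam0" for lam
  proof -
    obtain u where u: "u \<in> F.NM lam" "\<And>w. w \<in> F.NM lam \<Longrightarrow> F.J lam u \<le> F.J lam w" "0 < F.J lam u"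
      "\<forall>v\<in>W. dkint u v = lam * dwint a m1 u v + dwint b m2 u v"
      using lam0(2)[OF lam] by blast
    have "u \<in> W" using u(1) by (simp add: F.NM_def)
    then have "weak_solution s p A K \<Omega> lam a b m1 m2 u" using u(4) by (simp add: weak_solution_iff)
    moreover have "ereal (F.J lam u) = (INF w\<in>F.NM lam. ereal (F.J lam w))"
      using u(1,2) by (intro antisym INF_greatest INF_lower) auto
    ultimately have "ground_state_minus s p A K \<Omega> lam a b m1 m2 u"
      using u(1) unfolding ground_state_minus_def Let_def J[symmetric] NM by blast
    then show ?thesis using u(3) unfolding J by blast
  qed
  then show ?thesis using lam0(1) by blast
qed

end

theorem theorem1p3:
  fixes \<Omega> :: "'a::euclidean_space set"
    and s l p m m1 m2 cA CA b0 b1 :: real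
    and A A' A'' :: "real \<Rightarrow> real"
    and K :: "'a \<times> 'a \<Rightarrow> real"
    and a b :: "'a \<Rightarrow> real"
  assumes dim: "DIM('a) \<ge> 2"
    and dom: "smooth_bounded_domain \<Omega>"
    and s: "0 < s" "s < 1"
    and exponents: "1 < m1" "m1 < l" "l \<le> p" "p \<le> m" "m < m2"
      "m2 < real DIM('a) * p / (real DIM('a) - s * p)"
      "m < real DIM('a) / s"
      "(m2 - 1) * (m - l) < (m2 - l) * (m - m1)"
    and A_odd: "\<And>t. A (- t) = - A t"
    and A_C2: "\<And>t. (A has_real_derivative A' t) (at t)"
      "\<And>t. (A' has_real_derivative A'' t) (at t)"
      "continuous_on UNIV A''"
    and A_convex: "strictly_convex (potential A)"
    and A_growth: "cA > 0" "CA > 0"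
      "\<And>t. A t * t \<ge> cA * \<bar>t\<bar> powr p"
      "\<And>t. \<bar>A t\<bar> \<le> CA * \<bar>t\<bar> powr (p - 1)"
    and A_i: "\<And>t. l * potential A t \<le> A t * t" "\<And>t. A t * t \<le> p * potential A t"
    and A_ii: "\<And>t. (l - 1) * (A t * t) \<le> t\<^sup>2 * A' t" "\<And>t. t\<^sup>2 * A' t \<le> (m - 1) * (A t * t)"
    and A_iii: "\<And>t. (l - 2) * A' t \<le> A'' t * t" "\<And>t. A'' t * t \<le> (m - 2) * A' t"
    and K_meas: "K \<in> borel_measurable lebesgue"
    and K_nonneg: "\<And>x y. K (x, y) \<ge> 0"
    and K_bounds: "0 < b0" "b0 \<le> b1"
      "\<And>x y. x \<noteq> y \<Longrightarrow> b0 \<le> K (x, y) * norm (x - y) powr (real DIM('a) + s * p)"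
      "\<And>x y. x \<noteq> y \<Longrightarrow> K (x, y) * norm (x - y) powr (real DIM('a) + s * p) \<le> b1"
    and weights: "a \<in> Linfty \<Omega>" "b \<in> Linfty \<Omega>"
      "\<not> (AE x in lebesgue_on \<Omega>. max (a x) 0 = 0)"
      "\<not> (AE x in lebesgue_on \<Omega>. max (b x) 0 = 0)"
  shows "\<exists>lam0>0. \<forall>lam. 0 < lam \<and> lam < lam0 \<longrightarrow>
    (\<exists>u. ground_state_minus s p A K \<Omega> lam a b m1 m2 u \<and>
         energy A K \<Omega> lam a b m1 m2 u > 0)"
proof -
  obtain ca where ca: "AE x in lebesgue_on \<Omega>. \<bar>a x\<bar> \<le> ca" "a \<in> borel_measurable (lebesgue_on \<Omega>)"
    using weights(1) by (auto simp: Linfty_def)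
  obtain cb where cb: "AE x in lebesgue_on \<Omega>. \<bar>b x\<bar> \<le> cb" "b \<in> borel_measurable (lebesgue_on \<Omega>)"
    using weights(2) by (auto simp: Linfty_def)
  define cw where "cw = \<bar>ca\<bar> + \<bar>cb\<bar>"
  have "s * p < real DIM('a)"
  proof -
    have "s * p \<le> s * m" using s exponents by (intro mult_left_mono) auto
    also have "\<dots> < real DIM('a)" using s exponents(7) by (simp add: pos_less_divide_eq mult.commute)
    finally show ?thesis .
  qed
  moreover have "continuous_on UNIV A'"
    using A_C2(2) by (meson DERIV_isCont continuous_at_imp_continuous_on)
  moreover have "AE x in lebesgue_on \<Omega>. \<bar>a x\<bar> \<le> cw" using ca(1) by eventually_elim (simp add: cw_def)
  moreover have "AE x in lebesgue_on \<Omega>. \<bar>b x\<bar> \<le> cw" using cb(1) by eventually_elim (simp add: cw_def)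
  moreover have "0 \<le> cw" by (simp add: cw_def)
  ultimately interpret fractional_problem \<Omega> s l p m m1 m2 cA CA b0 b1 cw A A' K a b
    using dom s exponents(1-6) A_odd A_C2(1) A_growth A_i A_ii K_meas K_nonneg K_bounds(1,3,4)
      ca(2) cb(2) weights(4)
    unfolding smooth_bounded_domain_def by unfold_locales blast+
  show ?thesis by (rule ground_state_minus_ex)
qed

end
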